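(* Let $p:(\mathcal D,K)\to(\mathcal C,J)$ be a cartesian local fibration. An arrow of $\mathcal D$ is locally cartesian if and only if it is $K$-cartesian.
   Context: Sites are such that their categories of sheaves are Grothendieck toposes. For a site $(\mathcal C,J)$: $\widehat{\mathcal C}_J$ is the topos of sheaves, $a_J$ is sheafification, $l_J:\mathcal C\to\widehat{\mathcal C}_J$ is Yoneda followed by $a_J$. A comorphism of sites $p:(\mathcal D,K)\to(\mathcal C,J)$ is a functor such that every $J$-covering sieve on $p(d)$ contains the image $p(R)$ of a $K$-covering sieve $R$ on $d$; it induces a geometric morphism $C_p:\widehat{\mathcal D}_K\to\widehat{\mathcal C}_J$ with $C_p^*(E)=a_K(E\circ p^{op})$. For an object $d$ of $\mathcal D$ let $\eta(d):l_K(d)\to C_p^*l_Jp(d)\simeq a_K(\mathrm{Hom}_{\mathcal C}(p(-),p(d)))$ be the sheafification of $g\mapsto p(g)$. An arrow $g:d'\to d$ of $\mathcal D$ is locally cartesian if its image $\eta_{\mathcal D}(g)=(l_K(g),l_Jp(g))$ is a cartesian arrow of the comma category $(\widehat{\mathcal D}_K/C_p^* )$ fibred over $\widehat{\mathcal C}_J$; equivalently, if the square formed by $l_K(g)$, $\eta(d')$, $\eta(d)$, $C_p^*l_Jp(g)$ is a pullback in $\widehat{\mathcal D}_K$. A comorphism of sites $p$ is a local fibration if for every $u:c\to p(d)$ in $\mathcal C$ there are a $J$-covering family $(u_i:p(d_i)\to c)_i$ and locally cartesian arrows $\widehat{u_i}:d_i\to d$ with $uu_i=p(\widehat{u_i})$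 for all $i$. A local fibration $p:(\mathcal D,K)\to(\mathcal C,J)$ is cartesian if $\mathcal D$ has finite limits and $p$ preserves them. In that setting an arrow $f:d'\to d$ of $\mathcal D$ is $K$-cartesian if there is a $K$-covering family $(u_i:d_i\to d)_i$ such that for every $i$ the pullback of $f$ along $u_i$ is a locally cartesian arrow. *)

theory Defs
  imports Main "HOL-Library.FuncSet"
begin

record ('o, 'a) category =
  Obj :: "'o set"
  Arr :: "'a set"
  Dom :: "'a \<Rightarrow> 'o"
  Cod :: "'a \<Rightarrow> 'o"
  Id :: "'o \<Rightarrow> 'a"
  Comp :: "'a \<Rightarrow> 'a \<Rightarrow> 'a"   \<comment> \<open>\<open>Comp C g f\<close> is \<open>g\<close> after \<open>f\<close>\<close>

definition hom :: "('o, 'a) category \<Rightarrow> 'o \<Rightarrow> 'o \<Rightarrow> 'a set" where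
  "hom C a b = {f \<in> Arr C. Dom C f = a \<and> Cod C f = b}"

definition category :: "('o, 'a) category \<Rightarrow> bool" where
  "category C \<longleftrightarrow>
     (\<forall>f\<in>Arr C. Dom C f \<in> Obj C \<and> Cod C f \<in> Obj C) \<and>
     (\<forall>a\<in>Obj C. Id C a \<in> hom C a a) \<and>
     (\<forall>f\<in>Arr C. \<forall>g\<in>Arr C. Cod C f = Dom C g \<longrightarrow> Comp C g f \<in> hom C (Dom C f) (Cod C g)) \<and>
     (\<forall>f\<in>Arr C. Comp C f (Id C (Dom C f)) = f \<and> Comp C (Id C (Cod C f)) f = f) \<and>
     (\<forall>f\<in>Arr C. \<forall>g\<in>Arr C. \<forall>h\<in>Arr C. Cod C f = Dom C g \<longrightarrow> Cod C g = Dom C h \<longrightarrow>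
        Comp C h (Comp C g f) = Comp C (Comp C h g) f)"

record ('o1, 'a1, 'o2, 'a2) func =
  ObM :: "'o1 \<Rightarrow> 'o2"
  ArM :: "'a1 \<Rightarrow> 'a2"

definition is_functor ::
  "('o1, 'a1) category \<Rightarrow> ('o2, 'a2) category \<Rightarrow> ('o1, 'a1, 'o2, 'a2) func \<Rightarrow> bool" where
  "is_functor C D F \<longleftrightarrow>
     (\<forall>a\<in>Obj C. ObM F a \<in> Obj D) \<and>
     (\<forall>f\<in>Arr C. ArM F f \<in> hom D (ObM F (Dom C f)) (ObM F (Cod C f))) \<and>
     (\<forall>a\<in>Obj C. ArM F (Id C a) = Id D (ObM F a)) \<and>
     (\<forall>f\<in>Arr C. \<forall>g\<in>Arr C. Cod C f = Dom C g \<longrightarrow>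
        ArM F (Comp C g f) = Comp D (ArM F g) (ArM F f))"

definition fcomp ::
  "('o2, 'a2, 'o3, 'a3) func \<Rightarrow> ('o1, 'a1, 'o2, 'a2) func \<Rightarrow> ('o1, 'a1, 'o3, 'a3) func" where
  "fcomp G F = \<lparr>ObM = ObM G \<circ> ObM F, ArM = ArM G \<circ> ArM F\<rparr>"

definition cartesian_arrow ::
  "('oe, 'ae) category \<Rightarrow> ('ob, 'ab) category \<Rightarrow> ('oe, 'ae, 'ob, 'ab) func \<Rightarrow> 'ae \<Rightarrow> bool" where
  "cartesian_arrow E B \<pi> f \<longleftrightarrow> f \<in> Arr E \<and>
     (\<forall>h\<in>Arr E. \<forall>k\<in>hom B (ObM \<pi> (Dom E h)) (ObM \<pi> (Dom E f)).
        Cod E h = Cod E f \<longrightarrow> Comp B (ArM \<pi> f) k = ArM \<pi> h \<longrightarrow>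
        (\<exists>!m. m \<in> hom E (Dom E h) (Dom E f) \<and> ArM \<pi> m = k \<and> Comp E f m = h))"

text \<open>For a functor \<open>G\<close> from \<open>B\<close> to \<open>A\<close>, the comma category \<open>(A / G)\<close>: its objects are the
  triples \<open>(a, h, b)\<close> with \<open>h\<close> an arrow from \<open>a\<close> to \<open>G b\<close>, its arrows the pairs \<open>(f, g)\<close>
  making the evident square commute, recorded together with their domain and codomain.\<close>

definition comma_obj ::
  "('oa, 'aa) category \<Rightarrow> ('ob, 'ab) category \<Rightarrow> ('ob, 'ab, 'oa, 'aa) func \<Rightarrow> ('oa \<times> 'aa \<times> 'ob) set"
where
  "comma_obj A B G = {(a, h, b). a \<in> Obj A \<and> b \<in> Obj B \<and> h \<in> hom A a (ObM G b)}"

definition comma ::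
  "('oa, 'aa) category \<Rightarrow> ('ob, 'ab) category \<Rightarrow> ('ob, 'ab, 'oa, 'aa) func \<Rightarrow>
   ('oa \<times> 'aa \<times> 'ob, ('oa \<times> 'aa \<times> 'ob) \<times> ('aa \<times> 'ab) \<times> ('oa \<times> 'aa \<times> 'ob)) category"
where
  "comma A B G =
     \<lparr>Obj = comma_obj A B G,
      Arr = {((a', h', b'), (f, g), (a, h, b)).
               (a', h', b') \<in> comma_obj A B G \<and> (a, h, b) \<in> comma_obj A B G \<and>
               f \<in> hom A a' a \<and> g \<in> hom B b' b \<and> Comp A h f = Comp A (ArM G g) h'},
      Dom = (\<lambda>(s, _, _). s),
      Cod = (\<lambda>(_, _, t). t),
      Id = (\<lambda>(a, h, b). ((a, h, b), (Id A a, Id B b), (a, h, b))),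
      Comp = (\<lambda>(_, (f2, g2), t) (s, (f1, g1), _). (s, (Comp A f2 f1, Comp B g2 g1), t))\<rparr>"

definition comma_proj ::
  "('oa \<times> 'aa \<times> 'ob, ('oa \<times> 'aa \<times> 'ob) \<times> ('aa \<times> 'ab) \<times> ('oa \<times> 'aa \<times> 'ob), 'ob, 'ab) func"
where
  "comma_proj = \<lparr>ObM = (\<lambda>(_, _, b). b), ArM = (\<lambda>(_, (_, g), _). g)\<rparr>"

definition cone ::
  "('oi, 'ai) category \<Rightarrow> ('o, 'a) category \<Rightarrow> ('oi, 'ai, 'o, 'a) func \<Rightarrow> 'o \<Rightarrow> ('oi \<Rightarrow> 'a) \<Rightarrow> bool"
where
  "cone I C F a l \<longleftrightarrow> a \<in> Obj C \<and>
     (\<forall>i\<in>Obj I. l i \<in> hom C a (ObM F i)) \<and>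
     (\<forall>s\<in>Arr I. Comp C (ArM F s) (l (Dom I s)) = l (Cod I s))"

definition limit_cone ::
  "('oi, 'ai) category \<Rightarrow> ('o, 'a) category \<Rightarrow> ('oi, 'ai, 'o, 'a) func \<Rightarrow> 'o \<Rightarrow> ('oi \<Rightarrow> 'a) \<Rightarrow> bool"
where
  "limit_cone I C F a l \<longleftrightarrow> cone I C F a l \<and>
     (\<forall>b m. cone I C F b m \<longrightarrow>
        (\<exists>!h. h \<in> hom C b a \<and> (\<forall>i\<in>Obj I. Comp C (l i) h = m i)))"

definition finite_category :: "('o, 'a) category \<Rightarrow> bool" where
  "finite_category I \<longleftrightarrow> category I \<and> finite (Obj I) \<and> finite (Arr I)"

text \<open>Every finite category is isomorphic to one whose objects and arrows are natural numbers,
  so these suffice as shapes of finite diagrams.\<close>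

definition has_finite_limits :: "('o, 'a) category \<Rightarrow> bool" where
  "has_finite_limits C \<longleftrightarrow>
     (\<forall>(I :: (nat, nat) category) F. finite_category I \<longrightarrow> is_functor I C F \<longrightarrow>
        (\<exists>a l. limit_cone I C F a l))"

definition preserves_finite_limits ::
  "('o1, 'a1) category \<Rightarrow> ('o2, 'a2) category \<Rightarrow> ('o1, 'a1, 'o2, 'a2) func \<Rightarrow> bool" where
  "preserves_finite_limits D C p \<longleftrightarrow>
     (\<forall>(I :: (nat, nat) category) F a l. finite_category I \<longrightarrow> is_functor I D F \<longrightarrow>
        limit_cone I D F a l \<longrightarrow>
        limit_cone I C (fcomp p F) (ObM p a) (\<lambda>i. ArM p (l i)))"

text \<open>\<open>is_pullback C f u q r\<close>: the square \<open>f r = u q\<close> is a pullback, so that \<open>q\<close> is the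
  pullback of \<open>f\<close> along \<open>u\<close>.\<close>

definition is_pullback :: "('o, 'a) category \<Rightarrow> 'a \<Rightarrow> 'a \<Rightarrow> 'a \<Rightarrow> 'a \<Rightarrow> bool" where
  "is_pullback C f u q r \<longleftrightarrow>
     f \<in> Arr C \<and> u \<in> Arr C \<and> q \<in> Arr C \<and> r \<in> Arr C \<and>
     Cod C f = Cod C u \<and> Dom C q = Dom C r \<and> Cod C q = Dom C u \<and> Cod C r = Dom C f \<and>
     Comp C f r = Comp C u q \<and>
     (\<forall>q'\<in>Arr C. \<forall>r'\<in>Arr C. Dom C q' = Dom C r' \<longrightarrow> Cod C q' = Dom C u \<longrightarrow>
        Cod C r' = Dom C f \<longrightarrow> Comp C f r' = Comp C u q' \<longrightarrow>
        (\<exists>!h. h \<in> hom C (Dom C q') (Dom C q) \<and> Comp C q h = q' \<and> Comp C r h = r'))"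

definition sieve :: "('o, 'a) category \<Rightarrow> 'o \<Rightarrow> 'a set \<Rightarrow> bool" where
  "sieve C c R \<longleftrightarrow> R \<subseteq> {f \<in> Arr C. Cod C f = c} \<and>
     (\<forall>f\<in>R. \<forall>g\<in>Arr C. Cod C g = Dom C f \<longrightarrow> Comp C f g \<in> R)"

definition sieve_pullback :: "('o, 'a) category \<Rightarrow> 'a \<Rightarrow> 'a set \<Rightarrow> 'a set" where
  "sieve_pullback C h R = {g \<in> Arr C. Cod C g = Dom C h \<and> Comp C h g \<in> R}"

definition grothendieck_topology :: "('o, 'a) category \<Rightarrow> ('o \<Rightarrow> 'a set set) \<Rightarrow> bool" where
  "grothendieck_topology C J \<longleftrightarrow>
     (\<forall>c\<in>Obj C. \<forall>R\<in>J c. sieve C c R) \<and>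
     (\<forall>c\<in>Obj C. {f \<in> Arr C. Cod C f = c} \<in> J c) \<and>
     (\<forall>h\<in>Arr C. \<forall>R\<in>J (Cod C h). sieve_pullback C h R \<in> J (Dom C h)) \<and>
     (\<forall>c\<in>Obj C. \<forall>S\<in>J c. \<forall>R. sieve C c R \<longrightarrow>
        (\<forall>f\<in>S. sieve_pullback C f R \<in> J (Dom C f)) \<longrightarrow> R \<in> J c)"

definition generated_sieve :: "('o, 'a) category \<Rightarrow> 'a set \<Rightarrow> 'a set" where
  "generated_sieve C U = {Comp C u g | u g. u \<in> U \<and> g \<in> Arr C \<and> Cod C g = Dom C u}"

definition covering_family ::
  "('o, 'a) category \<Rightarrow> ('o \<Rightarrow> 'a set set) \<Rightarrow> 'o \<Rightarrow> 'a set \<Rightarrow> bool" where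
  "covering_family C J c U \<longleftrightarrow>
     U \<subseteq> {f \<in> Arr C. Cod C f = c} \<and> generated_sieve C U \<in> J c"

text \<open>Sets are the subsets of an infinite type \<open>'u\<close>, which plays the role of a universe. An
  index set \<open>A\<close> is small when \<open>'u\<close> is closed under \<open>A\<close>-indexed families, that is, when the
  cardinal of \<open>'u\<close> is not increased by raising it to the power of the cardinal of \<open>A\<close>. A site
  is required to be locally small and generated by a small set of objects; this is what makes
  \<open>'u\<close>-valued sheafification available.\<close>

definition small :: "'u itself \<Rightarrow> 'x set \<Rightarrow> bool" where
  "small (_ :: 'u itself) A \<longleftrightarrow> (\<exists>e :: ('x \<Rightarrow> 'u) \<Rightarrow> 'u. inj_on e (A \<rightarrow>\<^sub>E UNIV))"

definition site :: "'u itself \<Rightarrow> ('o, 'a) category \<Rightarrow> ('o \<Rightarrow> 'a set set) \<Rightarrow> bool" where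
  "site U C J \<longleftrightarrow> category C \<and> grothendieck_topology C J \<and>
     (\<forall>a\<in>Obj C. \<forall>b\<in>Obj C. small U (hom C a b)) \<and>
     (\<exists>G \<subseteq> Obj C. small U G \<and>
        (\<forall>c\<in>Obj C. covering_family C J c {f \<in> Arr C. Cod C f = c \<and> Dom C f \<in> G}))"

definition comorphism_of_sites ::
  "'u itself \<Rightarrow> ('od, 'ad) category \<Rightarrow> ('od \<Rightarrow> 'ad set set) \<Rightarrow>
   ('oc, 'ac) category \<Rightarrow> ('oc \<Rightarrow> 'ac set set) \<Rightarrow> ('od, 'ad, 'oc, 'ac) func \<Rightarrow> bool" where
  "comorphism_of_sites U D K C J p \<longleftrightarrow>
     site U D K \<and> site U C J \<and> is_functor D C p \<and>
     (\<forall>d\<in>Obj D. \<forall>S\<in>J (ObM p d). \<exists>R\<in>K d. ArM p ` R \<subseteq> S)"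

record ('o, 'a, 'x) psh =
  Val :: "'o \<Rightarrow> 'x set"
  Res :: "'a \<Rightarrow> 'x \<Rightarrow> 'x"

definition presheaf :: "('o, 'a) category \<Rightarrow> ('o, 'a, 'x) psh \<Rightarrow> bool" where
  "presheaf C P \<longleftrightarrow>
     (\<forall>f\<in>Arr C. \<forall>x\<in>Val P (Cod C f). Res P f x \<in> Val P (Dom C f)) \<and>
     (\<forall>c\<in>Obj C. \<forall>x\<in>Val P c. Res P (Id C c) x = x) \<and>
     (\<forall>f\<in>Arr C. \<forall>g\<in>Arr C. \<forall>x\<in>Val P (Cod C g). Cod C f = Dom C g \<longrightarrow>
        Res P (Comp C g f) x = Res P f (Res P g x))"

text \<open>Natural transformations are \<open>undefined\<close> outside their domain, so that equality of
  natural transformations is equality in HOL.\<close>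

definition mk_nat ::
  "('o, 'a) category \<Rightarrow> ('o, 'a, 'x) psh \<Rightarrow> ('o \<Rightarrow> 'x \<Rightarrow> 'y) \<Rightarrow> 'o \<Rightarrow> 'x \<Rightarrow> 'y" where
  "mk_nat C P \<alpha> = (\<lambda>c x. if c \<in> Obj C \<and> x \<in> Val P c then \<alpha> c x else undefined)"

definition nat_trans ::
  "('o, 'a) category \<Rightarrow> ('o, 'a, 'x) psh \<Rightarrow> ('o, 'a, 'y) psh \<Rightarrow> ('o \<Rightarrow> 'x \<Rightarrow> 'y) \<Rightarrow> bool" where
  "nat_trans C P Q \<alpha> \<longleftrightarrow>
     (\<forall>c\<in>Obj C. \<forall>x\<in>Val P c. \<alpha> c x \<in> Val Q c) \<and>
     (\<forall>f\<in>Arr C. \<forall>x\<in>Val P (Cod C f). \<alpha> (Dom C f) (Res P f x) = Res Q f (\<alpha> (Cod C f) x)) \<and>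
     \<alpha> = mk_nat C P \<alpha>"

definition nat_comp ::
  "('o, 'a) category \<Rightarrow> ('o, 'a, 'x) psh \<Rightarrow> ('o \<Rightarrow> 'y \<Rightarrow> 'z) \<Rightarrow> ('o \<Rightarrow> 'x \<Rightarrow> 'y) \<Rightarrow> 'o \<Rightarrow> 'x \<Rightarrow> 'z"
where
  "nat_comp C P \<beta> \<alpha> = mk_nat C P (\<lambda>c x. \<beta> c (\<alpha> c x))"

definition sheaf ::
  "('o, 'a) category \<Rightarrow> ('o \<Rightarrow> 'a set set) \<Rightarrow> ('o, 'a, 'x) psh \<Rightarrow> bool" where
  "sheaf C J F \<longleftrightarrow> presheaf C F \<and>
     (\<forall>c\<in>Obj C. \<forall>R\<in>J c. \<forall>x.
        (\<forall>f\<in>R. x f \<in> Val F (Dom C f)) \<longrightarrow>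
        (\<forall>f\<in>R. \<forall>g\<in>Arr C. Cod C g = Dom C f \<longrightarrow> x (Comp C f g) = Res F g (x f)) \<longrightarrow>
        (\<exists>!y. y \<in> Val F c \<and> (\<forall>f\<in>R. Res F f y = x f)))"

definition Sh ::
  "('o, 'a) category \<Rightarrow> ('o \<Rightarrow> 'a set set) \<Rightarrow>
   (('o, 'a, 'u) psh, ('o, 'a, 'u) psh \<times> ('o \<Rightarrow> 'u \<Rightarrow> 'u) \<times> ('o, 'a, 'u) psh) category" where
  "Sh C J =
     \<lparr>Obj = {P. sheaf C J P},
      Arr = {(P, \<alpha>, Q). sheaf C J P \<and> sheaf C J Q \<and> nat_trans C P Q \<alpha>},
      Dom = (\<lambda>(P, _, _). P),
      Cod = (\<lambda>(_, _, Q). Q),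
      Id = (\<lambda>P. (P, mk_nat C P (\<lambda>_ x. x), P)),
      Comp = (\<lambda>(_, \<beta>, R) (P, \<alpha>, _). (P, nat_comp C P \<beta> \<alpha>, R))\<rparr>"

text \<open>Sheafification is the reflection into \<open>'u\<close>-valued sheaves. The presheaf being sheafified
  may take values in another type, as the representable presheaves do.\<close>

definition is_sheafification ::
  "('o, 'a) category \<Rightarrow> ('o \<Rightarrow> 'a set set) \<Rightarrow> ('o, 'a, 'x) psh \<Rightarrow>
   ('o, 'a, 'u) psh \<Rightarrow> ('o \<Rightarrow> 'x \<Rightarrow> 'u) \<Rightarrow> bool" where
  "is_sheafification C J P F \<iota> \<longleftrightarrow> sheaf C J F \<and> nat_trans C P F \<iota> \<and>
     (\<forall>(G :: ('o, 'a, 'u) psh) \<beta>. sheaf C J G \<longrightarrow> nat_trans C P G \<beta> \<longrightarrow>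
        (\<exists>!\<gamma>. nat_trans C F G \<gamma> \<and> nat_comp C P \<gamma> \<iota> = \<beta>))"

definition sheafification ::
  "('o, 'a) category \<Rightarrow> ('o \<Rightarrow> 'a set set) \<Rightarrow> ('o, 'a, 'x) psh \<Rightarrow>
   ('o, 'a, 'u) psh \<times> ('o \<Rightarrow> 'x \<Rightarrow> 'u)" where
  "sheafification C J P = (SOME (F, \<iota>). is_sheafification C J P F \<iota>)"

definition sh_ob ::
  "('o, 'a) category \<Rightarrow> ('o \<Rightarrow> 'a set set) \<Rightarrow> ('o, 'a, 'x) psh \<Rightarrow> ('o, 'a, 'u) psh" where
  "sh_ob C J P = fst (sheafification C J P)"

definition sh_unit ::
  "('o, 'a) category \<Rightarrow> ('o \<Rightarrow> 'a set set) \<Rightarrow> ('o, 'a, 'x) psh \<Rightarrow> 'o \<Rightarrow> 'x \<Rightarrow> 'u" where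
  "sh_unit C J P = snd (sheafification C J P)"

definition sh_map ::
  "('o, 'a) category \<Rightarrow> ('o \<Rightarrow> 'a set set) \<Rightarrow> ('o, 'a, 'x) psh \<Rightarrow> ('o, 'a, 'y) psh \<Rightarrow>
   ('o \<Rightarrow> 'x \<Rightarrow> 'y) \<Rightarrow> ('o, 'a, 'u) psh \<times> ('o \<Rightarrow> 'u \<Rightarrow> 'u) \<times> ('o, 'a, 'u) psh" where
  "sh_map C J P Q \<alpha> =
     (sh_ob C J P,
      THE \<gamma>. nat_trans C (sh_ob C J P) (sh_ob C J Q) \<gamma> \<and>
        nat_comp C P \<gamma> (sh_unit C J P) = nat_comp C P (sh_unit C J Q) \<alpha>,
      sh_ob C J Q)"

definition yoneda :: "('o, 'a) category \<Rightarrow> 'o \<Rightarrow> ('o, 'a, 'a) psh" where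
  "yoneda C c = \<lparr>Val = (\<lambda>b. hom C b c), Res = (\<lambda>g f. Comp C f g)\<rparr>"

definition yoneda_map :: "('o, 'a) category \<Rightarrow> 'a \<Rightarrow> 'o \<Rightarrow> 'a \<Rightarrow> 'a" where
  "yoneda_map C h = mk_nat C (yoneda C (Dom C h)) (\<lambda>b f. Comp C h f)"

definition l_ob :: "('o, 'a) category \<Rightarrow> ('o \<Rightarrow> 'a set set) \<Rightarrow> 'o \<Rightarrow> ('o, 'a, 'u) psh" where
  "l_ob C J c = sh_ob C J (yoneda C c)"

definition l_map ::
  "('o, 'a) category \<Rightarrow> ('o \<Rightarrow> 'a set set) \<Rightarrow> 'a \<Rightarrow>
   ('o, 'a, 'u) psh \<times> ('o \<Rightarrow> 'u \<Rightarrow> 'u) \<times> ('o, 'a, 'u) psh" where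
  "l_map C J h =
     sh_map C J (yoneda C (Dom C h)) (yoneda C (Cod C h)) (yoneda_map C h)"

definition pull ::
  "('od, 'ad, 'oc, 'ac) func \<Rightarrow> ('oc, 'ac, 'x) psh \<Rightarrow> ('od, 'ad, 'x) psh" where
  "pull p E = \<lparr>Val = Val E \<circ> ObM p, Res = Res E \<circ> ArM p\<rparr>"

definition pull_map ::
  "('od, 'ad) category \<Rightarrow> ('od, 'ad, 'oc, 'ac) func \<Rightarrow> ('oc, 'ac, 'x) psh \<Rightarrow>
   ('oc \<Rightarrow> 'x \<Rightarrow> 'y) \<Rightarrow> 'od \<Rightarrow> 'x \<Rightarrow> 'y" where
  "pull_map D p E \<alpha> = mk_nat D (pull p E) (\<alpha> \<circ> ObM p)"

definition inverse_image ::
  "('od, 'ad) category \<Rightarrow> ('od \<Rightarrow> 'ad set set) \<Rightarrow> ('od, 'ad, 'oc, 'ac) func \<Rightarrow>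
   (('oc, 'ac, 'u) psh, ('oc, 'ac, 'u) psh \<times> ('oc \<Rightarrow> 'u \<Rightarrow> 'u) \<times> ('oc, 'ac, 'u) psh,
    ('od, 'ad, 'u) psh, ('od, 'ad, 'u) psh \<times> ('od \<Rightarrow> 'u \<Rightarrow> 'u) \<times> ('od, 'ad, 'u) psh) func"
where
  "inverse_image D K p =
     \<lparr>ObM = (\<lambda>E. sh_ob D K (pull p E)),
      ArM = (\<lambda>(E, \<alpha>, F). sh_map D K (pull p E) (pull p F) (pull_map D p E \<alpha>))\<rparr>"

text \<open>The arrow \<open>\<eta>(d)\<close> is the sheafification of \<open>g \<mapsto> p(g)\<close>, which lands in
  \<open>a_K (Hom (p -, p d))\<close>, followed by the canonical isomorphism of the latter with
  \<open>C_p\<^sup>* l_J (p d) = a_K (a_J (Hom (-, p d)) \<circ> p)\<close>, obtained by sheafifying the unit of \<open>a_J\<close>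
  restricted along \<open>p\<close>.\<close>

definition eta ::
  "('od, 'ad) category \<Rightarrow> ('od \<Rightarrow> 'ad set set) \<Rightarrow> ('oc, 'ac) category \<Rightarrow>
   ('oc \<Rightarrow> 'ac set set) \<Rightarrow> ('od, 'ad, 'oc, 'ac) func \<Rightarrow> 'od \<Rightarrow>
   ('od, 'ad, 'u) psh \<times> ('od \<Rightarrow> 'u \<Rightarrow> 'u) \<times> ('od, 'ad, 'u) psh" where
  "eta D K C J p d =
     (let y = yoneda C (ObM p d);
          \<iota> = (sh_unit C J y :: 'oc \<Rightarrow> 'ac \<Rightarrow> 'u)
      in Comp (Sh D K)
           (sh_map D K (pull p y) (pull p (l_ob C J (ObM p d) :: ('oc, 'ac, 'u) psh))
              (pull_map D p y \<iota>))
           (sh_map D K (yoneda D d) (pull p y)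
              (mk_nat D (yoneda D d) (\<lambda>_ g. ArM p g))))"

definition eta_ob ::
  "('od, 'ad) category \<Rightarrow> ('od \<Rightarrow> 'ad set set) \<Rightarrow> ('oc, 'ac) category \<Rightarrow>
   ('oc \<Rightarrow> 'ac set set) \<Rightarrow> ('od, 'ad, 'oc, 'ac) func \<Rightarrow> 'od \<Rightarrow>
   ('od, 'ad, 'u) psh \<times> (('od, 'ad, 'u) psh \<times> ('od \<Rightarrow> 'u \<Rightarrow> 'u) \<times> ('od, 'ad, 'u) psh) \<times>
   ('oc, 'ac, 'u) psh" where
  "eta_ob D K C J p d = (l_ob D K d, eta D K C J p d, l_ob C J (ObM p d))"

definition locally_cartesian ::
  "'u itself \<Rightarrow> ('od, 'ad) category \<Rightarrow> ('od \<Rightarrow> 'ad set set) \<Rightarrow>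
   ('oc, 'ac) category \<Rightarrow> ('oc \<Rightarrow> 'ac set set) \<Rightarrow> ('od, 'ad, 'oc, 'ac) func \<Rightarrow> 'ad \<Rightarrow> bool"
where
  "locally_cartesian (_ :: 'u itself) D K C J p g \<longleftrightarrow> g \<in> Arr D \<and>
     (let ShD = Sh D K ::
            (('od, 'ad, 'u) psh,
             ('od, 'ad, 'u) psh \<times> ('od \<Rightarrow> 'u \<Rightarrow> 'u) \<times> ('od, 'ad, 'u) psh) category;
          ShC = Sh C J ::
            (('oc, 'ac, 'u) psh,
             ('oc, 'ac, 'u) psh \<times> ('oc \<Rightarrow> 'u \<Rightarrow> 'u) \<times> ('oc, 'ac, 'u) psh) category
      in cartesian_arrow (comma ShD ShC (inverse_image D K p)) ShC comma_proj
           (eta_ob D K C J p (Dom D g),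
            (l_map D K g, l_map C J (ArM p g)),
            eta_ob D K C J p (Cod D g)))"

text \<open>The covering family and its lifts are given as a set of pairs \<open>(v, w)\<close>, where \<open>v\<close> is
  one of the covering arrows and \<open>w\<close> a locally cartesian arrow lifting the composite \<open>u v\<close>.\<close>

definition local_fibration ::
  "'u itself \<Rightarrow> ('od, 'ad) category \<Rightarrow> ('od \<Rightarrow> 'ad set set) \<Rightarrow>
   ('oc, 'ac) category \<Rightarrow> ('oc \<Rightarrow> 'ac set set) \<Rightarrow> ('od, 'ad, 'oc, 'ac) func \<Rightarrow> bool" where
  "local_fibration U D K C J p \<longleftrightarrow> comorphism_of_sites U D K C J p \<and>
     (\<forall>c\<in>Obj C. \<forall>d\<in>Obj D. \<forall>u\<in>hom C c (ObM p d).
        \<exists>W. covering_family C J c (fst ` W) \<and>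
          (\<forall>(v, w)\<in>W. locally_cartesian U D K C J p w \<and> Cod D w = d \<and>
             v \<in> hom C (ObM p (Dom D w)) c \<and> Comp C u v = ArM p w))"

definition cartesian_local_fibration ::
  "'u itself \<Rightarrow> ('od, 'ad) category \<Rightarrow> ('od \<Rightarrow> 'ad set set) \<Rightarrow>
   ('oc, 'ac) category \<Rightarrow> ('oc \<Rightarrow> 'ac set set) \<Rightarrow> ('od, 'ad, 'oc, 'ac) func \<Rightarrow> bool" where
  "cartesian_local_fibration U D K C J p \<longleftrightarrow> local_fibration U D K C J p \<and>
     has_finite_limits D \<and> preserves_finite_limits D C p"

definition K_cartesian ::
  "'u itself \<Rightarrow> ('od, 'ad) category \<Rightarrow> ('od \<Rightarrow> 'ad set set) \<Rightarrow>
   ('oc, 'ac) category \<Rightarrow> ('oc \<Rightarrow> 'ac set set) \<Rightarrow> ('od, 'ad, 'oc, 'ac) func \<Rightarrow> 'ad \<Rightarrow> bool"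
where
  "K_cartesian U D K C J p f \<longleftrightarrow> f \<in> Arr D \<and>
     (\<exists>W. covering_family D K (Cod D f) W \<and>
        (\<forall>u\<in>W. \<exists>q r. is_pullback D f u q r \<and> locally_cartesian U D K C J p q))"

end

theory Submission
  imports Defs
begin

text \<open>
An arrow \<open>f : d' \<rightarrow> d\<close> is locally cartesian exactly when two elementary conditions hold, both
about an object \<open>x\<close> and up to a covering of \<open>x\<close>: two arrows \<open>x \<rightarrow> d'\<close> with the same composite with
\<open>f\<close> and the same image under \<open>p\<close> are locally equal, and a pair \<open>h : x \<rightarrow> d\<close>, \<open>k : p x \<rightarrow> p d'\<close> with
\<open>p h = p f \<circ> k\<close> locally comes from an arrow into \<open>d'\<close> (\<open>locally_cartesian_iff_lifts\<close>). In this form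
the condition is visibly local on \<open>d\<close>. Suppose that it holds for the pullbacks \<open>q\<^sub>i\<close> of \<open>f\<close> along
a covering family \<open>u\<^sub>i : d\<^sub>i \<rightarrow> d\<close>. Any \<open>h : x \<rightarrow> d\<close> locally factors through some \<open>u\<^sub>i\<close>; the pullback
property in \<open>D\<close> transports arrows into \<open>d'\<close> over such an \<open>h\<close> to arrows into the pullback, and since
\<open>p\<close> preserves the pullback the same holds for the arrows \<open>k\<close> of \<open>C\<close>. So both conditions pass from
the \<open>q\<^sub>i\<close> to \<open>f\<close>. Conversely a locally cartesian arrow is \<open>K\<close>-cartesian for the covering family that
consists of an identity.

The work lies in the elementary description. A test object in the comma category lies over
\<open>C_p\<^sup>* F\<close> for a sheaf \<open>F\<close>, but only its composite into \<open>C_p\<^sup>* l_J p(d')\<close> matters, so \<open>f\<close> is locally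
cartesian if and only if its naturality square for \<open>\<eta>\<close> is a pullback of sheaves
(\<open>locally_cartesian_iff_pullback\<close>). The corners of that square are, up to local isomorphism, the
presheaves \<open>Hom(-, d)\<close> and \<open>Hom(p -, p d)\<close>: for the second one restricts the unit of \<open>a_J\<close> along
\<open>p\<close>, and a comorphism of sites turns local isomorphisms for \<open>J\<close> into local isomorphisms for \<open>K\<close>
(\<open>local_iso_pull_map\<close>). Hence every section of a corner is locally an arrow. Testing the pullback
property on representables gives the two elementary conditions; conversely they say that
compatible pairs of sections have local lifts, which are unique and therefore glue.

All of this needs that the units of the sheafifications in question are local isomorphisms. It
is enough to exhibit for each presheaf one local isomorphism into a sheaf with values in the
universe \<open>'u\<close>, because reflections are unique up to isomorphism (\<open>is_sheafification_local_iso\<close>). The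
associated sheaf is built from sets of local representatives, and the smallness conditions on a
site embed its sets of sections into \<open>'u\<close> (\<open>fits_universe_assoc_sheaf\<close>).
\<close>

section \<open>Local truth on a site\<close>

locale fixed_category =
  fixes C :: "('o, 'a) category"
  assumes category: "category C"
begin

lemma dom_obj [simp, intro]: "f \<in> Arr C \<Longrightarrow> Dom C f \<in> Obj C"
  and cod_obj [simp, intro]: "f \<in> Arr C \<Longrightarrow> Cod C f \<in> Obj C"
  using category unfolding category_def by auto

lemma id_arr [simp, intro]: "a \<in> Obj C \<Longrightarrow> Id C a \<in> Arr C"
  and dom_id [simp]: "a \<in> Obj C \<Longrightarrow> Dom C (Id C a) = a"
  and cod_id [simp]: "a \<in> Obj C \<Longrightarrow> Cod C (Id C a) = a"
  using category unfolding category_def hom_def by auto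

lemma comp_arr [simp, intro]:
    "f \<in> Arr C \<Longrightarrow> g \<in> Arr C \<Longrightarrow> Cod C f = Dom C g \<Longrightarrow> Comp C g f \<in> Arr C"
  and dom_comp [simp]:
    "f \<in> Arr C \<Longrightarrow> g \<in> Arr C \<Longrightarrow> Cod C f = Dom C g \<Longrightarrow> Dom C (Comp C g f) = Dom C f"
  and cod_comp [simp]:
    "f \<in> Arr C \<Longrightarrow> g \<in> Arr C \<Longrightarrow> Cod C f = Dom C g \<Longrightarrow> Cod C (Comp C g f) = Cod C g"
  using category unfolding category_def hom_def by auto

lemma comp_id_right [simp]: "f \<in> Arr C \<Longrightarrow> Dom C f = a \<Longrightarrow> Comp C f (Id C a) = f"
  and comp_id_left [simp]: "f \<in> Arr C \<Longrightarrow> Cod C f = a \<Longrightarrow> Comp C (Id C a) f = f"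
  using category unfolding category_def by auto

lemma comp_assoc:
  "f \<in> Arr C \<Longrightarrow> g \<in> Arr C \<Longrightarrow> h \<in> Arr C \<Longrightarrow> Cod C f = Dom C g \<Longrightarrow> Cod C g = Dom C h \<Longrightarrow>
     Comp C (Comp C h g) f = Comp C h (Comp C g f)"
  using category unfolding category_def by auto

end

locale topologised_category = fixed_category C for C :: "('o, 'a) category" +
  fixes J :: "'o \<Rightarrow> 'a set set"
  assumes topology: "grothendieck_topology C J"
begin

lemma covering_sieve:
  "c \<in> Obj C \<Longrightarrow> R \<in> J c \<Longrightarrow> sieve C c R"
  using topology unfolding grothendieck_topology_def by blast

lemma covering_arr:
  "c \<in> Obj C \<Longrightarrow> R \<in> J c \<Longrightarrow> g \<in> R \<Longrightarrow> g \<in> Arr C \<and> Cod C g = c"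
  using covering_sieve unfolding sieve_def by blast

lemma covering_comp:
  "c \<in> Obj C \<Longrightarrow> R \<in> J c \<Longrightarrow> g \<in> R \<Longrightarrow> h \<in> Arr C \<Longrightarrow> Cod C h = Dom C g \<Longrightarrow> Comp C g h \<in> R"
  using covering_sieve unfolding sieve_def by blast

lemma covering_max: "c \<in> Obj C \<Longrightarrow> {f \<in> Arr C. Cod C f = c} \<in> J c"
  using topology unfolding grothendieck_topology_def by blast

lemma covering_pullback:
  "h \<in> Arr C \<Longrightarrow> R \<in> J (Cod C h) \<Longrightarrow> sieve_pullback C h R \<in> J (Dom C h)"
  using topology unfolding grothendieck_topology_def by blast

lemma covering_trans:
  "c \<in> Obj C \<Longrightarrow> S \<in> J c \<Longrightarrow> sieve C c R \<Longrightarrow>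
     (\<And>f. f \<in> S \<Longrightarrow> sieve_pullback C f R \<in> J (Dom C f)) \<Longrightarrow> R \<in> J c"
  using topology unfolding grothendieck_topology_def by blast

lemma covering_superset:
  assumes "c \<in> Obj C" "R \<in> J c" "sieve C c S" "R \<subseteq> S"
  shows "S \<in> J c"
proof (rule covering_trans[OF assms(1,2,3)])
  fix f assume f: "f \<in> R"
  then have fa: "f \<in> Arr C" using covering_arr assms by blast
  have "sieve_pullback C f S = {g \<in> Arr C. Cod C g = Dom C f}"
    using f assms(3,4) unfolding sieve_pullback_def sieve_def by blast
  then show "sieve_pullback C f S \<in> J (Dom C f)" using covering_max fa by simp
qed

text \<open>The internal language of a site: a statement about arrows into \<open>c\<close> holds locally when it
  holds on a covering sieve. The axioms of a Grothendieck topology become rules of this language,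
  so that arguments with sheaves can be written without naming sieves.\<close>

definition locally :: "'o \<Rightarrow> ('a \<Rightarrow> bool) \<Rightarrow> bool" where
  "locally c \<Phi> \<longleftrightarrow> (\<exists>R\<in>J c. \<forall>g\<in>R. \<Phi> g)"

lemma locally_mono:
  assumes "locally c \<Phi>" "c \<in> Obj C"
    and "\<And>g. g \<in> Arr C \<Longrightarrow> Cod C g = c \<Longrightarrow> \<Phi> g \<Longrightarrow> \<Psi> g"
  shows "locally c \<Psi>"
proof -
  obtain R where "R \<in> J c" "\<forall>g\<in>R. \<Phi> g" using assms(1) unfolding locally_def by blast
  then show ?thesis using covering_arr[OF assms(2)] assms(3) unfolding locally_def by blast
qed

lemma locally_always:
  assumes "c \<in> Obj C" and "\<And>g. g \<in> Arr C \<Longrightarrow> Cod C g = c \<Longrightarrow> \<Phi> g"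
  shows "locally c \<Phi>"
  using assms(2) covering_max[OF assms(1)] unfolding locally_def
  by (intro bexI[of _ "{f \<in> Arr C. Cod C f = c}"]) auto

lemma locally_pullback:
  assumes "locally (Cod C h) \<Phi>" "h \<in> Arr C"
  shows "locally (Dom C h) (\<lambda>g. \<Phi> (Comp C h g))"
proof -
  obtain R where "R \<in> J (Cod C h)" "\<forall>g\<in>R. \<Phi> g" using assms(1) unfolding locally_def by blast
  then show ?thesis using covering_pullback[OF assms(2)] unfolding locally_def
    by (intro bexI[of _ "sieve_pullback C h R"]) (auto simp: sieve_pullback_def)
qed

text \<open>The composites of a cover of \<open>c\<close> with covers of its sources form a covering sieve again.\<close>

lemma locally_trans:
  assumes c: "c \<in> Obj C"
    and loc: "locally c (\<lambda>g. locally (Dom C g) (\<lambda>h. \<Phi> (Comp C g h)))"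
  shows "locally c \<Phi>"
proof -
  obtain R where R: "R \<in> J c" and "\<forall>g\<in>R. \<exists>S\<in>J (Dom C g). \<forall>h\<in>S. \<Phi> (Comp C g h)"
    using loc unfolding locally_def by blast
  then obtain S where S: "\<And>g. g \<in> R \<Longrightarrow> S g \<in> J (Dom C g)"
    and \<Phi>: "\<And>g h. g \<in> R \<Longrightarrow> h \<in> S g \<Longrightarrow> \<Phi> (Comp C g h)"
    by metis
  note Ra = covering_arr[OF c R]
  have Sa: "h \<in> Arr C \<and> Cod C h = Dom C g" if "g \<in> R" "h \<in> S g" for g h
    using covering_arr[OF _ S] Ra that by blast
  define T where "T = {Comp C g h | g h. g \<in> R \<and> h \<in> S g}"
  have "Comp C (Comp C g h) k \<in> T"
    if "g \<in> R" "h \<in> S g" "k \<in> Arr C" "Cod C k = Dom C (Comp C g h)" for g h k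
  proof -
    have "Comp C h k \<in> S g"
      using that Ra Sa S covering_comp[of "Dom C g" "S g" h k] by simp
    moreover have "Comp C (Comp C g h) k = Comp C g (Comp C h k)"
      using that Ra Sa by (simp add: comp_assoc)
    ultimately show ?thesis using that unfolding T_def by blast
  qed
  then have sv: "sieve C c T"
    using Ra Sa unfolding sieve_def T_def by auto
  have "T \<in> J c"
  proof (rule covering_trans[OF c R sv])
    fix g assume g: "g \<in> R"
    show "sieve_pullback C g T \<in> J (Dom C g)"
    proof (rule covering_superset[OF _ S[OF g]])
      show "Dom C g \<in> Obj C" using Ra g by blast
      show "sieve C (Dom C g) (sieve_pullback C g T)"
        using sv Ra g unfolding sieve_def sieve_pullback_def
        by (auto simp: comp_assoc[symmetric])
      show "S g \<subseteq> sieve_pullback C g T"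
        using Sa g unfolding sieve_pullback_def T_def by auto
    qed
  qed
  moreover have "\<forall>f\<in>T. \<Phi> f" unfolding T_def using \<Phi> by blast
  ultimately show ?thesis unfolding locally_def by blast
qed

lemma locally_bind:
  assumes c: "c \<in> Obj C" and \<Phi>: "locally c \<Phi>"
    and step: "\<And>g. g \<in> Arr C \<Longrightarrow> Cod C g = c \<Longrightarrow> \<Phi> g \<Longrightarrow> locally (Dom C g) (\<lambda>h. \<Psi> (Comp C g h))"
  shows "locally c \<Psi>"
  by (rule locally_trans[OF c], rule locally_mono[OF \<Phi> c step])

lemma locally_conj:
  assumes c: "c \<in> Obj C" and \<Phi>: "locally c \<Phi>" and \<Psi>: "locally c \<Psi>"
  shows "locally c (\<lambda>g. \<Phi> g \<and> \<Psi> g)"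
proof -
  obtain R S where R: "R \<in> J c" "\<forall>g\<in>R. \<Phi> g" and S: "S \<in> J c" "\<forall>g\<in>S. \<Psi> g"
    using \<Phi> \<Psi> unfolding locally_def by blast
  have "locally c (\<lambda>g. g \<in> R \<and> g \<in> S)"
  proof (rule locally_trans[OF c])
    have "locally (Dom C g) (\<lambda>h. Comp C g h \<in> R \<and> Comp C g h \<in> S)" if g: "g \<in> R" for g
    proof -
      have ga: "g \<in> Arr C" "Cod C g = c" using covering_arr c R g by blast+
      have "locally (Cod C g) (\<lambda>h. h \<in> S)" using S ga unfolding locally_def by blast
      then have "locally (Dom C g) (\<lambda>h. Comp C g h \<in> S)" using locally_pullback ga by blast
      then show ?thesis
        by (rule locally_mono) (use ga g c R covering_comp in auto)
    qed
    then show "locally c (\<lambda>g. locally (Dom C g) (\<lambda>h. Comp C g h \<in> R \<and> Comp C g h \<in> S))"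
      using R unfolding locally_def by blast
  qed
  then show ?thesis using R S unfolding locally_def by blast
qed

lemma locally_covering_family:
  assumes "covering_family C J c U" "c \<in> Obj C"
  shows "locally c (\<lambda>g. \<exists>u\<in>U. \<exists>t\<in>Arr C. Cod C t = Dom C u \<and> g = Comp C u t)"
  using assms unfolding covering_family_def locally_def
  by (intro bexI[of _ "generated_sieve C U"]) (auto simp: generated_sieve_def)

section \<open>Presheaves, sheaves and local isomorphisms\<close>

lemma res_val:
  "presheaf C P \<Longrightarrow> g \<in> Arr C \<Longrightarrow> x \<in> Val P (Cod C g) \<Longrightarrow> Res P g x \<in> Val P (Dom C g)"
  unfolding presheaf_def by blast

lemma res_id: "presheaf C P \<Longrightarrow> c \<in> Obj C \<Longrightarrow> x \<in> Val P c \<Longrightarrow> Res P (Id C c) x = x"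
  unfolding presheaf_def by blast

lemma res_comp:
  "presheaf C P \<Longrightarrow> f \<in> Arr C \<Longrightarrow> g \<in> Arr C \<Longrightarrow> Cod C f = Dom C g \<Longrightarrow> x \<in> Val P (Cod C g) \<Longrightarrow>
     Res P (Comp C g f) x = Res P f (Res P g x)"
  unfolding presheaf_def by blast

lemma sheaf_presheaf: "sheaf C J F \<Longrightarrow> presheaf C F"
  unfolding sheaf_def by blast

lemma sheaf_glue:
  assumes "sheaf C J F" "c \<in> Obj C" "R \<in> J c"
    and "\<And>f. f \<in> R \<Longrightarrow> x f \<in> Val F (Dom C f)"
    and "\<And>f g. f \<in> R \<Longrightarrow> g \<in> Arr C \<Longrightarrow> Cod C g = Dom C f \<Longrightarrow> x (Comp C f g) = Res F g (x f)"
  shows "\<exists>!y. y \<in> Val F c \<and> (\<forall>f\<in>R. Res F f y = x f)"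
  using assms unfolding sheaf_def by simp

end

lemma nat_trans_val:
  "nat_trans C P Q \<alpha> \<Longrightarrow> c \<in> Obj C \<Longrightarrow> x \<in> Val P c \<Longrightarrow> \<alpha> c x \<in> Val Q c"
  unfolding nat_trans_def by blast

lemma nat_trans_res:
  "nat_trans C P Q \<alpha> \<Longrightarrow> f \<in> Arr C \<Longrightarrow> x \<in> Val P (Cod C f) \<Longrightarrow>
     \<alpha> (Dom C f) (Res P f x) = Res Q f (\<alpha> (Cod C f) x)"
  unfolding nat_trans_def by blast

lemma nat_trans_eqI:
  assumes "nat_trans C P Q \<alpha>" "nat_trans C P Q' \<beta>"
    and "\<And>c x. c \<in> Obj C \<Longrightarrow> x \<in> Val P c \<Longrightarrow> \<alpha> c x = \<beta> c x"
  shows "\<alpha> = \<beta>"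
proof -
  have "\<alpha> = mk_nat C P \<alpha>" "\<beta> = mk_nat C P \<beta>" using assms unfolding nat_trans_def by blast+
  moreover have "mk_nat C P \<alpha> = mk_nat C P \<beta>" using assms(3) by (auto simp: mk_nat_def fun_eq_iff)
  ultimately show ?thesis by simp
qed

lemma mk_nat_apply [simp]: "c \<in> Obj C \<Longrightarrow> x \<in> Val P c \<Longrightarrow> mk_nat C P \<alpha> c x = \<alpha> c x"
  by (simp add: mk_nat_def)

lemma nat_comp_apply [simp]:
  "c \<in> Obj C \<Longrightarrow> x \<in> Val P c \<Longrightarrow> nat_comp C P \<beta> \<alpha> c x = \<beta> c (\<alpha> c x)"
  by (simp add: nat_comp_def)

context topologised_category
begin

lemma nat_trans_mk_nat:
  assumes "presheaf C P"
    and "\<And>c x. c \<in> Obj C \<Longrightarrow> x \<in> Val P c \<Longrightarrow> \<alpha> c x \<in> Val Q c"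
    and "\<And>f x. f \<in> Arr C \<Longrightarrow> x \<in> Val P (Cod C f) \<Longrightarrow>
           \<alpha> (Dom C f) (Res P f x) = Res Q f (\<alpha> (Cod C f) x)"
  shows "nat_trans C P Q (mk_nat C P \<alpha>)"
  using assms unfolding nat_trans_def 
  by (auto simp: res_val) (auto simp: mk_nat_def fun_eq_iff)

lemma nat_trans_comp:
  assumes "presheaf C P" "nat_trans C P Q \<alpha>" "nat_trans C Q R \<beta>"
  shows "nat_trans C P R (nat_comp C P \<beta> \<alpha>)"
  unfolding nat_comp_def using assms
  by (intro nat_trans_mk_nat) (auto simp: nat_trans_val nat_trans_res)

lemma nat_trans_id:
  assumes "presheaf C P" shows "nat_trans C P P (mk_nat C P (\<lambda>_ x. x))"
  using assms by (intro nat_trans_mk_nat) auto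

lemma sheaf_separated:
  assumes F: "sheaf C J F" and c: "c \<in> Obj C" and y: "y \<in> Val F c" and z: "z \<in> Val F c"
    and loc: "locally c (\<lambda>g. Res F g y = Res F g z)"
  shows "y = z"
proof -
  obtain R where R: "R \<in> J c" "\<forall>g\<in>R. Res F g y = Res F g z" using loc unfolding locally_def by blast
  note P = sheaf_presheaf[OF F]
  note Ra = covering_arr[OF c R(1)]
  have "\<exists>!w. w \<in> Val F c \<and> (\<forall>f\<in>R. Res F f w = Res F f y)"
    using y by (intro sheaf_glue[OF F c R(1)]) (auto simp: Ra res_val[OF P] res_comp[OF P])
  then show ?thesis using y z R(2) by (metis (no_types, lifting))
qed

text \<open>A problem whose solutions in a sheaf are unique and can be recognised locally has a
  solution as soon as it has one locally: the local solutions agree on overlaps, hence glue.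
  The data of the problem vary in the presheaf \<open>T\<close>, and the solution depends on them naturally.\<close>

lemma nat_trans_of_local_solutions:
  assumes T: "presheaf C T" and F: "sheaf C J F"
    and stable: "\<And>g t z. g \<in> Arr C \<Longrightarrow> t \<in> Val T (Cod C g) \<Longrightarrow> z \<in> Val F (Cod C g) \<Longrightarrow>
        \<Psi> (Cod C g) t z \<Longrightarrow> \<Psi> (Dom C g) (Res T g t) (Res F g z)"
    and local: "\<And>c t z. c \<in> Obj C \<Longrightarrow> t \<in> Val T c \<Longrightarrow> z \<in> Val F c \<Longrightarrow>
        locally c (\<lambda>g. \<Psi> (Dom C g) (Res T g t) (Res F g z)) \<Longrightarrow> \<Psi> c t z"
    and unique: "\<And>c t z z'. c \<in> Obj C \<Longrightarrow> t \<in> Val T c \<Longrightarrow> z \<in> Val F c \<Longrightarrow> z' \<in> Val F c \<Longrightarrow>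
        \<Psi> c t z \<Longrightarrow> \<Psi> c t z' \<Longrightarrow> z = z'"
    and ex: "\<And>c t. c \<in> Obj C \<Longrightarrow> t \<in> Val T c \<Longrightarrow>
        locally c (\<lambda>g. \<exists>z\<in>Val F (Dom C g). \<Psi> (Dom C g) (Res T g t) z)"
  shows "\<exists>\<gamma>. nat_trans C T F \<gamma> \<and> (\<forall>c\<in>Obj C. \<forall>t\<in>Val T c. \<Psi> c t (\<gamma> c t))"
proof -
  note P = sheaf_presheaf[OF F]
  have glue: "\<exists>z\<in>Val F c. \<Psi> c t z" if c: "c \<in> Obj C" and t: "t \<in> Val T c" for c t
  proof -
    obtain R where R: "R \<in> J c" and "\<forall>g\<in>R. \<exists>z\<in>Val F (Dom C g). \<Psi> (Dom C g) (Res T g t) z"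
      using ex[OF c t] unfolding locally_def by blast
    then obtain x where x: "\<And>g. g \<in> R \<Longrightarrow> x g \<in> Val F (Dom C g)"
      "\<And>g. g \<in> R \<Longrightarrow> \<Psi> (Dom C g) (Res T g t) (x g)" by metis
    note Ra = covering_arr[OF c R]
    have compat: "x (Comp C f g) = Res F g (x f)"
      if "f \<in> R" "g \<in> Arr C" "Cod C g = Dom C f" for f g
    proof (rule unique)
      have fa: "f \<in> Arr C" "Cod C f = c" using Ra that by auto
      have fg: "Comp C f g \<in> R" using covering_comp c R that by blast
      show "Dom C g \<in> Obj C" using that by simp
      show "Res T (Comp C f g) t \<in> Val T (Dom C g)" using fa that t res_val[OF T, of "Comp C f g"] by simp
      show "x (Comp C f g) \<in> Val F (Dom C g)" using x(1)[OF fg] fa that by simp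
      show "Res F g (x f) \<in> Val F (Dom C g)" using res_val[OF P] x that by simp
      show "\<Psi> (Dom C g) (Res T (Comp C f g) t) (x (Comp C f g))" using x(2)[OF fg] fa that by simp
      show "\<Psi> (Dom C g) (Res T (Comp C f g) t) (Res F g (x f))"
        using stable[of g "Res T f t" "x f"] x[OF that(1)] fa that t res_val[OF T, of f]
        by (simp add: res_comp[OF T])
    qed
    have "\<exists>!y. y \<in> Val F c \<and> (\<forall>f\<in>R. Res F f y = x f)"
      using sheaf_glue[OF F c R, of x] x(1) compat by blast
    then obtain y where y: "y \<in> Val F c" "\<forall>f\<in>R. Res F f y = x f" by blast
    have "\<Psi> c t y"
      by (rule local[OF c t y(1)]) (use R x(2) y(2) in \<open>auto simp: locally_def intro!: bexI[of _ R]\<close>)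
    then show ?thesis using y by blast
  qed
  define sol where "sol = (\<lambda>c t. SOME z. z \<in> Val F c \<and> \<Psi> c t z)"
  have sol: "sol c t \<in> Val F c" "\<Psi> c t (sol c t)" if "c \<in> Obj C" "t \<in> Val T c" for c t
    using someI_ex[of "\<lambda>z. z \<in> Val F c \<and> \<Psi> c t z"] glue[OF that] unfolding sol_def by blast+
  have "nat_trans C T F (mk_nat C T sol)"
  proof (rule nat_trans_mk_nat[OF T sol(1)])
    fix f x assume f: "f \<in> Arr C" and x: "x \<in> Val T (Cod C f)"
    show "sol (Dom C f) (Res T f x) = Res F f (sol (Cod C f) x)"
      using f x sol res_val[OF T f x] stable
      by (intro unique[of "Dom C f" "Res T f x"]) (auto simp: res_val[OF P])
  qed
  then show ?thesis using sol by (intro exI[of _ "mk_nat C T sol"]) auto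
qed

text \<open>Local injectivity and local surjectivity: these are the maps of presheaves that
  sheafification turns into isomorphisms.\<close>

definition local_iso ::
  "('o, 'a, 'x) psh \<Rightarrow> ('o, 'a, 'y) psh \<Rightarrow> ('o \<Rightarrow> 'x \<Rightarrow> 'y) \<Rightarrow> bool" where
  "local_iso P Q \<alpha> \<longleftrightarrow> nat_trans C P Q \<alpha> \<and>
     (\<forall>c\<in>Obj C. \<forall>x\<in>Val P c. \<forall>y\<in>Val P c. \<alpha> c x = \<alpha> c y \<longrightarrow>
        locally c (\<lambda>g. Res P g x = Res P g y)) \<and>
     (\<forall>c\<in>Obj C. \<forall>y\<in>Val Q c.
        locally c (\<lambda>g. \<exists>x\<in>Val P (Dom C g). \<alpha> (Dom C g) x = Res Q g y))"

lemma local_iso_nat_trans: "local_iso P Q \<alpha> \<Longrightarrow> nat_trans C P Q \<alpha>"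
  unfolding local_iso_def by blast

lemma local_iso_inj:
  "local_iso P Q \<alpha> \<Longrightarrow> c \<in> Obj C \<Longrightarrow> x \<in> Val P c \<Longrightarrow> y \<in> Val P c \<Longrightarrow> \<alpha> c x = \<alpha> c y \<Longrightarrow>
     locally c (\<lambda>g. Res P g x = Res P g y)"
  unfolding local_iso_def by blast

lemma local_iso_surj:
  "local_iso P Q \<alpha> \<Longrightarrow> c \<in> Obj C \<Longrightarrow> y \<in> Val Q c \<Longrightarrow>
     locally c (\<lambda>g. \<exists>x\<in>Val P (Dom C g). \<alpha> (Dom C g) x = Res Q g y)"
  unfolding local_iso_def by blast

lemma local_iso_comp:
  assumes P: "presheaf C P" and Q: "presheaf C Q" and R: "presheaf C R"
    and \<alpha>: "local_iso P Q \<alpha>" and \<beta>: "local_iso Q R \<beta>"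
  shows "local_iso P R (nat_comp C P \<beta> \<alpha>)"
proof -
  note nt = local_iso_nat_trans[OF \<alpha>] local_iso_nat_trans[OF \<beta>]
  have inj: "locally c (\<lambda>g. Res P g x = Res P g y)"
    if c: "c \<in> Obj C" and x: "x \<in> Val P c" and y: "y \<in> Val P c"
      and eq: "\<beta> c (\<alpha> c x) = \<beta> c (\<alpha> c y)" for c x y
  proof (rule locally_trans[OF c])
    have "locally c (\<lambda>g. Res Q g (\<alpha> c x) = Res Q g (\<alpha> c y))"
      using local_iso_inj[OF \<beta> c _ _ eq] nat_trans_val[OF nt(1) c] x y by blast
    then show "locally c (\<lambda>g. locally (Dom C g) (\<lambda>h. Res P (Comp C g h) x = Res P (Comp C g h) y))"
    proof (rule locally_mono[OF _ c])
      fix g assume g: "g \<in> Arr C" "Cod C g = c" "Res Q g (\<alpha> c x) = Res Q g (\<alpha> c y)"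
      have "locally (Dom C g) (\<lambda>h. Res P h (Res P g x) = Res P h (Res P g y))"
        using g x y nat_trans_res[OF nt(1) g(1)] res_val[OF P g(1)]
        by (intro local_iso_inj[OF \<alpha>]) auto
      then show "locally (Dom C g) (\<lambda>h. Res P (Comp C g h) x = Res P (Comp C g h) y)"
        by (rule locally_mono) (use g x y res_comp[OF P] in auto)
    qed
  qed
  have surj: "locally c (\<lambda>g. \<exists>x\<in>Val P (Dom C g). \<beta> (Dom C g) (\<alpha> (Dom C g) x) = Res R g z)"
    if c: "c \<in> Obj C" and z: "z \<in> Val R c" for c z
  proof (rule locally_bind[OF c local_iso_surj[OF \<beta> c z]])
    fix g assume g: "g \<in> Arr C" "Cod C g = c"
      and "\<exists>y\<in>Val Q (Dom C g). \<beta> (Dom C g) y = Res R g z"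
    then obtain y where y: "y \<in> Val Q (Dom C g)" "\<beta> (Dom C g) y = Res R g z" by blast
    show "locally (Dom C g) (\<lambda>h. \<exists>x\<in>Val P (Dom C (Comp C g h)).
            \<beta> (Dom C (Comp C g h)) (\<alpha> (Dom C (Comp C g h)) x) = Res R (Comp C g h) z)"
    proof (rule locally_mono[OF local_iso_surj[OF \<alpha> _ y(1)]])
      fix h assume h: "h \<in> Arr C" "Cod C h = Dom C g"
        and "\<exists>x\<in>Val P (Dom C h). \<alpha> (Dom C h) x = Res Q h y"
      then obtain x where x: "x \<in> Val P (Dom C h)" "\<alpha> (Dom C h) x = Res Q h y" by blast
      have "\<beta> (Dom C h) (\<alpha> (Dom C h) x) = Res R (Comp C g h) z"
        using x y g h z nat_trans_res[OF nt(2) h(1)] res_comp[OF R] by simp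
      then show "\<exists>x\<in>Val P (Dom C (Comp C g h)).
            \<beta> (Dom C (Comp C g h)) (\<alpha> (Dom C (Comp C g h)) x) = Res R (Comp C g h) z"
        using x(1) g h by (intro bexI[of _ x]) auto
    qed (use g in auto)
  qed
  have "locally c (\<lambda>g. \<exists>x\<in>Val P (Dom C g). nat_comp C P \<beta> \<alpha> (Dom C g) x = Res R g z)"
    if "c \<in> Obj C" "z \<in> Val R c" for c z
    by (rule locally_mono[OF surj[OF that]]) (use that in \<open>auto intro!: bexI\<close>)
  then show ?thesis
    using inj nat_trans_comp[OF P nt] unfolding local_iso_def by simp
qed

text \<open>A map into a sheaf is determined along a local isomorphism, since a local surjection is
  an epimorphism for separated targets.\<close>

lemma local_iso_epi:
  assumes \<alpha>: "local_iso P Q \<alpha>" and G: "sheaf C J G"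
    and \<gamma>: "nat_trans C Q G \<gamma>" and \<delta>: "nat_trans C Q G \<delta>"
    and eq: "\<And>c x. c \<in> Obj C \<Longrightarrow> x \<in> Val P c \<Longrightarrow> \<gamma> c (\<alpha> c x) = \<delta> c (\<alpha> c x)"
  shows "\<gamma> = \<delta>"
proof (rule nat_trans_eqI[OF \<gamma> \<delta>])
  fix c y assume c: "c \<in> Obj C" and y: "y \<in> Val Q c"
  have "locally c (\<lambda>g. Res G g (\<gamma> c y) = Res G g (\<delta> c y))"
  proof (rule locally_mono[OF local_iso_surj[OF \<alpha> c y] c])
    fix g assume g: "g \<in> Arr C" "Cod C g = c" "\<exists>x\<in>Val P (Dom C g). \<alpha> (Dom C g) x = Res Q g y"
    then obtain x where x: "x \<in> Val P (Dom C g)" "\<alpha> (Dom C g) x = Res Q g y" by blast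
    then show "Res G g (\<gamma> c y) = Res G g (\<delta> c y)"
      using eq[OF _ x(1)] g y nat_trans_res[OF \<gamma> g(1)] nat_trans_res[OF \<delta> g(1)] by simp
  qed
  then show "\<gamma> c y = \<delta> c y"
    using sheaf_separated[OF G c] nat_trans_val[OF \<gamma> c y] nat_trans_val[OF \<delta> c y] by blast
qed

text \<open>An element of \<open>Q\<close> locally has preimages under \<open>\<alpha>\<close>. Two preimages of the same element agree
  locally, so their images under \<open>\<beta>\<close> are equal in the sheaf \<open>G\<close> and glue.\<close>

lemma local_iso_extend:
  assumes P: "presheaf C P" and Q: "presheaf C Q" and \<alpha>: "local_iso P Q \<alpha>"
    and G: "sheaf C J G" and \<beta>: "nat_trans C P G \<beta>"
  shows "\<exists>\<gamma>. nat_trans C Q G \<gamma> \<and> (\<forall>c\<in>Obj C. \<forall>x\<in>Val P c. \<gamma> c (\<alpha> c x) = \<beta> c x)"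
proof -
  note PG = sheaf_presheaf[OF G]
  note nt = local_iso_nat_trans[OF \<alpha>]
  define \<Psi> where "\<Psi> c y z \<longleftrightarrow>
    locally c (\<lambda>g. \<exists>x\<in>Val P (Dom C g). \<alpha> (Dom C g) x = Res Q g y \<and> \<beta> (Dom C g) x = Res G g z)" for c y z
  have well_defined: "\<beta> c x = \<beta> c x'"
    if "c \<in> Obj C" "x \<in> Val P c" "x' \<in> Val P c" "\<alpha> c x = \<alpha> c x'" for c x x'
  proof (rule sheaf_separated[OF G that(1)])
    show "locally c (\<lambda>g. Res G g (\<beta> c x) = Res G g (\<beta> c x'))"
      by (rule locally_mono[OF local_iso_inj[OF \<alpha> that]])
         (use that nat_trans_res[OF \<beta>] in \<open>metis+\<close>)
  qed (use that nat_trans_val[OF \<beta>] in auto)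
  have exact: "\<Psi> c (\<alpha> c x) (\<beta> c x)" if c: "c \<in> Obj C" and x: "x \<in> Val P c" for c x
    unfolding \<Psi>_def
  proof (rule locally_always[OF c])
    fix g assume "g \<in> Arr C" "Cod C g = c"
    then show "\<exists>x'\<in>Val P (Dom C g). \<alpha> (Dom C g) x' = Res Q g (\<alpha> c x) \<and> \<beta> (Dom C g) x' = Res G g (\<beta> c x)"
      using x res_val[OF P] nat_trans_res[OF nt] nat_trans_res[OF \<beta>]
      by (intro bexI[of _ "Res P g x"]) auto
  qed
  have unique: "z = z'"
    if "c \<in> Obj C" "y \<in> Val Q c" "z \<in> Val G c" "z' \<in> Val G c" "\<Psi> c y z" "\<Psi> c y z'" for c y z z'
  proof (rule sheaf_separated[OF G that(1,3,4)])
    show "locally c (\<lambda>g. Res G g z = Res G g z')"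
      by (rule locally_mono[OF locally_conj[OF that(1) that(5,6)[unfolded \<Psi>_def]]])
         (use that(1) well_defined in \<open>metis dom_obj\<close>)+
  qed
  have "\<exists>\<gamma>. nat_trans C Q G \<gamma> \<and> (\<forall>c\<in>Obj C. \<forall>t\<in>Val Q c. \<Psi> c t (\<gamma> c t))"
  proof (rule nat_trans_of_local_solutions[OF Q G])
    show "\<Psi> (Dom C g) (Res Q g t) (Res G g z)"
      if "g \<in> Arr C" "t \<in> Val Q (Cod C g)" "z \<in> Val G (Cod C g)" "\<Psi> (Cod C g) t z" for g t z
      using locally_pullback[OF that(4)[unfolded \<Psi>_def] that(1)] unfolding \<Psi>_def
      by (rule locally_mono) (use that in \<open>auto simp: res_comp[OF Q] res_comp[OF PG]\<close>)
    show "\<Psi> c t z"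
      if "c \<in> Obj C" "t \<in> Val Q c" "z \<in> Val G c"
        "locally c (\<lambda>g. \<Psi> (Dom C g) (Res Q g t) (Res G g z))" for c t z
      unfolding \<Psi>_def
    proof (rule locally_trans[OF that(1)], rule locally_mono[OF that(4,1)])
      fix g assume g: "g \<in> Arr C" "Cod C g = c" "\<Psi> (Dom C g) (Res Q g t) (Res G g z)"
      show "locally (Dom C g) (\<lambda>h. \<exists>x\<in>Val P (Dom C (Comp C g h)).
          \<alpha> (Dom C (Comp C g h)) x = Res Q (Comp C g h) t \<and>
          \<beta> (Dom C (Comp C g h)) x = Res G (Comp C g h) z)"
        by (rule locally_mono[OF g(3)[unfolded \<Psi>_def]])
           (use g that in \<open>auto simp: res_comp[OF Q] res_comp[OF PG]\<close>)
    qed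
    show "z = z'"
      if "c \<in> Obj C" "y \<in> Val Q c" "z \<in> Val G c" "z' \<in> Val G c" "\<Psi> c y z" "\<Psi> c y z'" for c y z z'
      using unique that by blast
    show "locally c (\<lambda>g. \<exists>z\<in>Val G (Dom C g). \<Psi> (Dom C g) (Res Q g t) z)"
      if "c \<in> Obj C" "t \<in> Val Q c" for c t
      by (rule locally_mono[OF local_iso_surj[OF \<alpha> that] that(1)])
         (metis dom_obj exact nat_trans_val[OF \<beta>])
  qed
  then obtain \<gamma> where \<gamma>: "nat_trans C Q G \<gamma>" "\<And>c t. c \<in> Obj C \<Longrightarrow> t \<in> Val Q c \<Longrightarrow> \<Psi> c t (\<gamma> c t)" by blast
  have "\<gamma> c (\<alpha> c x) = \<beta> c x" if "c \<in> Obj C" "x \<in> Val P c" for c x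
    using unique[OF that(1), of "\<alpha> c x"] that \<gamma>(2) exact nat_trans_val[OF \<gamma>(1)] nat_trans_val[OF nt]
      nat_trans_val[OF \<beta>] by metis
  then show ?thesis using \<gamma>(1) by blast
qed

lemma local_iso_is_sheafification:
  fixes F :: "('o, 'a, 'u) psh"
  assumes "presheaf C P" "sheaf C J F" "local_iso P F \<iota>"
  shows "is_sheafification C J P F \<iota>"
  unfolding is_sheafification_def
proof (intro conjI allI impI)
  show "sheaf C J F" "nat_trans C P F \<iota>" using assms local_iso_nat_trans by auto
  fix G :: "('o, 'a, 'u) psh" and \<beta>
  assume G: "sheaf C J G" and \<beta>: "nat_trans C P G \<beta>"
  obtain \<gamma> where \<gamma>: "nat_trans C F G \<gamma>" "\<forall>c\<in>Obj C. \<forall>x\<in>Val P c. \<gamma> c (\<iota> c x) = \<beta> c x"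
    using local_iso_extend[OF assms(1) _ assms(3) G \<beta>] sheaf_presheaf assms(2) by blast
  show "\<exists>!\<gamma>. nat_trans C F G \<gamma> \<and> nat_comp C P \<gamma> \<iota> = \<beta>"
  proof (rule ex1I[of _ \<gamma>])
    have "nat_comp C P \<gamma> \<iota> = \<beta>"
      using \<gamma> nat_trans_comp[OF assms(1) local_iso_nat_trans[OF assms(3)] \<gamma>(1)]
      by (intro nat_trans_eqI[OF _ \<beta>]) auto
    then show "nat_trans C F G \<gamma> \<and> nat_comp C P \<gamma> \<iota> = \<beta>" using \<gamma> by blast
    fix \<delta> assume \<delta>: "nat_trans C F G \<delta> \<and> nat_comp C P \<delta> \<iota> = \<beta>"
    show "\<delta> = \<gamma>"
    proof (rule local_iso_epi[OF assms(3) G])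
      fix c x assume "c \<in> Obj C" "x \<in> Val P c"
      then show "\<delta> c (\<iota> c x) = \<gamma> c (\<iota> c x)" using \<delta> \<gamma>(2) nat_comp_apply by metis
    qed (use \<delta> \<gamma> in auto)
  qed
qed

end

section \<open>Existence of sheafifications in a universe\<close>

context topologised_category
begin

text \<open>A section over \<open>c\<close> of the sheaf associated with \<open>P\<close> is recorded by all sections of \<open>P\<close>
  that represent it: \<open>s g\<close> is the set of the elements of \<open>P\<close> over the domain of \<open>g\<close> whose
  image in the associated sheaf is the restriction along \<open>g\<close>. Recording all representatives
  makes the construction work in one step and without quotients. The value of \<open>s\<close> at all other
  arrows is empty, so that equal sections are equal functions.\<close>

definition assoc_section :: "('o, 'a, 'x) psh \<Rightarrow> 'o \<Rightarrow> ('a \<Rightarrow> 'x set) \<Rightarrow> bool" where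
  "assoc_section P c s \<longleftrightarrow>
     (\<forall>g. \<not> (g \<in> Arr C \<and> Cod C g = c) \<longrightarrow> s g = {}) \<and>
     (\<forall>g\<in>Arr C. s g \<subseteq> Val P (Dom C g)) \<and>
     (\<forall>g\<in>Arr C. \<forall>h\<in>Arr C. \<forall>y\<in>s g. Cod C h = Dom C g \<longrightarrow> Res P h y \<in> s (Comp C g h)) \<and>
     (\<forall>g\<in>Arr C. \<forall>y\<in>s g. \<forall>z\<in>s g. locally (Dom C g) (\<lambda>h. Res P h y = Res P h z)) \<and>
     (\<forall>g\<in>Arr C. \<forall>y\<in>Val P (Dom C g). Cod C g = c \<longrightarrow>
        locally (Dom C g) (\<lambda>h. Res P h y \<in> s (Comp C g h)) \<longrightarrow> y \<in> s g) \<and>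
     locally c (\<lambda>g. s g \<noteq> {})"

definition assoc_sheaf :: "('o, 'a, 'x) psh \<Rightarrow> ('o, 'a, 'a \<Rightarrow> 'x set) psh" where
  "assoc_sheaf P = \<lparr>Val = (\<lambda>c. {s. assoc_section P c s}),
     Res = (\<lambda>h s g. if g \<in> Arr C \<and> Cod C g = Dom C h then s (Comp C h g) else {})\<rparr>"

definition assoc_unit :: "('o, 'a, 'x) psh \<Rightarrow> 'o \<Rightarrow> 'x \<Rightarrow> 'a \<Rightarrow> 'x set" where
  "assoc_unit P = mk_nat C P (\<lambda>c y g. if g \<in> Arr C \<and> Cod C g = c
     then {z \<in> Val P (Dom C g). locally (Dom C g) (\<lambda>h. Res P h z = Res P (Comp C g h) y)} else {})"

lemma assoc_sectionD:
  assumes "assoc_section P c s"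
  shows "\<not> (g \<in> Arr C \<and> Cod C g = c) \<Longrightarrow> s g = {}"
    and "g \<in> Arr C \<Longrightarrow> y \<in> s g \<Longrightarrow> y \<in> Val P (Dom C g)"
    and "g \<in> Arr C \<Longrightarrow> h \<in> Arr C \<Longrightarrow> y \<in> s g \<Longrightarrow> Cod C h = Dom C g \<Longrightarrow> Res P h y \<in> s (Comp C g h)"
    and "g \<in> Arr C \<Longrightarrow> y \<in> s g \<Longrightarrow> z \<in> s g \<Longrightarrow> locally (Dom C g) (\<lambda>h. Res P h y = Res P h z)"
    and "g \<in> Arr C \<Longrightarrow> y \<in> Val P (Dom C g) \<Longrightarrow> Cod C g = c \<Longrightarrow>
        locally (Dom C g) (\<lambda>h. Res P h y \<in> s (Comp C g h)) \<Longrightarrow> y \<in> s g"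
    and "locally c (\<lambda>g. s g \<noteq> {})"
proof -
  note a = assms[unfolded assoc_section_def]
  show "\<not> (g \<in> Arr C \<and> Cod C g = c) \<Longrightarrow> s g = {}" using a by simp
  show "g \<in> Arr C \<Longrightarrow> y \<in> s g \<Longrightarrow> y \<in> Val P (Dom C g)" using a by (elim conjE) blast
  show "g \<in> Arr C \<Longrightarrow> h \<in> Arr C \<Longrightarrow> y \<in> s g \<Longrightarrow> Cod C h = Dom C g \<Longrightarrow> Res P h y \<in> s (Comp C g h)"
    using a by (elim conjE) simp
  show "g \<in> Arr C \<Longrightarrow> y \<in> s g \<Longrightarrow> z \<in> s g \<Longrightarrow> locally (Dom C g) (\<lambda>h. Res P h y = Res P h z)"
    using a by (elim conjE) simp
  show "g \<in> Arr C \<Longrightarrow> y \<in> Val P (Dom C g) \<Longrightarrow> Cod C g = c \<Longrightarrow>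
        locally (Dom C g) (\<lambda>h. Res P h y \<in> s (Comp C g h)) \<Longrightarrow> y \<in> s g"
    using a by (elim conjE) simp
  show "locally c (\<lambda>g. s g \<noteq> {})" using a by (elim conjE)
qed

lemma Val_assoc_sheaf [simp]: "s \<in> Val (assoc_sheaf P) c \<longleftrightarrow> assoc_section P c s"
  by (simp add: assoc_sheaf_def)

lemma Res_assoc_sheaf [simp]:
  "Res (assoc_sheaf P) h s = (\<lambda>g. if g \<in> Arr C \<and> Cod C g = Dom C h then s (Comp C h g) else {})"
  by (simp add: assoc_sheaf_def)

lemma assoc_section_iff_locally:
  assumes s: "assoc_section P c s" and c: "c \<in> Obj C" and g: "g \<in> Arr C" "Cod C g = c"
    and y: "y \<in> Val P (Dom C g)"
  shows "y \<in> s g \<longleftrightarrow> locally (Dom C g) (\<lambda>h. Res P h y \<in> s (Comp C g h))"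
proof
  assume "y \<in> s g"
  then show "locally (Dom C g) (\<lambda>h. Res P h y \<in> s (Comp C g h))"
    by (intro locally_always) (use assoc_sectionD(3)[OF s g(1)] g in auto)
qed (rule assoc_sectionD(5)[OF s g(1) y g(2)])

lemma assoc_section_res:
  assumes s: "assoc_section P (Cod C f) s" and f: "f \<in> Arr C"
  shows "assoc_section P (Dom C f) (Res (assoc_sheaf P) f s)"
  unfolding assoc_section_def Res_assoc_sheaf
proof (intro conjI allI ballI impI subsetI)
  fix g h y
  assume g: "g \<in> Arr C" and h: "h \<in> Arr C" "Cod C h = Dom C g"
    and y: "y \<in> (if g \<in> Arr C \<and> Cod C g = Dom C f then s (Comp C f g) else {})"
  then have cg: "Cod C g = Dom C f" by (auto split: if_splits)
  then show "Res P h y \<in> (if Comp C g h \<in> Arr C \<and> Cod C (Comp C g h) = Dom C f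
      then s (Comp C f (Comp C g h)) else {})"
    using assoc_sectionD(3)[OF s, of "Comp C f g" h y] y g h f by (simp add: comp_assoc)
next
  fix g y z
  assume "g \<in> Arr C" "y \<in> (if g \<in> Arr C \<and> Cod C g = Dom C f then s (Comp C f g) else {})"
    "z \<in> (if g \<in> Arr C \<and> Cod C g = Dom C f then s (Comp C f g) else {})"
  then show "locally (Dom C g) (\<lambda>h. Res P h y = Res P h z)"
    using assoc_sectionD(4)[OF s, of "Comp C f g" y z] f by (auto split: if_splits)
next
  fix g y
  assume g: "g \<in> Arr C" "Cod C g = Dom C f" and y: "y \<in> Val P (Dom C g)"
    and loc: "locally (Dom C g) (\<lambda>h. Res P h y \<in> (if Comp C g h \<in> Arr C \<and> Cod C (Comp C g h) = Dom C f
      then s (Comp C f (Comp C g h)) else {}))"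
  have "locally (Dom C g) (\<lambda>h. Res P h y \<in> s (Comp C (Comp C f g) h))"
    by (rule locally_mono[OF loc]) (use g f in \<open>auto simp: comp_assoc\<close>)
  then show "y \<in> (if g \<in> Arr C \<and> Cod C g = Dom C f then s (Comp C f g) else {})"
    using assoc_sectionD(5)[OF s, of "Comp C f g" y] y g f by simp
next
  show "locally (Dom C f) (\<lambda>g. (if g \<in> Arr C \<and> Cod C g = Dom C f then s (Comp C f g) else {}) \<noteq> {})"
    by (rule locally_mono[OF locally_pullback[OF assoc_sectionD(6)[OF s] f]]) (use f in auto)
next
  fix g y
  assume "g \<in> Arr C" "y \<in> (if g \<in> Arr C \<and> Cod C g = Dom C f then s (Comp C f g) else {})"
  then show "y \<in> Val P (Dom C g)"
    using assoc_sectionD(2)[OF s, of "Comp C f g" y] f by (auto split: if_splits)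
qed auto

lemma presheaf_assoc_sheaf: "presheaf C (assoc_sheaf P)"
proof -
  have "Res (assoc_sheaf P) (Id C c) s = s" if "c \<in> Obj C" "assoc_section P c s" for c s
    using that assoc_sectionD(1)[OF that(2)] by (auto simp: fun_eq_iff)
  moreover have "Res (assoc_sheaf P) (Comp C g f) s = Res (assoc_sheaf P) f (Res (assoc_sheaf P) g s)"
    if "f \<in> Arr C" "g \<in> Arr C" "Cod C f = Dom C g" for f g s
    using that by (auto simp: fun_eq_iff comp_assoc)
  ultimately show ?thesis
    unfolding presheaf_def by (auto simp del: Res_assoc_sheaf intro: assoc_section_res)
qed

text \<open>The representatives of the glued section over an arrow \<open>g\<close> are the elements which, restricted
  to arrows \<open>h\<close> such that \<open>g \<circ> h\<close> lies in the given sieve, locally represent the section given there.\<close>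

lemma sheaf_assoc_sheaf:
  assumes P: "presheaf C P"
  shows "sheaf C J (assoc_sheaf P)"
  unfolding sheaf_def
proof (intro conjI ballI allI impI)
  show "presheaf C (assoc_sheaf P)" by (rule presheaf_assoc_sheaf)
  fix c R x
  assume c: "c \<in> Obj C" and R: "R \<in> J c"
    and "\<forall>f\<in>R. x f \<in> Val (assoc_sheaf P) (Dom C f)"
    and compat: "\<forall>f\<in>R. \<forall>g\<in>Arr C. Cod C g = Dom C f \<longrightarrow>
      x (Comp C f g) = Res (assoc_sheaf P) g (x f)"
  then have x: "\<And>f. f \<in> R \<Longrightarrow> assoc_section P (Dom C f) (x f)" by simp
  note Ra = covering_arr[OF c R] and Rc = covering_comp[OF c R]
  have xid: "x (Comp C f h) (Id C (Dom C h)) = x f h"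
    if "f \<in> R" "h \<in> Arr C" "Cod C h = Dom C f" for f h
    using compat that by simp
  define rep where "rep g z h \<longleftrightarrow> Comp C g h \<in> R \<and> Res P h z \<in> x (Comp C g h) (Id C (Dom C h))" for g z h
  define y where "y g = (if g \<in> Arr C \<and> Cod C g = c
    then {z \<in> Val P (Dom C g). locally (Dom C g) (rep g z)} else {})" for g
  have rep_res: "rep (Comp C g k) (Res P k z) h \<longleftrightarrow> rep g z (Comp C k h)"
    if "g \<in> Arr C" "k \<in> Arr C" "h \<in> Arr C" "Cod C k = Dom C g" "Cod C h = Dom C k"
      "z \<in> Val P (Dom C g)" for g k z h
    using that unfolding rep_def by (simp add: comp_assoc res_comp[OF P])
  have y_restrict: "y (Comp C f g) = x f g"
    if f: "f \<in> R" and g: "g \<in> Arr C" "Cod C g = Dom C f" for f g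
  proof -
    have fa: "f \<in> Arr C" "Cod C f = c" using Ra f by auto
    have eq: "rep (Comp C f g) z h \<longleftrightarrow> Res P h z \<in> x f (Comp C g h)"
      if h: "h \<in> Arr C" "Cod C h = Dom C g" for z h
      using xid[OF f, of "Comp C g h"] Rc[OF f, of "Comp C g h"] f g h fa
      unfolding rep_def by (simp add: comp_assoc)
    have "locally (Dom C g) (rep (Comp C f g) z) \<longleftrightarrow>
        locally (Dom C g) (\<lambda>h. Res P h z \<in> x f (Comp C g h))" for z
      using eq g by (auto elim!: locally_mono)
    then show ?thesis
      using assoc_section_iff_locally[OF x[OF f] _ g] assoc_sectionD(2)[OF x[OF f] g(1)] fa g
      unfolding y_def by auto
  qed
  have y_sec: "assoc_section P c y"
    unfolding assoc_section_def
  proof (intro conjI allI ballI impI)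
    fix g h z
    assume g: "g \<in> Arr C" and h: "h \<in> Arr C" "Cod C h = Dom C g" and z: "z \<in> y g"
    have z': "Cod C g = c" "z \<in> Val P (Dom C g)" "locally (Cod C h) (rep g z)"
      using z h unfolding y_def by (auto split: if_splits)
    have "locally (Dom C h) (rep (Comp C g h) (Res P h z))"
      by (rule locally_mono[OF locally_pullback[OF z'(3) h(1)]]) (use g h z' rep_res in auto)
    then show "Res P h z \<in> y (Comp C g h)"
      using g h z' res_val[OF P h(1)] unfolding y_def by auto
  next
    fix g z z'
    assume g: "g \<in> Arr C" and z: "z \<in> y g" "z' \<in> y g"
    have zz: "Cod C g = c" "z \<in> Val P (Dom C g)" "z' \<in> Val P (Dom C g)"
      "locally (Dom C g) (rep g z)" "locally (Dom C g) (rep g z')"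
      using z unfolding y_def by (auto split: if_splits)
    have d: "Dom C g \<in> Obj C" using g by simp
    show "locally (Dom C g) (\<lambda>h. Res P h z = Res P h z')"
    proof (rule locally_bind[OF d locally_conj[OF d zz(4,5)]])
      fix h assume h: "h \<in> Arr C" "Cod C h = Dom C g" and r: "rep g z h \<and> rep g z' h"
      have "locally (Dom C h) (\<lambda>k. Res P k (Res P h z) = Res P k (Res P h z'))"
        using r g h assoc_sectionD(4)[OF x, of "Comp C g h" "Id C (Dom C h)"] unfolding rep_def by simp
      then show "locally (Dom C h) (\<lambda>k. Res P (Comp C h k) z = Res P (Comp C h k) z')"
        by (rule locally_mono) (use h zz in \<open>auto simp: res_comp[OF P]\<close>)
    qed
  next
    fix g z
    assume g: "g \<in> Arr C" "Cod C g = c" and z: "z \<in> Val P (Dom C g)"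
      and loc: "locally (Dom C g) (\<lambda>h. Res P h z \<in> y (Comp C g h))"
    have d: "Dom C g \<in> Obj C" using g by simp
    have "locally (Dom C g) (rep g z)"
    proof (rule locally_bind[OF d loc])
      fix h assume h: "h \<in> Arr C" "Cod C h = Dom C g" "Res P h z \<in> y (Comp C g h)"
      then have "locally (Dom C h) (rep (Comp C g h) (Res P h z))"
        using g unfolding y_def by simp
      then show "locally (Dom C h) (\<lambda>k. rep g z (Comp C h k))"
        by (rule locally_mono) (use g h z rep_res in auto)
    qed
    then show "z \<in> y g" using g z unfolding y_def by simp
  next
    have "locally c (\<lambda>f. f \<in> R)" using R unfolding locally_def by blast
    then have "locally c (\<lambda>f. locally (Dom C f) (\<lambda>g. y (Comp C f g) \<noteq> {}))"
    proof (rule locally_mono[OF _ c])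
      fix f assume f: "f \<in> R"
      show "locally (Dom C f) (\<lambda>g. y (Comp C f g) \<noteq> {})"
        by (rule locally_mono[OF assoc_sectionD(6)[OF x[OF f]]]) (use f Ra y_restrict in auto)
    qed
    then show "locally c (\<lambda>g. y g \<noteq> {})" by (rule locally_trans[OF c])
  qed (auto simp: y_def)
  have unique: "y' g = y g" if y': "assoc_section P c y'"
      and res: "\<And>f. f \<in> R \<Longrightarrow> Res (assoc_sheaf P) f y' = x f" for y' g
  proof (cases "g \<in> Arr C \<and> Cod C g = c")
    case True
    then have g: "g \<in> Arr C" "Cod C g = c" and d: "Dom C g \<in> Obj C" by auto
    have "locally (Cod C g) (\<lambda>f. f \<in> R)" using R g unfolding locally_def by blast
    then have inR: "locally (Dom C g) (\<lambda>h. Comp C g h \<in> R)" using locally_pullback g by blast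
    have eq: "rep g z h \<longleftrightarrow> Res P h z \<in> y' (Comp C g h)"
      if h: "h \<in> Arr C" "Cod C h = Dom C g" "Comp C g h \<in> R" for z h
      using res[OF h(3), symmetric] h g unfolding rep_def by simp
    have "locally (Dom C g) (rep g z) \<longleftrightarrow> locally (Dom C g) (\<lambda>h. Res P h z \<in> y' (Comp C g h))" for z
    proof
      assume "locally (Dom C g) (rep g z)"
      from locally_conj[OF d this inR] show "locally (Dom C g) (\<lambda>h. Res P h z \<in> y' (Comp C g h))"
        by (rule locally_mono[OF _ d]) (use eq in auto)
    next
      assume "locally (Dom C g) (\<lambda>h. Res P h z \<in> y' (Comp C g h))"
      from locally_conj[OF d this inR] show "locally (Dom C g) (rep g z)"
        by (rule locally_mono[OF _ d]) (use eq in auto)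
    qed
    then show ?thesis
      using assoc_section_iff_locally[OF y' c g] assoc_sectionD(2)[OF y' g(1)] g
      unfolding y_def by auto
  qed (use assoc_sectionD(1)[OF y'] in \<open>auto simp: y_def\<close>)
  show "\<exists>!y. y \<in> Val (assoc_sheaf P) c \<and> (\<forall>f\<in>R. Res (assoc_sheaf P) f y = x f)"
  proof (rule ex1I[of _ y])
    have "Res (assoc_sheaf P) f y = x f" if "f \<in> R" for f
      using that y_restrict assoc_sectionD(1)[OF x[OF that]] by (auto simp: fun_eq_iff)
    then show "y \<in> Val (assoc_sheaf P) c \<and> (\<forall>f\<in>R. Res (assoc_sheaf P) f y = x f)"
      using y_sec by simp
    fix y' assume "y' \<in> Val (assoc_sheaf P) c \<and> (\<forall>f\<in>R. Res (assoc_sheaf P) f y' = x f)"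
    then show "y' = y" using unique by (intro ext) auto
  qed
qed

lemma assoc_unit_iff:
  assumes "c \<in> Obj C" "y \<in> Val P c" "g \<in> Arr C" "Cod C g = c"
  shows "z \<in> assoc_unit P c y g \<longleftrightarrow>
    z \<in> Val P (Dom C g) \<and> locally (Dom C g) (\<lambda>h. Res P h z = Res P (Comp C g h) y)"
  using assms by (simp add: assoc_unit_def)

lemma assoc_unit_section:
  assumes P: "presheaf C P" and c: "c \<in> Obj C" and y: "y \<in> Val P c"
  shows "assoc_section P c (assoc_unit P c y)"
  unfolding assoc_section_def
proof (intro conjI allI ballI impI)
  let ?s = "assoc_unit P c y"
  have dest: "Cod C g = c \<and> z \<in> Val P (Dom C g) \<and> locally (Dom C g) (\<lambda>h. Res P h z = Res P (Comp C g h) y)"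
    if "z \<in> ?s g" "g \<in> Arr C" for z g
    using that c y by (auto simp: assoc_unit_def split: if_splits)
  note intro = assoc_unit_iff[OF c y, THEN iffD2]
  show "?s g = {}" if "\<not> (g \<in> Arr C \<and> Cod C g = c)" for g
    using that c y by (auto simp: assoc_unit_def)
  show "?s g \<subseteq> Val P (Dom C g)" if "g \<in> Arr C" for g
    using dest that by blast
  fix g assume g: "g \<in> Arr C"
  then have d: "Dom C g \<in> Obj C" by simp
  show "locally (Dom C g) (\<lambda>h. Res P h z = Res P h z')" if "z \<in> ?s g" "z' \<in> ?s g" for z z'
    using locally_conj[OF d dest[OF that(1) g, THEN conjunct2, THEN conjunct2]
        dest[OF that(2) g, THEN conjunct2, THEN conjunct2]]
    by (rule locally_mono[OF _ d]) auto
  show "Res P h z \<in> ?s (Comp C g h)"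
    if h: "h \<in> Arr C" "Cod C h = Dom C g" and z: "z \<in> ?s g" for h z
  proof (rule intro)
    have z': "Cod C g = c" "z \<in> Val P (Cod C h)" "locally (Cod C h) (\<lambda>h. Res P h z = Res P (Comp C g h) y)"
      using dest[OF z g] h by auto
    have "locally (Dom C h) (\<lambda>k. Res P k (Res P h z) = Res P (Comp C (Comp C g h) k) y)"
      by (rule locally_mono[OF locally_pullback[OF z'(3) h(1)]])
         (use z' g h in \<open>auto simp: comp_assoc res_comp[OF P]\<close>)
    then show "Res P h z \<in> Val P (Dom C (Comp C g h)) \<and>
        locally (Dom C (Comp C g h)) (\<lambda>k. Res P k (Res P h z) = Res P (Comp C (Comp C g h) k) y)"
      using res_val[OF P h(1) z'(2)] g h by simp
  qed (use dest[OF z g] g h in auto)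
  show "z \<in> ?s g"
    if z: "z \<in> Val P (Dom C g)" and gc: "Cod C g = c"
      and loc: "locally (Dom C g) (\<lambda>h. Res P h z \<in> ?s (Comp C g h))" for z
  proof (rule intro[OF g gc], intro conjI z)
    show "locally (Dom C g) (\<lambda>h. Res P h z = Res P (Comp C g h) y)"
    proof (rule locally_bind[OF d loc])
      fix h assume h: "h \<in> Arr C" "Cod C h = Dom C g" "Res P h z \<in> ?s (Comp C g h)"
      have "locally (Dom C h) (\<lambda>k. Res P k (Res P h z) = Res P (Comp C (Comp C g h) k) y)"
        using dest[OF h(3)] g h by simp
      then show "locally (Dom C h) (\<lambda>k. Res P (Comp C h k) z = Res P (Comp C g (Comp C h k)) y)"
        by (rule locally_mono) (use z g h in \<open>auto simp: comp_assoc res_comp[OF P]\<close>)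
    qed
  qed
next
  show "locally c (\<lambda>g. assoc_unit P c y g \<noteq> {})"
  proof (rule locally_always[OF c])
    fix g assume g: "g \<in> Arr C" "Cod C g = c"
    then have "Res P g y \<in> assoc_unit P c y g"
      using y by (auto simp: assoc_unit_iff[OF c y] res_val[OF P] res_comp[OF P] intro!: locally_always)
    then show "assoc_unit P c y g \<noteq> {}" by blast
  qed
qed

text \<open>A section is, over each arrow where it has a representative, the image of that representative.
  Naturality and local surjectivity of the unit are both instances of this.\<close>

lemma assoc_section_represented:
  assumes P: "presheaf C P" and s: "assoc_section P c s" and g: "g \<in> Arr C" "Cod C g = c"
    and z: "z \<in> s g"
  shows "Res (assoc_sheaf P) g s = assoc_unit P (Dom C g) z"
proof -
  have d: "Dom C g \<in> Obj C" using g by simp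
  have zv: "z \<in> Val P (Dom C g)" using assoc_sectionD(2)[OF s g(1) z] .
  have "s (Comp C g h) = assoc_unit P (Dom C g) z h" if h: "h \<in> Arr C" "Cod C h = Dom C g" for h
  proof -
    have gh: "Comp C g h \<in> Arr C" "Cod C (Comp C g h) = c" "Dom C (Comp C g h) = Dom C h" using g h by auto
    have zh: "Res P h z \<in> s (Comp C g h)" using assoc_sectionD(3)[OF s g(1) h(1) z h(2)] .
    have "w \<in> s (Comp C g h) \<longleftrightarrow>
        w \<in> Val P (Dom C h) \<and> locally (Dom C h) (\<lambda>k. Res P k w = Res P (Comp C h k) z)" for w
    proof
      assume w: "w \<in> s (Comp C g h)"
      have "locally (Dom C h) (\<lambda>k. Res P k w = Res P k (Res P h z))"
        using assoc_sectionD(4)[OF s gh(1) w zh] gh by simp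
      then have "locally (Dom C h) (\<lambda>k. Res P k w = Res P (Comp C h k) z)"
        by (rule locally_mono) (use h zv in \<open>auto simp: res_comp[OF P]\<close>)
      then show "w \<in> Val P (Dom C h) \<and> locally (Dom C h) (\<lambda>k. Res P k w = Res P (Comp C h k) z)"
        using assoc_sectionD(2)[OF s gh(1) w] gh by simp
    next
      assume w: "w \<in> Val P (Dom C h) \<and> locally (Dom C h) (\<lambda>k. Res P k w = Res P (Comp C h k) z)"
      have "locally (Dom C h) (\<lambda>k. Res P k w \<in> s (Comp C (Comp C g h) k))"
      proof (rule locally_mono[OF conjunct2[OF w]])
        fix k assume k: "k \<in> Arr C" "Cod C k = Dom C h" "Res P k w = Res P (Comp C h k) z"
        then show "Res P k w \<in> s (Comp C (Comp C g h) k)"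
          using assoc_sectionD(3)[OF s gh(1) k(1) zh] gh h zv by (simp add: res_comp[OF P])
      qed (use h in auto)
      then show "w \<in> s (Comp C g h)" using assoc_sectionD(5)[OF s gh(1), of w] w gh by simp
    qed
    then show ?thesis using assoc_unit_iff[OF d zv h] by blast
  qed
  then show ?thesis
    using d zv by (auto simp: fun_eq_iff assoc_unit_def)
qed

lemma local_iso_assoc_unit:
  assumes P: "presheaf C P"
  shows "local_iso P (assoc_sheaf P) (assoc_unit P)"
  unfolding local_iso_def
proof (intro conjI ballI impI)
  have self: "Res P g y \<in> assoc_unit P c y g"
    if "c \<in> Obj C" "y \<in> Val P c" "g \<in> Arr C" "Cod C g = c" for c y g
    using that by (auto simp: assoc_unit_iff res_val[OF P] res_comp[OF P] intro!: locally_always)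
  have "assoc_unit P (Dom C f) (Res P f y) = Res (assoc_sheaf P) f (assoc_unit P (Cod C f) y)"
    if f: "f \<in> Arr C" and y: "y \<in> Val P (Cod C f)" for f y
    using assoc_section_represented[OF P assoc_unit_section[OF P _ y] f _ self[OF _ y f]] f by simp
  then have "nat_trans C P (assoc_sheaf P) (mk_nat C P (assoc_unit P))"
    using assoc_unit_section[OF P] by (intro nat_trans_mk_nat[OF P]) (auto simp del: Res_assoc_sheaf)
  moreover have "mk_nat C P (assoc_unit P) = assoc_unit P"
    by (auto simp: assoc_unit_def mk_nat_def fun_eq_iff)
  ultimately show "nat_trans C P (assoc_sheaf P) (assoc_unit P)" by simp
  show "locally c (\<lambda>g. Res P g x = Res P g y)"
    if c: "c \<in> Obj C" and x: "x \<in> Val P c" and y: "y \<in> Val P c"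
      and eq: "assoc_unit P c x = assoc_unit P c y" for c x y
  proof -
    have "x \<in> assoc_unit P c x (Id C c)"
      using self[OF c x, of "Id C c"] c x by (simp add: res_id[OF P])
    then have "locally c (\<lambda>g. Res P g x = Res P (Comp C (Id C c) g) y)"
      unfolding eq using assoc_unit_iff[OF c y, of "Id C c"] c by simp
    then show ?thesis by (rule locally_mono[OF _ c]) auto
  qed
  show "locally c (\<lambda>g. \<exists>x\<in>Val P (Dom C g). assoc_unit P (Dom C g) x = Res (assoc_sheaf P) g s)"
    if c: "c \<in> Obj C" and "s \<in> Val (assoc_sheaf P) c" for c s
  proof -
    have s: "assoc_section P c s" using that by simp
    show ?thesis
    proof (rule locally_mono[OF assoc_sectionD(6)[OF s] c])
      fix g assume g: "g \<in> Arr C" "Cod C g = c" "s g \<noteq> {}"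
      then obtain z where z: "z \<in> s g" by blast
      then show "\<exists>x\<in>Val P (Dom C g). assoc_unit P (Dom C g) x = Res (assoc_sheaf P) g s"
        using assoc_section_represented[OF P s g(1,2) z] assoc_sectionD(2)[OF s g(1) z] by auto
    qed
  qed
qed

end

lemma small_family_code:
  assumes "small TYPE('u) A"
  shows "\<exists>e :: ('x \<Rightarrow> 'u) \<Rightarrow> 'u. \<forall>\<phi> \<psi>. e \<phi> = e \<psi> \<longrightarrow> (\<forall>a\<in>A. \<phi> a = \<psi> a)"
proof -
  obtain e :: "('x \<Rightarrow> 'u) \<Rightarrow> 'u" where e: "inj_on e (A \<rightarrow>\<^sub>E UNIV)"
    using assms unfolding small_def by blast
  have "\<phi> a = \<psi> a" if eq: "e (restrict \<phi> A) = e (restrict \<psi> A)" and a: "a \<in> A" for \<phi> \<psi> a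
  proof -
    have "restrict \<phi> A = restrict \<psi> A" using eq e by (simp add: inj_on_eq_iff)
    then show ?thesis using a by (metis restrict_apply')
  qed
  then show ?thesis by (intro exI[of _ "\<lambda>\<phi>. e (restrict \<phi> A)"]) blast
qed

text \<open>A set is smaller than its power set, and characteristic functions are families with two
  distinct values.\<close>

lemma small_embeds:
  assumes "small TYPE('u) A" and inf: "infinite (UNIV :: 'u set)"
  shows "\<exists>j :: 'x \<Rightarrow> 'u. inj_on j A"
proof -
  obtain e :: "('x \<Rightarrow> 'u) \<Rightarrow> 'u" where e: "\<forall>\<phi> \<psi>. e \<phi> = e \<psi> \<longrightarrow> (\<forall>a\<in>A. \<phi> a = \<psi> a)"
    using small_family_code[OF assms(1)] by blast
  obtain u v :: 'u where uv: "u \<noteq> v"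
  proof -
    fix u :: 'u
    have "finite {u}" by simp
    then have "UNIV \<noteq> {u}" using inf by metis
    then show thesis using that by blast
  qed
  have "inj_on (\<lambda>a. e (\<lambda>x. if x = a then u else v)) A"
  proof (rule inj_onI)
    fix a b assume "a \<in> A" "b \<in> A" "e (\<lambda>x. if x = a then u else v) = e (\<lambda>x. if x = b then u else v)"
    then have "(if a = a then u else v) = (if a = b then u else v)" using e by blast
    then show "a = b" using uv by (simp split: if_splits)
  qed
  then show ?thesis by blast
qed

lemma infinite_option_embeds:
  assumes "infinite (UNIV :: 'u set)"
  shows "\<exists>o' :: 'u option \<Rightarrow> 'u. inj o'"
proof -
  fix a :: 'u
  obtain h :: "'u \<Rightarrow> 'u" where h: "bij_betw h UNIV (UNIV - {a})"
    using infinite_imp_bij_betw[OF assms] by blast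
  have ne: "h x \<noteq> a" for x using bij_betw_apply[OF h, of x] by simp
  have "inj h" using h by (rule bij_betw_imp_inj_on)
  then have "inj (case_option a h)"
    using ne by (intro injI) (auto dest: injD split: option.splits)
  then show ?thesis by blast
qed

text \<open>The smallness conditions of a site make the associated sheaf of a presheaf fit into the
  universe \<open>'u\<close>; its being infinite leaves room for coding the absence of a representative.\<close>

locale universe_site = topologised_category C J
  for C :: "('o, 'a) category" and J :: "'o \<Rightarrow> 'a set set" +
  fixes U :: "'u itself"
  assumes site: "site TYPE('u) C J"
    and infinite_universe: "infinite (UNIV :: 'u set)"
begin

definition fits_universe :: "('o, 'a, 'x) psh \<Rightarrow> bool" where
  "fits_universe P \<longleftrightarrow> (\<forall>c\<in>Obj C. \<exists>j :: 'x \<Rightarrow> 'u. inj_on j (Val P c))"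

lemma hom_embeds:
  "a \<in> Obj C \<Longrightarrow> b \<in> Obj C \<Longrightarrow> \<exists>j :: 'a \<Rightarrow> 'u. inj_on j (hom C a b)"
  using site small_embeds[OF _ infinite_universe] unfolding site_def by blast

text \<open>A section of the associated sheaf is determined by one representative over each arrow from
  a generating object, where a representative exists; there is only a small set of such arrows.\<close>

lemma fits_universe_assoc_sheaf:
  assumes P: "presheaf C P" and fits: "fits_universe P"
  shows "fits_universe (assoc_sheaf P)"
  unfolding fits_universe_def
proof
  fix c assume c: "c \<in> Obj C"
  obtain G where G: "G \<subseteq> Obj C" "small TYPE('u) G"
    and gen: "\<And>c. c \<in> Obj C \<Longrightarrow> covering_family C J c {f \<in> Arr C. Cod C f = c \<and> Dom C f \<in> G}"
    using site unfolding site_def by blast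
  obtain eG :: "('o \<Rightarrow> 'u) \<Rightarrow> 'u" where eG: "\<And>\<phi> \<psi>. eG \<phi> = eG \<psi> \<Longrightarrow> (\<forall>a\<in>G. \<phi> a = \<psi> a)"
    using small_family_code[OF G(2)] by blast
  have "\<forall>x\<in>G. \<exists>e :: ('a \<Rightarrow> 'u) \<Rightarrow> 'u. \<forall>\<phi> \<psi>. e \<phi> = e \<psi> \<longrightarrow> (\<forall>g\<in>hom C x c. \<phi> g = \<psi> g)"
    using small_family_code G(1) c site unfolding site_def by blast
  then obtain eH :: "'o \<Rightarrow> ('a \<Rightarrow> 'u) \<Rightarrow> 'u"
    where eH: "\<And>x \<phi> \<psi>. x \<in> G \<Longrightarrow> eH x \<phi> = eH x \<psi> \<Longrightarrow> (\<forall>g\<in>hom C x c. \<phi> g = \<psi> g)"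
    by metis
  obtain o' :: "'u option \<Rightarrow> 'u" where o': "inj o'"
    using infinite_option_embeds infinite_universe by blast
  obtain jP :: "'o \<Rightarrow> 'b \<Rightarrow> 'u" where jP: "\<And>x. x \<in> Obj C \<Longrightarrow> inj_on (jP x) (Val P x)"
    using fits unfolding fits_universe_def by metis
  define pick where "pick s g = (SOME y. y \<in> s g)" for s :: "'a \<Rightarrow> 'b set" and g
  define code where
    "code s g = o' (if s g = {} then None else Some (jP (Dom C g) (pick s g)))" for s g
  define j where "j s = eG (\<lambda>x. eH x (code s))" for s
  have pick: "pick s g \<in> s g" if "s g \<noteq> {}" for s g
    using that unfolding pick_def by (simp add: some_in_eq)
  have sub: "s g \<subseteq> s' g"
    if s: "assoc_section P c s" and s': "assoc_section P c s'" and eq: "j s = j s'" for s s' g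
  proof
    fix z assume z: "z \<in> s g"
    then have g: "g \<in> Arr C" "Cod C g = c" using assoc_sectionD(1)[OF s] by blast+
    then have d: "Dom C g \<in> Obj C" by simp
    have zv: "z \<in> Val P (Dom C g)" using assoc_sectionD(2)[OF s g(1) z] .
    have code: "code s k = code s' k" if "k \<in> Arr C" "Cod C k = c" "Dom C k \<in> G" for k
      using eG[OF eq[unfolded j_def]] eH[OF that(3)] that unfolding hom_def by blast
    have step: "Res P u z \<in> s' (Comp C g u)"
      if u: "u \<in> Arr C" "Cod C u = Dom C g" "Dom C u \<in> G" for u
    proof -
      have gu: "Comp C g u \<in> Arr C" "Cod C (Comp C g u) = c" "Dom C (Comp C g u) = Dom C u"
        using g u by auto
      have zu: "Res P u z \<in> s (Comp C g u)" using assoc_sectionD(3)[OF s g(1) u(1) z u(2)] .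
      have zuv: "Res P u z \<in> Val P (Dom C u)" using assoc_sectionD(2)[OF s gu(1) zu] gu by simp
      have "code s (Comp C g u) = code s' (Comp C g u)" using code gu u by simp
      then have ne: "s (Comp C g u) \<noteq> {}" "s' (Comp C g u) \<noteq> {}"
        and jeq: "jP (Dom C u) (pick s (Comp C g u)) = jP (Dom C u) (pick s' (Comp C g u))"
        using zu gu injD[OF o'] unfolding code_def by (auto split: if_splits dest!: injD[OF o'])
      define y where "y = pick s (Comp C g u)"
      have y: "y \<in> s (Comp C g u)" "y \<in> s' (Comp C g u)"
      proof -
        show y1: "y \<in> s (Comp C g u)" using pick ne(1) unfolding y_def by blast
        have y2: "pick s' (Comp C g u) \<in> s' (Comp C g u)" using pick ne(2) by blast
        have "y = pick s' (Comp C g u)"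
          using inj_onD[OF jP jeq[folded y_def]] assoc_sectionD(2)[OF s gu(1) y1]
            assoc_sectionD(2)[OF s' gu(1) y2] gu u by simp
        then show "y \<in> s' (Comp C g u)" using y2 by simp
      qed
      have "locally (Dom C u) (\<lambda>h. Res P h (Res P u z) = Res P h y)"
        using assoc_sectionD(4)[OF s gu(1) zu y(1)] gu by simp
      then have "locally (Dom C u) (\<lambda>h. Res P h (Res P u z) \<in> s' (Comp C (Comp C g u) h))"
        by (rule locally_mono) (use u gu assoc_sectionD(3)[OF s' gu(1) _ y(2)] in auto)
      then show ?thesis using assoc_sectionD(5)[OF s' gu(1)] gu zuv by simp
    qed
    have "locally (Dom C g) (\<lambda>h. Res P h z \<in> s' (Comp C g h))"
    proof (rule locally_mono[OF locally_covering_family[OF gen[OF d] d] d])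
      fix h
      assume "\<exists>u\<in>{f \<in> Arr C. Cod C f = Dom C g \<and> Dom C f \<in> G}.
        \<exists>t\<in>Arr C. Cod C t = Dom C u \<and> h = Comp C u t"
      then obtain u t where u: "u \<in> Arr C" "Cod C u = Dom C g" "Dom C u \<in> G"
        and t: "t \<in> Arr C" "Cod C t = Dom C u" "h = Comp C u t" by blast
      have "Res P t (Res P u z) \<in> s' (Comp C (Comp C g u) t)"
        using assoc_sectionD(3)[OF s' _ t(1) step[OF u]] g u t by simp
      then show "Res P h z \<in> s' (Comp C g h)"
        using g u t zv by (simp add: comp_assoc res_comp[OF P])
    qed
    then show "z \<in> s' g" using assoc_sectionD(5)[OF s' g(1) zv g(2)] by blast
  qed
  have "inj_on j (Val (assoc_sheaf P) c)"
    using sub by (intro inj_onI ext) (simp add: subset_antisym)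
  then show "\<exists>j :: ('a \<Rightarrow> 'b set) \<Rightarrow> 'u. inj_on j (Val (assoc_sheaf P) c)" by blast
qed

end

context topologised_category
begin

text \<open>Transport of a presheaf along injections \<open>j c\<close> of its sets of sections.\<close>

definition relabel :: "('o \<Rightarrow> 'x \<Rightarrow> 'y) \<Rightarrow> ('o, 'a, 'x) psh \<Rightarrow> ('o, 'a, 'y) psh" where
  "relabel j P = \<lparr>Val = (\<lambda>c. j c ` Val P c),
     Res = (\<lambda>g u. j (Dom C g) (Res P g (inv_into (Val P (Cod C g)) (j (Cod C g)) u)))\<rparr>"

lemma Val_relabel [simp]: "Val (relabel j P) c = j c ` Val P c"
  by (simp add: relabel_def)

lemma Res_relabel:
  "inj_on (j (Cod C g)) (Val P (Cod C g)) \<Longrightarrow> x \<in> Val P (Cod C g) \<Longrightarrow>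
     Res (relabel j P) g (j (Cod C g) x) = j (Dom C g) (Res P g x)"
  by (simp add: relabel_def)

lemma relabel_sheaf:
  assumes F: "sheaf C J F" and inj: "\<And>c. c \<in> Obj C \<Longrightarrow> inj_on (j c) (Val F c)"
  shows "sheaf C J (relabel j F)"
proof -
  note P = sheaf_presheaf[OF F]
  have res: "Res (relabel j F) g (j c x) = j (Dom C g) (Res F g x)"
    if "g \<in> Arr C" "Cod C g = c" "x \<in> Val F c" for g c x
    using Res_relabel[of j g F x] inj that by auto
  have "presheaf C (relabel j F)"
    unfolding presheaf_def by (auto simp: res res_val[OF P] res_comp[OF P] res_id[OF P])
  moreover have "\<exists>!y. y \<in> Val (relabel j F) c \<and> (\<forall>f\<in>R. Res (relabel j F) f y = x f)"
    if c: "c \<in> Obj C" and R: "R \<in> J c"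
      and x: "\<forall>f\<in>R. x f \<in> Val (relabel j F) (Dom C f)"
      and compat: "\<forall>f\<in>R. \<forall>g\<in>Arr C. Cod C g = Dom C f \<longrightarrow>
        x (Comp C f g) = Res (relabel j F) g (x f)" for c R x
  proof -
    note Ra = covering_arr[OF c R]
    have "\<forall>f\<in>R. \<exists>x'. x' \<in> Val F (Dom C f) \<and> x f = j (Dom C f) x'" using x by auto
    then obtain x' where x': "\<And>f. f \<in> R \<Longrightarrow> x' f \<in> Val F (Dom C f)"
      and xx: "\<And>f. f \<in> R \<Longrightarrow> x f = j (Dom C f) (x' f)" by metis
    have eq: "x' (Comp C f g) = Res F g (x' f)"
      if f: "f \<in> R" and g: "g \<in> Arr C" "Cod C g = Dom C f" for f g
    proof -
      have fg: "Comp C f g \<in> R" "Dom C (Comp C f g) = Dom C g"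
        using covering_comp[OF c R f g] Ra[OF f] g by auto
      have "j (Dom C g) (x' (Comp C f g)) = j (Dom C g) (Res F g (x' f))"
        using compat f g xx[OF f] xx[OF fg(1)] fg x'[OF f] res by simp
      then show ?thesis
        using inj_onD[OF inj[of "Dom C g"]] x'[OF fg(1)] fg(2) res_val[OF P g(1)] x'[OF f] g by simp
    qed
    obtain y where y: "y \<in> Val F c" "\<forall>f\<in>R. Res F f y = x' f"
      and uniq: "\<And>z. z \<in> Val F c \<Longrightarrow> \<forall>f\<in>R. Res F f z = x' f \<Longrightarrow> z = y"
      using sheaf_glue[OF F c R, of x'] x' eq by blast
    show ?thesis
    proof (rule ex1I[of _ "j c y"])
      show "j c y \<in> Val (relabel j F) c \<and> (\<forall>f\<in>R. Res (relabel j F) f (j c y) = x f)"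
        using y res Ra xx by auto
      fix w assume w: "w \<in> Val (relabel j F) c \<and> (\<forall>f\<in>R. Res (relabel j F) f w = x f)"
      then obtain z where z: "z \<in> Val F c" "w = j c z" by auto
      have "Res F f z = x' f" if f: "f \<in> R" for f
      proof -
        have "j (Dom C f) (Res F f z) = j (Dom C f) (x' f)"
          using w z res[of f c z] Ra[OF f] xx[OF f] f by auto
        then show ?thesis using inj_onD[OF inj[of "Dom C f"]] res_val[OF P, of f z] z Ra[OF f] x'[OF f] by simp
      qed
      then show "w = j c y" using uniq z by blast
    qed
  qed
  ultimately show ?thesis unfolding sheaf_def by blast
qed

lemma relabel_local_iso:
  assumes P: "presheaf C P" and inj: "\<And>c. c \<in> Obj C \<Longrightarrow> inj_on (j c) (Val P c)"
  shows "local_iso P (relabel j P) (mk_nat C P j)"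
proof -
  have res: "Res (relabel j P) g (j c x) = j (Dom C g) (Res P g x)"
    if "g \<in> Arr C" "Cod C g = c" "x \<in> Val P c" for g c x
    using Res_relabel[of j g P x] inj that by auto
  have "nat_trans C P (relabel j P) (mk_nat C P j)"
    by (rule nat_trans_mk_nat[OF P]) (auto simp: res)
  moreover have "locally c (\<lambda>g. \<exists>x\<in>Val P (Dom C g). mk_nat C P j (Dom C g) x = Res (relabel j P) g y)"
    if c: "c \<in> Obj C" and y: "y \<in> Val (relabel j P) c" for c y
  proof (rule locally_always[OF c])
    fix g assume g: "g \<in> Arr C" "Cod C g = c"
    obtain x where "x \<in> Val P c" "y = j c x" using y by auto
    then show "\<exists>x\<in>Val P (Dom C g). mk_nat C P j (Dom C g) x = Res (relabel j P) g y"
      using g res[of g c x] res_val[OF P, of g x] by (intro bexI[of _ "Res P g x"]) auto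
  qed
  moreover have "locally c (\<lambda>g. Res P g x = Res P g y)"
    if "c \<in> Obj C" "x \<in> Val P c" "y \<in> Val P c" "mk_nat C P j c x = mk_nat C P j c y" for c x y
  proof -
    have "x = y" using that inj_onD[OF inj[OF that(1)]] by simp
    then show ?thesis using locally_always[OF that(1)] by simp
  qed
  ultimately show ?thesis unfolding local_iso_def by blast
qed

end

context universe_site
begin

lemma ex_local_iso_to_sheaf:
  assumes P: "presheaf C P" and fits: "fits_universe P"
  shows "\<exists>(F :: ('o, 'a, 'u) psh) \<iota>. sheaf C J F \<and> local_iso P F \<iota>"
proof -
  have "\<forall>c\<in>Obj C. \<exists>j :: ('a \<Rightarrow> 'b set) \<Rightarrow> 'u. inj_on j (Val (assoc_sheaf P) c)"
    using fits_universe_assoc_sheaf[OF P fits] unfolding fits_universe_def .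
  then obtain j :: "'o \<Rightarrow> ('a \<Rightarrow> 'b set) \<Rightarrow> 'u"
    where j: "\<And>c. c \<in> Obj C \<Longrightarrow> inj_on (j c) (Val (assoc_sheaf P) c)" by metis
  note S = sheaf_assoc_sheaf[OF P]
  note R = relabel_sheaf[OF S j]
  show ?thesis
    using R local_iso_comp[OF P presheaf_assoc_sheaf sheaf_presheaf[OF R] local_iso_assoc_unit[OF P]
        relabel_local_iso[OF presheaf_assoc_sheaf j]] by blast
qed

text \<open>Sheafifications are unique up to isomorphism, so the unit of any of them is a local
  isomorphism because that of the constructed one is.\<close>

lemma is_sheafification_local_iso:
  fixes F :: "('o, 'a, 'u) psh"
  assumes P: "presheaf C P" and fits: "fits_universe P" and F: "is_sheafification C J P F \<iota>"
  shows "local_iso P F \<iota>"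
proof -
  obtain F' :: "('o, 'a, 'u) psh" and \<iota>' where F': "sheaf C J F'" and iso: "local_iso P F' \<iota>'"
    using ex_local_iso_to_sheaf[OF P fits] by blast
  note nt' = local_iso_nat_trans[OF iso]
  have sF: "sheaf C J F" and nt: "nat_trans C P F \<iota>"
    and univ: "\<And>(G :: ('o, 'a, 'u) psh) \<beta>. sheaf C J G \<Longrightarrow> nat_trans C P G \<beta> \<Longrightarrow>
        \<exists>!\<gamma>. nat_trans C F G \<gamma> \<and> nat_comp C P \<gamma> \<iota> = \<beta>"
    using F unfolding is_sheafification_def by auto
  note pF = sheaf_presheaf[OF sF] and pF' = sheaf_presheaf[OF F']
  obtain \<gamma> where \<gamma>: "nat_trans C F F' \<gamma>" "nat_comp C P \<gamma> \<iota> = \<iota>'" using univ[OF F' nt'] by blast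
  obtain \<delta> where \<delta>: "nat_trans C F' F \<delta>" and "\<forall>c\<in>Obj C. \<forall>x\<in>Val P c. \<delta> c (\<iota>' c x) = \<iota> c x"
    using local_iso_extend[OF P pF' iso sF nt] by blast
  then have \<delta>\<iota>: "\<delta> c (\<iota>' c x) = \<iota> c x" if "c \<in> Obj C" "x \<in> Val P c" for c x using that by blast
  have \<gamma>\<iota>: "\<gamma> c (\<iota> c x) = \<iota>' c x" if "c \<in> Obj C" "x \<in> Val P c" for c x
    using \<gamma>(2) that nat_comp_apply by metis
  let ?id = "mk_nat C F (\<lambda>_ x. x)"
  have "nat_comp C F \<delta> \<gamma> = ?id"
  proof -
    have "nat_comp C P (nat_comp C F \<delta> \<gamma>) \<iota> = \<iota>"
      using nat_trans_comp[OF P nt nat_trans_comp[OF pF \<gamma>(1) \<delta>]]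
      by (rule nat_trans_eqI[OF _ nt]) (simp add: \<gamma>\<iota> \<delta>\<iota> nat_trans_val[OF nt])
    moreover have "nat_comp C P ?id \<iota> = \<iota>"
      using nat_trans_comp[OF P nt nat_trans_id[OF pF]]
      by (rule nat_trans_eqI[OF _ nt]) (simp add: nat_trans_val[OF nt])
    ultimately show ?thesis
      using univ[OF sF nt] nat_trans_comp[OF pF \<gamma>(1) \<delta>] nat_trans_id[OF pF] by blast
  qed
  then have inv: "\<delta> c (\<gamma> c z) = z" if "c \<in> Obj C" "z \<in> Val F c" for c z
    using that nat_comp_apply[of c C z F \<delta> \<gamma>] mk_nat_apply[of c C z F "\<lambda>_ x. x"] by simp
  have "locally c (\<lambda>g. Res P g x = Res P g y)"
    if "c \<in> Obj C" "x \<in> Val P c" "y \<in> Val P c" "\<iota> c x = \<iota> c y" for c x y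
    using local_iso_inj[OF iso that(1,2,3)] \<gamma>\<iota> that by metis
  moreover have "locally c (\<lambda>g. \<exists>x\<in>Val P (Dom C g). \<iota> (Dom C g) x = Res F g z)"
    if c: "c \<in> Obj C" and z: "z \<in> Val F c" for c z
  proof (rule locally_mono[OF local_iso_surj[OF iso c nat_trans_val[OF \<gamma>(1) c z]] c])
    fix g assume g: "g \<in> Arr C" "Cod C g = c"
      and "\<exists>x\<in>Val P (Dom C g). \<iota>' (Dom C g) x = Res F' g (\<gamma> c z)"
    then obtain x where x: "x \<in> Val P (Dom C g)" "\<iota>' (Dom C g) x = Res F' g (\<gamma> c z)" by blast
    have "\<iota> (Dom C g) x = \<delta> (Dom C g) (Res F' g (\<gamma> c z))" using \<delta>\<iota> x g by (metis dom_obj)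
    also have "\<dots> = Res F g z"
      using nat_trans_res[OF \<delta> g(1)] nat_trans_val[OF \<gamma>(1) c z] inv[OF c z] g by simp
    finally show "\<exists>x\<in>Val P (Dom C g). \<iota> (Dom C g) x = Res F g z" using x by blast
  qed
  ultimately show ?thesis using nt unfolding local_iso_def by blast
qed

lemma sheafification_spec:
  assumes P: "presheaf C P" and fits: "fits_universe P"
  shows sheaf_sh_ob: "sheaf C J (sh_ob C J P :: ('o, 'a, 'u) psh)"
    and local_iso_sh_unit: "local_iso P (sh_ob C J P) (sh_unit C J P :: 'o \<Rightarrow> 'b \<Rightarrow> 'u)"
proof -
  let ?S = "sheafification C J P :: ('o, 'a, 'u) psh \<times> ('o \<Rightarrow> 'b \<Rightarrow> 'u)"
  have "\<exists>S :: ('o, 'a, 'u) psh \<times> ('o \<Rightarrow> 'b \<Rightarrow> 'u). case S of (F, \<iota>) \<Rightarrow> is_sheafification C J P F \<iota>"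
    using ex_local_iso_to_sheaf[OF P fits] local_iso_is_sheafification[OF P] by auto
  then have "case ?S of (F, \<iota>) \<Rightarrow> is_sheafification C J P F \<iota>"
    unfolding sheafification_def by (rule someI_ex)
  then have "is_sheafification C J P (sh_ob C J P :: ('o, 'a, 'u) psh) (sh_unit C J P)"
    unfolding sh_ob_def sh_unit_def by (simp add: case_prod_beta)
  then show "sheaf C J (sh_ob C J P :: ('o, 'a, 'u) psh)"
    "local_iso P (sh_ob C J P) (sh_unit C J P :: 'o \<Rightarrow> 'b \<Rightarrow> 'u)"
    using is_sheafification_local_iso[OF P fits] unfolding is_sheafification_def by auto
qed

end

section \<open>Arrows between sheaves\<close>

abbreviation trafo :: "'p \<times> 't \<times> 'p \<Rightarrow> 't" where
  "trafo a \<equiv> fst (snd a)"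

lemma hom_Sh:
  "a \<in> hom (Sh C J) F G \<longleftrightarrow>
     sheaf C J F \<and> sheaf C J G \<and> nat_trans C F G (trafo a) \<and> fst a = F \<and> snd (snd a) = G"
  by (cases a) (auto simp: hom_def Sh_def)

lemma Comp_Sh:
  "Comp (Sh C J) b a = (fst a, nat_comp C (fst a) (trafo b) (trafo a), snd (snd b))"
  by (cases a; cases b) (simp add: Sh_def)

lemma Sh_arrow_eqI:
  assumes "a \<in> hom (Sh C J) F G" "b \<in> hom (Sh C J) F G"
    and "\<And>c x. c \<in> Obj C \<Longrightarrow> x \<in> Val F c \<Longrightarrow> trafo a c x = trafo b c x"
  shows "a = b"
  using assms nat_trans_eqI[of C F G "trafo a" G "trafo b"] unfolding hom_Sh by (auto simp: prod_eq_iff)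

lemma trafo_Comp_Sh:
  "a \<in> hom (Sh C J) F G \<Longrightarrow> c \<in> Obj C \<Longrightarrow> x \<in> Val F c \<Longrightarrow>
     trafo (Comp (Sh C J) b a) c x = trafo b c (trafo a c x)"
  by (simp add: Comp_Sh hom_Sh)

lemma trafo_Id_Sh:
  "c \<in> Obj C \<Longrightarrow> x \<in> Val F c \<Longrightarrow> trafo (Id (Sh C J) F) c x = x"
  by (simp add: Sh_def)

context topologised_category
begin

lemma Comp_Sh_hom:
  "a \<in> hom (Sh C J) F G \<Longrightarrow> b \<in> hom (Sh C J) G H \<Longrightarrow> Comp (Sh C J) b a \<in> hom (Sh C J) F H"
  using nat_trans_comp sheaf_presheaf unfolding hom_Sh Comp_Sh by fastforce

lemma Id_Sh_hom:
  "sheaf C J F \<Longrightarrow> Id (Sh C J) F \<in> hom (Sh C J) F F"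
  using nat_trans_id sheaf_presheaf unfolding hom_Sh by (auto simp: Sh_def)

lemma Comp_Sh_assoc:
  assumes "a \<in> hom (Sh C J) F G" "b \<in> hom (Sh C J) G H" "c \<in> hom (Sh C J) H I"
  shows "Comp (Sh C J) (Comp (Sh C J) c b) a = Comp (Sh C J) c (Comp (Sh C J) b a)"
proof (rule Sh_arrow_eqI)
  have "trafo a x y \<in> Val G x" if "x \<in> Obj C" "y \<in> Val F x" for x y
    using assms(1) that nat_trans_val[of C F G "trafo a"] unfolding hom_Sh by blast
  then show "trafo (Comp (Sh C J) (Comp (Sh C J) c b) a) x y = trafo (Comp (Sh C J) c (Comp (Sh C J) b a)) x y"
    if "x \<in> Obj C" "y \<in> Val F x" for x y
    using that assms trafo_Comp_Sh[OF Comp_Sh_hom[OF assms(1,2)]] by (simp add: trafo_Comp_Sh)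
qed (use assms in \<open>blast intro: Comp_Sh_hom\<close>)+

lemma Comp_Sh_Id_right:
  assumes a: "a \<in> hom (Sh C J) F G" shows "Comp (Sh C J) a (Id (Sh C J) F) = a"
proof (rule Sh_arrow_eqI[OF _ a])
  have id: "Id (Sh C J) F \<in> hom (Sh C J) F F" using a Id_Sh_hom unfolding hom_Sh by blast
  show "Comp (Sh C J) a (Id (Sh C J) F) \<in> hom (Sh C J) F G" using Comp_Sh_hom[OF id a] .
  show "trafo (Comp (Sh C J) a (Id (Sh C J) F)) x y = trafo a x y" if "x \<in> Obj C" "y \<in> Val F x" for x y
    using trafo_Comp_Sh[OF id that] that by (simp add: trafo_Id_Sh)
qed

lemma Comp_Sh_Id_left:
  assumes a: "a \<in> hom (Sh C J) F G" shows "Comp (Sh C J) (Id (Sh C J) G) a = a"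
proof (rule Sh_arrow_eqI[OF _ a])
  have id: "Id (Sh C J) G \<in> hom (Sh C J) G G" using a Id_Sh_hom unfolding hom_Sh by blast
  show "Comp (Sh C J) (Id (Sh C J) G) a \<in> hom (Sh C J) F G" using Comp_Sh_hom[OF a id] .
  have "trafo a x y \<in> Val G x" if "x \<in> Obj C" "y \<in> Val F x" for x y
    using a that nat_trans_val[of C F G "trafo a"] unfolding hom_Sh by blast
  then show "trafo (Comp (Sh C J) (Id (Sh C J) G) a) x y = trafo a x y" if "x \<in> Obj C" "y \<in> Val F x" for x y
    using trafo_Comp_Sh[OF a that] that by (simp add: trafo_Id_Sh)
qed

lemma presheaf_yoneda: "c \<in> Obj C \<Longrightarrow> presheaf C (yoneda C c)"
  unfolding presheaf_def yoneda_def by (auto simp: hom_def comp_assoc)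

lemma nat_trans_yoneda_map:
  "h \<in> Arr C \<Longrightarrow> nat_trans C (yoneda C (Dom C h)) (yoneda C (Cod C h)) (yoneda_map C h)"
  unfolding yoneda_map_def
  by (rule nat_trans_mk_nat[OF presheaf_yoneda]) (auto simp: yoneda_def hom_def comp_assoc)

end

lemma Val_yoneda [simp]: "Val (yoneda C c) b = hom C b c"
  by (simp add: yoneda_def)

lemma Res_yoneda [simp]: "Res (yoneda C c) g f = Comp C f g"
  by (simp add: yoneda_def)

lemma Val_pull [simp]: "Val (pull p E) d = Val E (ObM p d)"
  by (simp add: pull_def)

lemma Res_pull [simp]: "Res (pull p E) g = Res E (ArM p g)"
  by (simp add: pull_def)

context universe_site
begin

lemma fits_universe_self: "fits_universe (P :: ('o, 'a, 'u) psh)"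
  unfolding fits_universe_def by (auto intro: exI[of _ id])

lemma fits_universe_yoneda: "c \<in> Obj C \<Longrightarrow> fits_universe (yoneda C c)"
  unfolding fits_universe_def by (auto intro: hom_embeds)

lemma
  assumes P: "presheaf C P" "fits_universe P" and Q: "presheaf C Q" "fits_universe Q"
    and \<alpha>: "nat_trans C P Q \<alpha>"
  defines "s \<equiv> sh_map C J P Q \<alpha> :: ('o, 'a, 'u) psh \<times> ('o \<Rightarrow> 'u \<Rightarrow> 'u) \<times> ('o, 'a, 'u) psh"
  shows sh_map_hom: "s \<in> hom (Sh C J) (sh_ob C J P) (sh_ob C J Q)"
    and sh_map_unit: "c \<in> Obj C \<Longrightarrow> x \<in> Val P c \<Longrightarrow>
          trafo s c (sh_unit C J P c x) = sh_unit C J Q c (\<alpha> c x)"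
proof -
  let ?F = "sh_ob C J P :: ('o, 'a, 'u) psh" and ?G = "sh_ob C J Q :: ('o, 'a, 'u) psh"
  let ?i = "sh_unit C J P :: 'o \<Rightarrow> 'b \<Rightarrow> 'u" and ?j = "sh_unit C J Q :: 'o \<Rightarrow> 'c \<Rightarrow> 'u"
  note iP = local_iso_sh_unit[OF P] and iQ = local_iso_sh_unit[OF Q]
  note sF = sheaf_sh_ob[OF P] and sG = sheaf_sh_ob[OF Q]
  have "\<exists>!\<gamma>. nat_trans C ?F ?G \<gamma> \<and> nat_comp C P \<gamma> ?i = nat_comp C P ?j \<alpha>"
    using local_iso_is_sheafification[OF P(1) sF iP] sG nat_trans_comp[OF P(1) \<alpha> local_iso_nat_trans[OF iQ]]
    unfolding is_sheafification_def by blast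
  from theI'[OF this] have t: "nat_trans C ?F ?G (trafo s)" "nat_comp C P (trafo s) ?i = nat_comp C P ?j \<alpha>"
    unfolding s_def sh_map_def by simp_all
  then show "s \<in> hom (Sh C J) ?F ?G"
    using sF sG unfolding hom_Sh by (simp add: s_def sh_map_def)
  show "trafo s c (?i c x) = ?j c (\<alpha> c x)" if "c \<in> Obj C" "x \<in> Val P c"
    using fun_cong[OF fun_cong[OF t(2)], of c x] that by simp
qed

lemma Sh_arrow_eqI_unit:
  fixes G :: "('o, 'a, 'u) psh"
  assumes P: "presheaf C P" and iso: "local_iso P F \<iota>"
    and a: "a \<in> hom (Sh C J) F G" and b: "b \<in> hom (Sh C J) F G"
    and "\<And>c x. c \<in> Obj C \<Longrightarrow> x \<in> Val P c \<Longrightarrow> trafo a c (\<iota> c x) = trafo b c (\<iota> c x)"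
  shows "a = b"
proof -
  have "trafo a = trafo b"
    using assms local_iso_epi[OF iso, of G "trafo a" "trafo b"] unfolding hom_Sh by blast
  then show ?thesis using a b unfolding hom_Sh by (auto simp: prod_eq_iff)
qed

end

section \<open>The inverse image functor of a comorphism of sites\<close>

locale functor_between =
  D: fixed_category D + C: fixed_category C
  for D :: "('od, 'ad) category" and C :: "('oc, 'ac) category" +
  fixes p :: "('od, 'ad, 'oc, 'ac) func"
  assumes is_functor_p: "is_functor D C p"
begin

lemma ob_p [simp, intro]: "d \<in> Obj D \<Longrightarrow> ObM p d \<in> Obj C"
  and ar_p [simp, intro]: "g \<in> Arr D \<Longrightarrow> ArM p g \<in> Arr C"
  and dom_p [simp]: "g \<in> Arr D \<Longrightarrow> Dom C (ArM p g) = ObM p (Dom D g)"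
  and cod_p [simp]: "g \<in> Arr D \<Longrightarrow> Cod C (ArM p g) = ObM p (Cod D g)"
  and id_p [simp]: "d \<in> Obj D \<Longrightarrow> ArM p (Id D d) = Id C (ObM p d)"
  and comp_p [simp]: "f \<in> Arr D \<Longrightarrow> g \<in> Arr D \<Longrightarrow> Cod D f = Dom D g \<Longrightarrow>
      ArM p (Comp D g f) = Comp C (ArM p g) (ArM p f)"
  using is_functor_p unfolding is_functor_def hom_def by auto

end

locale universe_comorphism =
  D: universe_site D K U + C: universe_site C J U + functor_between D C p
  for D :: "('od, 'ad) category" and K :: "'od \<Rightarrow> 'ad set set"
    and C :: "('oc, 'ac) category" and J :: "'oc \<Rightarrow> 'ac set set" and U :: "'u itself"
    and p :: "('od, 'ad, 'oc, 'ac) func" +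
  assumes cover_lifting: "d \<in> Obj D \<Longrightarrow> S \<in> J (ObM p d) \<Longrightarrow> \<exists>R\<in>K d. ArM p ` R \<subseteq> S"
begin

text \<open>The comorphism condition: local truth in \<open>C\<close> over \<open>p d\<close> gives local truth in \<open>D\<close> over \<open>d\<close>.\<close>

lemma locally_p:
  assumes "C.locally (ObM p d) \<Phi>" "d \<in> Obj D"
  shows "D.locally d (\<lambda>g. \<Phi> (ArM p g))"
proof -
  obtain S where S: "S \<in> J (ObM p d)" "\<forall>g\<in>S. \<Phi> g" using assms(1) unfolding C.locally_def by blast
  obtain R where "R \<in> K d" "ArM p ` R \<subseteq> S" using cover_lifting[OF assms(2) S(1)] by blast
  then show ?thesis using S(2) unfolding D.locally_def by blast
qed

lemma presheaf_pull:
  assumes "presheaf C E" shows "presheaf D (pull p E)"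
  unfolding presheaf_def
proof (intro conjI ballI impI)
  show "Res (pull p E) f x \<in> Val (pull p E) (Dom D f)"
    if "f \<in> Arr D" "x \<in> Val (pull p E) (Cod D f)" for f x
    using that C.res_val[OF assms, of "ArM p f" x] by simp
  show "Res (pull p E) (Id D c) x = x" if "c \<in> Obj D" "x \<in> Val (pull p E) c" for c x
    using that C.res_id[OF assms] by simp
  show "Res (pull p E) (Comp D g f) x = Res (pull p E) f (Res (pull p E) g x)"
    if "f \<in> Arr D" "g \<in> Arr D" "x \<in> Val (pull p E) (Cod D g)" "Cod D f = Dom D g" for f g x
    using that C.res_comp[OF assms, of "ArM p f" "ArM p g" x] by simp
qed

lemma fits_universe_pull: "C.fits_universe E \<Longrightarrow> D.fits_universe (pull p E)"
  unfolding C.fits_universe_def D.fits_universe_def by auto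

lemma nat_trans_pull_map:
  assumes "presheaf C E" "nat_trans C E F \<alpha>"
  shows "nat_trans D (pull p E) (pull p F) (pull_map D p E \<alpha>)"
  unfolding pull_map_def
proof (rule D.nat_trans_mk_nat[OF presheaf_pull[OF assms(1)]])
  fix f x assume "f \<in> Arr D" "x \<in> Val (pull p E) (Cod D f)"
  then show "(\<alpha> \<circ> ObM p) (Dom D f) (Res (pull p E) f x) = Res (pull p F) f ((\<alpha> \<circ> ObM p) (Cod D f) x)"
    using nat_trans_res[OF assms(2), of "ArM p f" x] by simp
qed (use nat_trans_val[OF assms(2)] in auto)

lemma pull_map_apply [simp]:
  "d \<in> Obj D \<Longrightarrow> x \<in> Val E (ObM p d) \<Longrightarrow> pull_map D p E \<alpha> d x = \<alpha> (ObM p d) x"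
  by (simp add: pull_map_def)

text \<open>Restricting along \<open>p\<close> preserves local injectivity and local surjectivity because \<open>p\<close> lifts
  covers; this is why sheafification may be inserted before restricting.\<close>

lemma local_iso_pull_map:
  assumes E: "presheaf C E" and \<alpha>: "C.local_iso E F \<alpha>"
  shows "D.local_iso (pull p E) (pull p F) (pull_map D p E \<alpha>)"
  unfolding D.local_iso_def
proof (intro conjI ballI impI)
  show "nat_trans D (pull p E) (pull p F) (pull_map D p E \<alpha>)"
    using nat_trans_pull_map[OF E C.local_iso_nat_trans[OF \<alpha>]] .
  fix d assume d: "d \<in> Obj D"
  show "D.locally d (\<lambda>g. Res (pull p E) g x = Res (pull p E) g y)"
    if "x \<in> Val (pull p E) d" "y \<in> Val (pull p E) d" "pull_map D p E \<alpha> d x = pull_map D p E \<alpha> d y" for x y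
    using locally_p[OF C.local_iso_inj[OF \<alpha>, of "ObM p d" x y] d] that d by simp
  show "D.locally d (\<lambda>g. \<exists>x\<in>Val (pull p E) (Dom D g). pull_map D p E \<alpha> (Dom D g) x = Res (pull p F) g y)"
    if y: "y \<in> Val (pull p F) d" for y
    by (rule D.locally_mono[OF locally_p[OF C.local_iso_surj[OF \<alpha>, of "ObM p d" y] d] d])
       (use y d in auto)
qed

abbreviation LD :: "'od \<Rightarrow> ('od, 'ad, 'u) psh" where "LD \<equiv> l_ob D K"
abbreviation LC :: "'oc \<Rightarrow> ('oc, 'ac, 'u) psh" where "LC \<equiv> l_ob C J"

abbreviation ShD :: "(('od, 'ad, 'u) psh,
    ('od, 'ad, 'u) psh \<times> ('od \<Rightarrow> 'u \<Rightarrow> 'u) \<times> ('od, 'ad, 'u) psh) category" where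
  "ShD \<equiv> Sh D K"
abbreviation ShC :: "(('oc, 'ac, 'u) psh,
    ('oc, 'ac, 'u) psh \<times> ('oc \<Rightarrow> 'u \<Rightarrow> 'u) \<times> ('oc, 'ac, 'u) psh) category" where
  "ShC \<equiv> Sh C J"

abbreviation Cp ::
  "(('oc, 'ac, 'u) psh, ('oc, 'ac, 'u) psh \<times> ('oc \<Rightarrow> 'u \<Rightarrow> 'u) \<times> ('oc, 'ac, 'u) psh,
    ('od, 'ad, 'u) psh, ('od, 'ad, 'u) psh \<times> ('od \<Rightarrow> 'u \<Rightarrow> 'u) \<times> ('od, 'ad, 'u) psh) func" where
  "Cp \<equiv> inverse_image D K p"

lemma Cp_ob: "ObM Cp E = sh_ob D K (pull p E)"
  by (simp add: inverse_image_def)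

lemma
  fixes E :: "('oc, 'ac, 'u) psh"
  assumes "presheaf C E"
  shows Cp_sheaf: "sheaf D K (ObM Cp E)"
    and Cp_local_iso: "D.local_iso (pull p E) (ObM Cp E) (sh_unit D K (pull p E))"
  using D.sheafification_spec[OF presheaf_pull fits_universe_pull] assms C.fits_universe_self
  unfolding Cp_ob by blast+

lemma
  assumes a: "a \<in> hom ShC E F"
  shows Cp_hom: "ArM Cp a \<in> hom ShD (ObM Cp E) (ObM Cp F)"
    and Cp_unit: "x \<in> Obj D \<Longrightarrow> e \<in> Val E (ObM p x) \<Longrightarrow>
      trafo (ArM Cp a) x (sh_unit D K (pull p E) x e) = sh_unit D K (pull p F) x (trafo a (ObM p x) e)"
proof -
  have sh: "presheaf C E" "presheaf C F" "nat_trans C E F (trafo a)"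
    and ar: "ArM Cp a = sh_map D K (pull p E) (pull p F) (pull_map D p E (trafo a))"
    using a C.sheaf_presheaf unfolding hom_Sh by (auto simp: inverse_image_def case_prod_beta)
  note s = presheaf_pull[OF sh(1)] fits_universe_pull[OF C.fits_universe_self]
    presheaf_pull[OF sh(2)] fits_universe_pull[OF C.fits_universe_self] nat_trans_pull_map[OF sh(1,3)]
  show "ArM Cp a \<in> hom ShD (ObM Cp E) (ObM Cp F)"
    unfolding ar Cp_ob by (rule D.sh_map_hom[OF s])
  show "trafo (ArM Cp a) x (sh_unit D K (pull p E) x e) = sh_unit D K (pull p F) x (trafo a (ObM p x) e)"
    if "x \<in> Obj D" "e \<in> Val E (ObM p x)"
    unfolding ar using D.sh_map_unit[OF s, of x e] that by simp
qed

lemma Cp_comp: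
  assumes a: "a \<in> hom ShC E F" and b: "b \<in> hom ShC F G"
  shows "ArM Cp (Comp ShC b a) = Comp ShD (ArM Cp b) (ArM Cp a)"
proof -
  have ba: "Comp ShC b a \<in> hom ShC E G" using C.Comp_Sh_hom[OF a b] .
  have E: "presheaf C E" using a C.sheaf_presheaf unfolding hom_Sh by blast
  note iso = Cp_local_iso[OF E]
  show ?thesis
  proof (rule D.Sh_arrow_eqI_unit[OF presheaf_pull[OF E] iso Cp_hom[OF ba]])
    show "Comp ShD (ArM Cp b) (ArM Cp a) \<in> hom ShD (ObM Cp E) (ObM Cp G)"
      using D.Comp_Sh_hom[OF Cp_hom[OF a] Cp_hom[OF b]] .
    fix x e assume x: "x \<in> Obj D" and "e \<in> Val (pull p E) x"
    then have e: "e \<in> Val E (ObM p x)" by simp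
    have "trafo a (ObM p x) e \<in> Val F (ObM p x)"
      using a e x nat_trans_val[of C E F "trafo a" "ObM p x" e] unfolding hom_Sh by simp
    moreover have "sh_unit D K (pull p E) x e \<in> Val (ObM Cp E) x"
      using nat_trans_val[OF D.local_iso_nat_trans[OF iso] x] e by simp
    ultimately show "trafo (ArM Cp (Comp ShC b a)) x (sh_unit D K (pull p E) x e) =
        trafo (Comp ShD (ArM Cp b) (ArM Cp a)) x (sh_unit D K (pull p E) x e)"
      using x e Cp_unit[OF a x e] Cp_unit[OF b x] Cp_unit[OF ba x e] trafo_Comp_Sh[OF a, of "ObM p x" e]
      by (simp add: trafo_Comp_Sh[OF Cp_hom[OF a] x])
  qed
qed

lemma Cp_Id:
  assumes E: "sheaf C J E" shows "ArM Cp (Id ShC E) = Id ShD (ObM Cp E)"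
proof -
  note P = C.sheaf_presheaf[OF E]
  note iso = Cp_local_iso[OF P] and id = C.Id_Sh_hom[OF E]
  show ?thesis
  proof (rule D.Sh_arrow_eqI_unit[OF presheaf_pull[OF P] iso Cp_hom[OF id] D.Id_Sh_hom[OF Cp_sheaf[OF P]]])
    fix x e assume x: "x \<in> Obj D" and e: "e \<in> Val (pull p E) x"
    then show "trafo (ArM Cp (Id ShC E)) x (sh_unit D K (pull p E) x e) =
        trafo (Id ShD (ObM Cp E)) x (sh_unit D K (pull p E) x e)"
      using Cp_unit[OF id x, of e] nat_trans_val[OF D.local_iso_nat_trans[OF iso] x e]
      by (simp add: trafo_Id_Sh)
  qed
qed

text \<open>Sections of \<open>l_K(d)\<close> and of \<open>C_p\<^sup>* l_J(c)\<close> are locally given by arrows of \<open>D\<close> and \<open>C\<close>: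
  \<open>\<iota>\<close> and \<open>\<kappa>\<close> send an arrow \<open>x \<rightarrow> d\<close>, respectively \<open>p x \<rightarrow> c\<close>, to the section over \<open>x\<close> that
  it represents. All computations with sheaves are carried out on such representatives.\<close>

definition \<iota> :: "'od \<Rightarrow> 'od \<Rightarrow> 'ad \<Rightarrow> 'u" where
  "\<iota> d = sh_unit D K (yoneda D d)"

definition \<kappa> :: "'oc \<Rightarrow> 'od \<Rightarrow> 'ac \<Rightarrow> 'u" where
  "\<kappa> c = nat_comp D (pull p (yoneda C c)) (sh_unit D K (pull p (LC c)))
     (pull_map D p (yoneda C c) (sh_unit C J (yoneda C c)))"

lemma sheaf_LD: "d \<in> Obj D \<Longrightarrow> sheaf D K (LD d)"
  unfolding l_ob_def by (intro D.sheaf_sh_ob D.presheaf_yoneda D.fits_universe_yoneda)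

lemma sheaf_LC: "c \<in> Obj C \<Longrightarrow> sheaf C J (LC c)"
  unfolding l_ob_def by (intro C.sheaf_sh_ob C.presheaf_yoneda C.fits_universe_yoneda)

lemma sheaf_Cp_LC: "c \<in> Obj C \<Longrightarrow> sheaf D K (ObM Cp (LC c))"
  by (intro Cp_sheaf C.sheaf_presheaf[OF sheaf_LC])

lemma local_iso_\<iota>: "d \<in> Obj D \<Longrightarrow> D.local_iso (yoneda D d) (LD d) (\<iota> d)"
  unfolding \<iota>_def l_ob_def
  by (intro D.local_iso_sh_unit D.presheaf_yoneda D.fits_universe_yoneda)

lemma local_iso_unit_LC:
  "c \<in> Obj C \<Longrightarrow> C.local_iso (yoneda C c) (LC c) (sh_unit C J (yoneda C c))"
  unfolding l_ob_def by (intro C.local_iso_sh_unit C.presheaf_yoneda C.fits_universe_yoneda)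

lemma local_iso_\<kappa>:
  assumes c: "c \<in> Obj C"
  shows "D.local_iso (pull p (yoneda C c)) (ObM Cp (LC c)) (\<kappa> c)"
proof -
  have P: "presheaf C (LC c)" using C.sheaf_presheaf[OF sheaf_LC[OF c]] .
  show ?thesis
    unfolding \<kappa>_def
    using presheaf_pull[OF C.presheaf_yoneda[OF c]] presheaf_pull[OF P]
      D.sheaf_presheaf[OF sheaf_Cp_LC[OF c]]
      local_iso_pull_map[OF C.presheaf_yoneda[OF c] local_iso_unit_LC[OF c]] Cp_local_iso[OF P]
    by (rule D.local_iso_comp)
qed

lemma \<kappa>_eq:
  "x \<in> Obj D \<Longrightarrow> k \<in> hom C (ObM p x) c \<Longrightarrow>
     \<kappa> c x k = sh_unit D K (pull p (LC c)) x (sh_unit C J (yoneda C c) (ObM p x) k)"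
  by (simp add: \<kappa>_def)

lemma
  assumes "d \<in> Obj D" "x \<in> Obj D" "g \<in> hom D x d"
  shows \<iota>_val: "\<iota> d x g \<in> Val (LD d) x"
    and \<iota>_res: "w \<in> Arr D \<Longrightarrow> Cod D w = x \<Longrightarrow> Res (LD d) w (\<iota> d x g) = \<iota> d (Dom D w) (Comp D g w)"
    and \<iota>_inj: "g' \<in> hom D x d \<Longrightarrow> \<iota> d x g = \<iota> d x g' \<Longrightarrow>
      D.locally x (\<lambda>w. Comp D g w = Comp D g' w)"
  using nat_trans_val[OF D.local_iso_nat_trans[OF local_iso_\<iota>[OF assms(1)]], of x g]
    nat_trans_res[OF D.local_iso_nat_trans[OF local_iso_\<iota>[OF assms(1)]], of w g]
    D.local_iso_inj[OF local_iso_\<iota>[OF assms(1)], of x g g'] assms by auto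

lemma \<iota>_surj:
  "d \<in> Obj D \<Longrightarrow> x \<in> Obj D \<Longrightarrow> z \<in> Val (LD d) x \<Longrightarrow>
     D.locally x (\<lambda>w. \<exists>g\<in>hom D (Dom D w) d. \<iota> d (Dom D w) g = Res (LD d) w z)"
  using D.local_iso_surj[OF local_iso_\<iota>, of d x z] by simp

lemma
  assumes "c \<in> Obj C" "x \<in> Obj D" "k \<in> hom C (ObM p x) c"
  shows \<kappa>_res: "w \<in> Arr D \<Longrightarrow> Cod D w = x \<Longrightarrow>
      Res (ObM Cp (LC c)) w (\<kappa> c x k) = \<kappa> c (Dom D w) (Comp C k (ArM p w))"
    and \<kappa>_inj: "k' \<in> hom C (ObM p x) c \<Longrightarrow> \<kappa> c x k = \<kappa> c x k' \<Longrightarrow>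
      D.locally x (\<lambda>w. Comp C k (ArM p w) = Comp C k' (ArM p w))"
  using nat_trans_res[OF D.local_iso_nat_trans[OF local_iso_\<kappa>[OF assms(1)]], of w k]
    D.local_iso_inj[OF local_iso_\<kappa>[OF assms(1)], of x k k'] assms by auto

lemma \<kappa>_surj:
  "c \<in> Obj C \<Longrightarrow> x \<in> Obj D \<Longrightarrow> z \<in> Val (ObM Cp (LC c)) x \<Longrightarrow>
     D.locally x (\<lambda>w. \<exists>k\<in>hom C (ObM p (Dom D w)) c. \<kappa> c (Dom D w) k = Res (ObM Cp (LC c)) w z)"
  using D.local_iso_surj[OF local_iso_\<kappa>, of c x z] by simp

lemma
  assumes g: "g \<in> Arr D"
  shows l_map_D_hom: "l_map D K g \<in> hom ShD (LD (Dom D g)) (LD (Cod D g))"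
    and l_map_\<iota>: "x \<in> Obj D \<Longrightarrow> m \<in> hom D x (Dom D g) \<Longrightarrow>
      trafo (l_map D K g) x (\<iota> (Dom D g) x m) = \<iota> (Cod D g) x (Comp D g m)"
proof -
  note s = D.presheaf_yoneda[OF D.dom_obj[OF g]] D.fits_universe_yoneda[OF D.dom_obj[OF g]]
    D.presheaf_yoneda[OF D.cod_obj[OF g]] D.fits_universe_yoneda[OF D.cod_obj[OF g]]
    D.nat_trans_yoneda_map[OF g]
  show "l_map D K g \<in> hom ShD (LD (Dom D g)) (LD (Cod D g))"
    unfolding l_map_def l_ob_def by (rule D.sh_map_hom[OF s])
  show "trafo (l_map D K g) x (\<iota> (Dom D g) x m) = \<iota> (Cod D g) x (Comp D g m)"
    if "x \<in> Obj D" "m \<in> hom D x (Dom D g)"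
    using D.sh_map_unit[OF s, of x m] that unfolding l_map_def \<iota>_def by (simp add: yoneda_map_def)
qed

lemma
  assumes h: "h \<in> Arr C"
  shows l_map_C_hom: "l_map C J h \<in> hom ShC (LC (Dom C h)) (LC (Cod C h))"
    and Cp_l_map_\<kappa>: "x \<in> Obj D \<Longrightarrow> k \<in> hom C (ObM p x) (Dom C h) \<Longrightarrow>
      trafo (ArM Cp (l_map C J h)) x (\<kappa> (Dom C h) x k) = \<kappa> (Cod C h) x (Comp C h k)"
proof -
  note s = C.presheaf_yoneda[OF C.dom_obj[OF h]] C.fits_universe_yoneda[OF C.dom_obj[OF h]]
    C.presheaf_yoneda[OF C.cod_obj[OF h]] C.fits_universe_yoneda[OF C.cod_obj[OF h]]
    C.nat_trans_yoneda_map[OF h]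
  show hom: "l_map C J h \<in> hom ShC (LC (Dom C h)) (LC (Cod C h))"
    unfolding l_map_def l_ob_def by (rule C.sh_map_hom[OF s])
  show "trafo (ArM Cp (l_map C J h)) x (\<kappa> (Dom C h) x k) = \<kappa> (Cod C h) x (Comp C h k)"
    if x: "x \<in> Obj D" and k: "k \<in> hom C (ObM p x) (Dom C h)"
  proof -
    have "sh_unit C J (yoneda C (Dom C h)) (ObM p x) k \<in> Val (LC (Dom C h)) (ObM p x)"
      using nat_trans_val[OF C.local_iso_nat_trans[OF local_iso_unit_LC], of "Dom C h" "ObM p x" k] h x k by simp
    moreover have "Comp C h k \<in> hom C (ObM p x) (Cod C h)" using h k by (auto simp: hom_def)
    moreover have "trafo (l_map C J h) (ObM p x) (sh_unit C J (yoneda C (Dom C h)) (ObM p x) k) =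
        (sh_unit C J (yoneda C (Cod C h)) (ObM p x) (Comp C h k) :: 'u)"
      using C.sh_map_unit[OF s, of "ObM p x" k] x k unfolding l_map_def by (simp add: yoneda_map_def)
    ultimately show ?thesis using Cp_unit[OF hom x] x k by (simp add: \<kappa>_eq)
  qed
qed

lemma
  assumes d: "d \<in> Obj D"
  shows eta_hom: "eta D K C J p d \<in> hom ShD (LD d) (ObM Cp (LC (ObM p d)))"
    and eta_\<iota>: "x \<in> Obj D \<Longrightarrow> g \<in> hom D x d \<Longrightarrow>
      trafo (eta D K C J p d) x (\<iota> d x g) = \<kappa> (ObM p d) x (ArM p g)"
proof -
  let ?y = "yoneda C (ObM p d)" and ?pd = "ObM p d"
  let ?\<alpha> = "mk_nat D (yoneda D d) (\<lambda>_ g. ArM p g)"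
  let ?\<beta> = "pull_map D p ?y (sh_unit C J ?y :: 'oc \<Rightarrow> 'ac \<Rightarrow> 'u)"
  have pd: "?pd \<in> Obj C" using d by simp
  note Y = D.presheaf_yoneda[OF d] D.fits_universe_yoneda[OF d]
  note Q = presheaf_pull[OF C.presheaf_yoneda[OF pd]] fits_universe_pull[OF C.fits_universe_yoneda[OF pd]]
  note R = presheaf_pull[OF C.sheaf_presheaf[OF sheaf_LC[OF pd]]] fits_universe_pull[OF C.fits_universe_self]
  have \<alpha>: "nat_trans D (yoneda D d) (pull p ?y) ?\<alpha>"
    by (rule D.nat_trans_mk_nat[OF Y(1)]) (auto simp: hom_def)
  have \<beta>: "nat_trans D (pull p ?y) (pull p (LC ?pd)) ?\<beta>"
    using nat_trans_pull_map[OF C.presheaf_yoneda[OF pd] C.local_iso_nat_trans[OF local_iso_unit_LC[OF pd]]] .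
  note h\<alpha> = D.sh_map_hom[OF Y Q \<alpha>] and u\<alpha> = D.sh_map_unit[OF Y Q \<alpha>]
  note h\<beta> = D.sh_map_hom[OF Q R \<beta>] and u\<beta> = D.sh_map_unit[OF Q R \<beta>]
  have eta: "eta D K C J p d = Comp ShD (sh_map D K (pull p ?y) (pull p (LC ?pd)) ?\<beta>)
      (sh_map D K (yoneda D d) (pull p ?y) ?\<alpha>)"
    by (simp add: eta_def Let_def)
  show "eta D K C J p d \<in> hom ShD (LD d) (ObM Cp (LC ?pd))"
    unfolding eta l_ob_def[of D] Cp_ob by (rule D.Comp_Sh_hom[OF h\<alpha> h\<beta>])
  show "trafo (eta D K C J p d) x (\<iota> d x g) = \<kappa> ?pd x (ArM p g)"
    if x: "x \<in> Obj D" and g: "g \<in> hom D x d"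
  proof -
    have pg: "ArM p g \<in> hom C (ObM p x) ?pd" using g by (auto simp: hom_def)
    show ?thesis
      unfolding eta using x g pg trafo_Comp_Sh[OF h\<alpha> x] \<iota>_val[OF d x g] u\<alpha>[of x g] u\<beta>[of x "ArM p g"]
      by (simp add: \<kappa>_eq \<iota>_def l_ob_def[of D])
  qed
qed

end

lemma hom_Sh_Obj:
  "a \<in> hom (Sh C J) F G \<Longrightarrow> F \<in> Obj (Sh C J)" "a \<in> hom (Sh C J) F G \<Longrightarrow> G \<in> Obj (Sh C J)"
  unfolding hom_Sh by (simp_all add: Sh_def)

lemma is_pullback_hom:
  assumes "is_pullback C f u q r"
  shows "f \<in> hom C (Dom C f) (Cod C f)" "u \<in> hom C (Dom C u) (Cod C f)"
    "q \<in> hom C (Dom C q) (Dom C u)" "r \<in> hom C (Dom C q) (Dom C f)" "Comp C f r = Comp C u q"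
  using assms unfolding is_pullback_def by (auto simp: hom_def)

lemma is_pullback_lift:
  assumes pb: "is_pullback C f u q r"
    and A: "r' \<in> hom C x (Dom C f)" "q' \<in> hom C x (Dom C u)" "Comp C f r' = Comp C u q'"
  shows "\<exists>!m. m \<in> hom C x (Dom C q) \<and> Comp C q m = q' \<and> Comp C r m = r'"
proof -
  have univ: "\<And>q' r'. q' \<in> Arr C \<Longrightarrow> r' \<in> Arr C \<Longrightarrow> Dom C q' = Dom C r' \<Longrightarrow> Cod C q' = Dom C u \<Longrightarrow>
      Cod C r' = Dom C f \<Longrightarrow> Comp C f r' = Comp C u q' \<Longrightarrow>
      \<exists>!h. h \<in> hom C (Dom C q') (Dom C q) \<and> Comp C q h = q' \<and> Comp C r h = r'"
    using pb unfolding is_pullback_def by (elim conjE) simp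
  have "\<exists>!m. m \<in> hom C (Dom C q') (Dom C q) \<and> Comp C q m = q' \<and> Comp C r m = r'"
    by (rule univ) (use A in \<open>auto simp: hom_def\<close>)
  then show ?thesis using A(2) by (simp add: hom_def)
qed

lemma is_pullback_iff:
  assumes "f \<in> hom C a c" "u \<in> hom C b c" "q \<in> hom C e b" "r \<in> hom C e a" "Comp C f r = Comp C u q"
  shows "is_pullback C f u q r \<longleftrightarrow>
     (\<forall>x r' q'. r' \<in> hom C x a \<longrightarrow> q' \<in> hom C x b \<longrightarrow> Comp C f r' = Comp C u q' \<longrightarrow>
        (\<exists>!m. m \<in> hom C x e \<and> Comp C q m = q' \<and> Comp C r m = r'))"
    (is "_ \<longleftrightarrow> ?R")
proof
  have d: "Dom C f = a" "Dom C u = b" "Dom C q = e" using assms by (simp_all add: hom_def)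
  show ?R if pb: "is_pullback C f u q r"
    by (intro allI impI) (rule is_pullback_lift[OF pb, unfolded d])
  show "is_pullback C f u q r" if R: ?R
    unfolding is_pullback_def
  proof (intro conjI ballI impI)
    fix q' r'
    assume "q' \<in> Arr C" "r' \<in> Arr C" "Dom C q' = Dom C r'" "Cod C q' = Dom C u"
      "Cod C r' = Dom C f" "Comp C f r' = Comp C u q'"
    then show "\<exists>!h. h \<in> hom C (Dom C q') (Dom C q) \<and> Comp C q h = q' \<and> Comp C r h = r'"
      using R[rule_format, of r' "Dom C q'" q'] assms by (simp add: hom_def)
  qed (use assms in \<open>auto simp: hom_def\<close>)
qed

lemma cartesian_arrowD:
  "cartesian_arrow E B \<pi> f \<Longrightarrow> h \<in> Arr E \<Longrightarrow> k \<in> hom B (ObM \<pi> (Dom E h)) (ObM \<pi> (Dom E f)) \<Longrightarrow>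
     Cod E h = Cod E f \<Longrightarrow> Comp B (ArM \<pi> f) k = ArM \<pi> h \<Longrightarrow>
     \<exists>!m. m \<in> hom E (Dom E h) (Dom E f) \<and> ArM \<pi> m = k \<and> Comp E f m = h"
  unfolding cartesian_arrow_def by simp

lemma ex1_iff_of_injection:
  assumes "\<And>y. P y \<longleftrightarrow> (\<exists>x. y = f x \<and> Q x)" "inj f"
  shows "(\<exists>!y. P y) \<longleftrightarrow> (\<exists>!x. Q x)"
  using assms unfolding inj_def by metis

section \<open>Locally cartesian arrows as pullback squares of sheaves\<close>

context universe_comorphism
begin

abbreviation \<eta> :: "'od \<Rightarrow> ('od, 'ad, 'u) psh \<times> ('od \<Rightarrow> 'u \<Rightarrow> 'u) \<times> ('od, 'ad, 'u) psh" where
  "\<eta> \<equiv> eta D K C J p"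

abbreviation lD :: "'ad \<Rightarrow> ('od, 'ad, 'u) psh \<times> ('od \<Rightarrow> 'u \<Rightarrow> 'u) \<times> ('od, 'ad, 'u) psh" where
  "lD \<equiv> l_map D K"

abbreviation lC :: "'ac \<Rightarrow> ('oc, 'ac, 'u) psh \<times> ('oc \<Rightarrow> 'u \<Rightarrow> 'u) \<times> ('oc, 'ac, 'u) psh" where
  "lC \<equiv> l_map C J"

lemma Sh_arrow_eqI_\<iota>:
  assumes "d \<in> Obj D" "a \<in> hom ShD (LD d) G" "b \<in> hom ShD (LD d) G"
    and "\<And>x m. x \<in> Obj D \<Longrightarrow> m \<in> hom D x d \<Longrightarrow> trafo a x (\<iota> d x m) = trafo b x (\<iota> d x m)"
  shows "a = b"
  by (rule D.Sh_arrow_eqI_unit[OF D.presheaf_yoneda[OF assms(1)] local_iso_\<iota>[OF assms(1)] assms(2,3)])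
     (use assms(4) in simp)

lemma lC_p_hom:
  "g \<in> Arr D \<Longrightarrow> lC (ArM p g) \<in> hom ShC (LC (ObM p (Dom D g))) (LC (ObM p (Cod D g)))"
  using l_map_C_hom[of "ArM p g"] by simp

lemma eta_natural:
  assumes g: "g \<in> Arr D"
  shows "Comp ShD (\<eta> (Cod D g)) (lD g) = Comp ShD (ArM Cp (lC (ArM p g))) (\<eta> (Dom D g))"
proof -
  have d: "Dom D g \<in> Obj D" "Cod D g \<in> Obj D" using g by auto
  note h1 = l_map_D_hom[OF g] eta_hom[OF d(2)] and h2 = eta_hom[OF d(1)] Cp_hom[OF lC_p_hom[OF g]]
  show ?thesis
  proof (rule Sh_arrow_eqI_\<iota>[OF d(1) D.Comp_Sh_hom[OF h1] D.Comp_Sh_hom[OF h2]])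
    fix x m assume x: "x \<in> Obj D" and m: "m \<in> hom D x (Dom D g)"
    have gm: "Comp D g m \<in> hom D x (Cod D g)" and pm: "ArM p m \<in> hom C (ObM p x) (ObM p (Dom D g))"
      using m g by (auto simp: hom_def)
    show "trafo (Comp ShD (\<eta> (Cod D g)) (lD g)) x (\<iota> (Dom D g) x m) =
        trafo (Comp ShD (ArM Cp (lC (ArM p g))) (\<eta> (Dom D g))) x (\<iota> (Dom D g) x m)"
      using trafo_Comp_Sh[OF h1(1) x \<iota>_val[OF d(1) x m]] trafo_Comp_Sh[OF h2(1) x \<iota>_val[OF d(1) x m]]
        l_map_\<iota>[OF g x m] eta_\<iota>[OF d(2) x gm] eta_\<iota>[OF d(1) x m] Cp_l_map_\<kappa>[of "ArM p g" x "ArM p m"]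
        x pm m g by (simp add: hom_def)
  qed
qed

definition pullback_square :: "'ad \<Rightarrow> bool" where
  "pullback_square g \<longleftrightarrow>
     is_pullback ShD (\<eta> (Cod D g)) (ArM Cp (lC (ArM p g))) (\<eta> (Dom D g)) (lD g)"

lemma pullback_square_iff:
  assumes g: "g \<in> Arr D"
  shows "pullback_square g \<longleftrightarrow>
     (\<forall>E a \<beta>. a \<in> hom ShD E (LD (Cod D g)) \<longrightarrow> \<beta> \<in> hom ShD E (ObM Cp (LC (ObM p (Dom D g)))) \<longrightarrow>
        Comp ShD (\<eta> (Cod D g)) a = Comp ShD (ArM Cp (lC (ArM p g))) \<beta> \<longrightarrow>
        (\<exists>!m. m \<in> hom ShD E (LD (Dom D g)) \<and> Comp ShD (\<eta> (Dom D g)) m = \<beta> \<and> Comp ShD (lD g) m = a))"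
  unfolding pullback_square_def
  by (rule is_pullback_iff) (use g in \<open>auto intro: eta_hom l_map_D_hom Cp_hom lC_p_hom eta_natural\<close>)

lemmas pullback_squareD = pullback_square_iff[THEN iffD1, rule_format]
lemmas pullback_squareI = pullback_square_iff[THEN iffD2, rule_format]

text \<open>A test object over \<open>C_p\<^sup>* F\<close> for an arbitrary sheaf \<open>F\<close> reduces to one over
  \<open>C_p\<^sup>* l_J p(d')\<close> by composition with the image of the given arrow in the base; conversely the
  pullback property is the cartesian property for arrows over the identity.\<close>

lemma locally_cartesian_iff_pullback:
  assumes g: "g \<in> Arr D"
  shows "locally_cartesian TYPE('u) D K C J p g \<longleftrightarrow> pullback_square g"
proof -
  let ?d' = "Dom D g" and ?d = "Cod D g" and ?l = "lD g" and ?pl = "lC (ArM p g)"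
  let ?X' = "(LD ?d', \<eta> ?d', LC (ObM p ?d'))" and ?X = "(LD ?d, \<eta> ?d, LC (ObM p ?d))"
  let ?E = "comma ShD ShC Cp" and ?G = "(?X', (?l, ?pl), ?X)"
  let ?\<pi> = "comma_proj :: (('od, 'ad, 'u) psh \<times> (('od, 'ad, 'u) psh \<times> ('od \<Rightarrow> 'u \<Rightarrow> 'u) \<times> ('od, 'ad, 'u) psh) \<times> ('oc, 'ac, 'u) psh, _, _, _) func"
  have d: "?d' \<in> Obj D" "?d \<in> Obj D" using g by auto
  note hl = l_map_D_hom[OF g] and hpl = lC_p_hom[OF g] and h\<eta>' = eta_hom[OF d(1)] and h\<eta> = eta_hom[OF d(2)]
  note hCpl = Cp_hom[OF hpl]
  have comma_arr: "((E, h, F), (a, b), (E', h', F')) \<in> Arr ?E \<longleftrightarrow>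
      h \<in> hom ShD E (ObM Cp F) \<and> h' \<in> hom ShD E' (ObM Cp F') \<and> a \<in> hom ShD E E' \<and> b \<in> hom ShC F F' \<and>
      Comp ShD h' a = Comp ShD (ArM Cp b) h" for E h F a b E' h' F'
    by (auto simp: comma_def comma_obj_def intro: hom_Sh_Obj)
  have GE: "?G \<in> Arr ?E" using comma_arr hl hpl h\<eta>' h\<eta> eta_natural[OF g] by simp
  have lc: "locally_cartesian TYPE('u) D K C J p g \<longleftrightarrow> cartesian_arrow ?E ShC ?\<pi> ?G"
    using g by (simp add: locally_cartesian_def eta_ob_def Let_def)
  \<comment> \<open>The fillers in the comma category are the fillers of the square in the category of sheaves.\<close>
  have fillers: "(\<exists>!m. m \<in> hom ?E (E, h, F) ?X' \<and> ArM ?\<pi> m = k \<and> Comp ?E ?G m = ((E, h, F), (a, b), ?X)) \<longleftrightarrow>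
      (\<exists>!m. m \<in> hom ShD E (LD ?d') \<and> Comp ShD (\<eta> ?d') m = Comp ShD (ArM Cp k) h \<and> Comp ShD ?l m = a)"
    if h: "h \<in> hom ShD E (ObM Cp F)" and k: "k \<in> hom ShC F (LC (ObM p ?d'))" and b: "Comp ShC ?pl k = b"
    for E h F a b k
  proof -
    let ?i = "\<lambda>m. ((E, h, F), (m, k), ?X')"
    have "m \<in> hom ?E (E, h, F) ?X' \<and> ArM ?\<pi> m = k \<and> Comp ?E ?G m = ((E, h, F), (a, b), ?X) \<longleftrightarrow>
        (\<exists>m1. m = ?i m1 \<and> m1 \<in> hom ShD E (LD ?d') \<and>
          Comp ShD (\<eta> ?d') m1 = Comp ShD (ArM Cp k) h \<and> Comp ShD ?l m1 = a)" for m
    proof -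
      obtain s m1 m2 t where m: "m = (s, (m1, m2), t)" by (cases m) auto
      show ?thesis
      proof (cases "s = (E, h, F) \<and> t = ?X' \<and> m2 = k")
        case True
        then show ?thesis using h k b h\<eta>' comma_arr[of E h F m1 k "LD ?d'" "\<eta> ?d'" "LC (ObM p ?d')"]
          unfolding m hom_def[of ?E] by (auto simp: comma_def comma_proj_def)
      next
        case False
        then show ?thesis unfolding m hom_def[of ?E] by (auto simp: comma_def comma_proj_def)
      qed
    qed
    then show ?thesis by (rule ex1_iff_of_injection[where f = ?i]) (simp add: inj_def)
  qed
  have cart: "cartesian_arrow ?E ShC ?\<pi> ?G \<longleftrightarrow>
     (\<forall>E h F a b k. h \<in> hom ShD E (ObM Cp F) \<longrightarrow> a \<in> hom ShD E (LD ?d) \<longrightarrow> b \<in> hom ShC F (LC (ObM p ?d)) \<longrightarrow>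
        Comp ShD (\<eta> ?d) a = Comp ShD (ArM Cp b) h \<longrightarrow>
        k \<in> hom ShC F (LC (ObM p ?d')) \<longrightarrow> Comp ShC ?pl k = b \<longrightarrow>
        (\<exists>!m. m \<in> hom ShD E (LD ?d') \<and> Comp ShD (\<eta> ?d') m = Comp ShD (ArM Cp k) h \<and> Comp ShD ?l m = a))"
    (is "_ \<longleftrightarrow> ?R")
  proof
    assume c: "cartesian_arrow ?E ShC ?\<pi> ?G"
    show ?R
    proof (intro allI impI)
      fix E h F a b k
      assume A: "h \<in> hom ShD E (ObM Cp F)" "a \<in> hom ShD E (LD ?d)" "b \<in> hom ShC F (LC (ObM p ?d))"
        "Comp ShD (\<eta> ?d) a = Comp ShD (ArM Cp b) h" "k \<in> hom ShC F (LC (ObM p ?d'))" "Comp ShC ?pl k = b"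
      let ?H = "((E, h, F), (a, b), ?X)"
      have H: "?H \<in> Arr ?E" using A h\<eta> comma_arr by simp
      have "\<exists>!m. m \<in> hom ?E (Dom ?E ?H) (Dom ?E ?G) \<and> ArM ?\<pi> m = k \<and> Comp ?E ?G m = ?H"
        by (rule cartesian_arrowD[OF c H]) (use A(5,6) in \<open>simp_all add: comma_def comma_proj_def\<close>)
      then have "\<exists>!m. m \<in> hom ?E (E, h, F) ?X' \<and> ArM ?\<pi> m = k \<and> Comp ?E ?G m = ?H"
        by (simp add: comma_def)
      then show "\<exists>!m. m \<in> hom ShD E (LD ?d') \<and> Comp ShD (\<eta> ?d') m = Comp ShD (ArM Cp k) h \<and> Comp ShD ?l m = a"
        by (rule fillers[OF A(1,5,6), THEN iffD1])
    qed
  next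
    assume R: ?R
    show "cartesian_arrow ?E ShC ?\<pi> ?G"
      unfolding cartesian_arrow_def
    proof (intro conjI GE ballI impI)
      fix H k
      assume H: "H \<in> Arr ?E" and k: "k \<in> hom ShC (ObM ?\<pi> (Dom ?E H)) (ObM ?\<pi> (Dom ?E ?G))"
        and cod: "Cod ?E H = Cod ?E ?G" and eq: "Comp ShC (ArM ?\<pi> ?G) k = ArM ?\<pi> H"
      obtain E h F a b t where H0: "H = ((E, h, F), (a, b), t)" by (cases H) auto
      then have t: "t = ?X" using cod by (simp add: comma_def)
      have k': "k \<in> hom ShC F (LC (ObM p ?d'))" and b: "Comp ShC ?pl k = b"
        using k eq H0 by (auto simp: comma_def comma_proj_def)
      have A: "h \<in> hom ShD E (ObM Cp F)" "a \<in> hom ShD E (LD ?d)" "b \<in> hom ShC F (LC (ObM p ?d))"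
        "Comp ShD (\<eta> ?d) a = Comp ShD (ArM Cp b) h"
        using H comma_arr unfolding H0 t by auto
      have "\<exists>!m. m \<in> hom ?E (E, h, F) ?X' \<and> ArM ?\<pi> m = k \<and> Comp ?E ?G m = H"
        unfolding H0 t
        by (rule fillers[OF A(1) k' b, THEN iffD2], rule R[rule_format, OF A k' b])
      then show "\<exists>!m. m \<in> hom ?E (Dom ?E H) (Dom ?E ?G) \<and> ArM ?\<pi> m = k \<and> Comp ?E ?G m = H"
        unfolding H0 by (simp add: comma_def)
    qed
  qed
  have "?R \<longleftrightarrow> pullback_square g"
    unfolding pullback_square_iff[OF g]
  proof (intro iffI allI impI)
    fix E a \<beta>
    assume R: ?R and A: "a \<in> hom ShD E (LD ?d)" "\<beta> \<in> hom ShD E (ObM Cp (LC (ObM p ?d')))"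
      "Comp ShD (\<eta> ?d) a = Comp ShD (ArM Cp ?pl) \<beta>"
    have sh: "sheaf C J (LC (ObM p ?d'))" using sheaf_LC d by simp
    have "\<exists>!m. m \<in> hom ShD E (LD ?d') \<and>
        Comp ShD (\<eta> ?d') m = Comp ShD (ArM Cp (Id ShC (LC (ObM p ?d')))) \<beta> \<and> Comp ShD ?l m = a"
      using R A hpl C.Id_Sh_hom[OF sh] C.Comp_Sh_Id_right[OF hpl] by blast
    then show "\<exists>!m. m \<in> hom ShD E (LD ?d') \<and> Comp ShD (\<eta> ?d') m = \<beta> \<and> Comp ShD ?l m = a"
      using Cp_Id[OF sh] D.Comp_Sh_Id_left[OF A(2)] by simp
  next
    fix E h F a b k
    assume P: "\<forall>E a \<beta>. a \<in> hom ShD E (LD ?d) \<longrightarrow> \<beta> \<in> hom ShD E (ObM Cp (LC (ObM p ?d'))) \<longrightarrow>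
        Comp ShD (\<eta> ?d) a = Comp ShD (ArM Cp ?pl) \<beta> \<longrightarrow>
        (\<exists>!m. m \<in> hom ShD E (LD ?d') \<and> Comp ShD (\<eta> ?d') m = \<beta> \<and> Comp ShD ?l m = a)"
      and A: "h \<in> hom ShD E (ObM Cp F)" "a \<in> hom ShD E (LD ?d)" "b \<in> hom ShC F (LC (ObM p ?d))"
        "Comp ShD (\<eta> ?d) a = Comp ShD (ArM Cp b) h" "k \<in> hom ShC F (LC (ObM p ?d'))" "Comp ShC ?pl k = b"
    have "Comp ShD (\<eta> ?d) a = Comp ShD (ArM Cp ?pl) (Comp ShD (ArM Cp k) h)"
      using A(4) Cp_comp[OF A(5) hpl] D.Comp_Sh_assoc[OF A(1) Cp_hom[OF A(5)] hCpl] A(6) by simp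
    then show "\<exists>!m. m \<in> hom ShD E (LD ?d') \<and> Comp ShD (\<eta> ?d') m = Comp ShD (ArM Cp k) h \<and> Comp ShD ?l m = a"
      using P A(2) D.Comp_Sh_hom[OF A(1) Cp_hom[OF A(5)]] by blast
  qed
  then show ?thesis using lc cart by blast
qed

end

section \<open>An elementary description of locally cartesian arrows\<close>

context universe_comorphism
begin

text \<open>The two conditions say that the map from \<open>Hom(-, d')\<close> to the presheaf of compatible pairs
  \<open>(h, k)\<close>, which sheafifies to the comparison map into the pullback, is locally injective and
  locally surjective.\<close>

definition locally_injective_lifts :: "'ad \<Rightarrow> bool" where
  "locally_injective_lifts g \<longleftrightarrow>
     (\<forall>x\<in>Obj D. \<forall>m\<in>hom D x (Dom D g). \<forall>m'\<in>hom D x (Dom D g).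
        Comp D g m = Comp D g m' \<longrightarrow> ArM p m = ArM p m' \<longrightarrow>
        D.locally x (\<lambda>w. Comp D m w = Comp D m' w))"

definition locally_surjective_lifts :: "'ad \<Rightarrow> bool" where
  "locally_surjective_lifts g \<longleftrightarrow>
     (\<forall>x\<in>Obj D. \<forall>h\<in>hom D x (Cod D g). \<forall>k\<in>hom C (ObM p x) (ObM p (Dom D g)).
        ArM p h = Comp C (ArM p g) k \<longrightarrow>
        D.locally x (\<lambda>w. \<exists>n\<in>hom D (Dom D w) (Dom D g).
          Comp D g n = Comp D h w \<and> ArM p n = Comp C k (ArM p w)))"

lemma trafo_val:
  "a \<in> hom ShD F G \<Longrightarrow> x \<in> Obj D \<Longrightarrow> z \<in> Val F x \<Longrightarrow> trafo a x z \<in> Val G x"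
  using nat_trans_val[of D F G "trafo a" x z] by (simp add: hom_Sh)

lemma trafo_res:
  "a \<in> hom ShD F G \<Longrightarrow> w \<in> Arr D \<Longrightarrow> z \<in> Val F (Cod D w) \<Longrightarrow>
     trafo a (Dom D w) (Res F w z) = Res G w (trafo a (Cod D w) z)"
  using nat_trans_res[of D F G "trafo a" w z] by (simp add: hom_Sh)

lemma comp_hom_D: "f \<in> hom D x y \<Longrightarrow> g \<in> hom D y z \<Longrightarrow> Comp D g f \<in> hom D x z"
  by (auto simp: hom_def)

lemma comp_hom_C: "f \<in> hom C x y \<Longrightarrow> g \<in> hom C y z \<Longrightarrow> Comp C g f \<in> hom C x z"
  by (auto simp: hom_def)

lemma ar_p_hom: "f \<in> hom D x y \<Longrightarrow> ArM p f \<in> hom C (ObM p x) (ObM p y)"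
  by (auto simp: hom_def)

lemma hom_selfI: "g \<in> Arr D \<Longrightarrow> g \<in> hom D (Dom D g) (Cod D g)"
  by (simp add: hom_def)

text \<open>Two arrows \<open>m, m' : x \<rightarrow> d'\<close> that agree after \<open>g\<close> and under \<open>p\<close> give two lifts \<open>l(m), l(m')\<close> of
  the same test object \<open>l(x)\<close>; uniqueness of lifts makes them equal as sections, so locally equal as
  arrows.\<close>

lemma locally_injective_lifts_of_pullback:
  assumes g: "g \<in> Arr D" and pb: "pullback_square g"
  shows "locally_injective_lifts g"
  unfolding locally_injective_lifts_def
proof (intro ballI impI)
  fix x m m'
  assume x: "x \<in> Obj D" and m: "m \<in> hom D x (Dom D g)" and m': "m' \<in> hom D x (Dom D g)"
    and gm: "Comp D g m = Comp D g m'" and pm: "ArM p m = ArM p m'"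
  have d: "Dom D g \<in> Obj D" "Cod D g \<in> Obj D" using g by auto
  have hg: "lD g \<in> hom ShD (LD (Dom D g)) (LD (Cod D g))" by (rule l_map_D_hom[OF g])
  have h\<eta>: "\<eta> (Dom D g) \<in> hom ShD (LD (Dom D g)) (ObM Cp (LC (ObM p (Dom D g))))" by (rule eta_hom[OF d(1)])
  have act: "lD m \<in> hom ShD (LD x) (LD (Dom D g)) \<and>
      (\<forall>y\<in>Obj D. \<forall>w\<in>hom D y x. trafo (lD m) y (\<iota> x y w) = \<iota> (Dom D g) y (Comp D m w))"
    if "m \<in> hom D x (Dom D g)" for m
    using l_map_D_hom[of m] l_map_\<iota>[of m] that by (auto simp: hom_def)
  note hm = act[OF m, THEN conjunct1] and hm' = act[OF m', THEN conjunct1]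
  have e1: "Comp ShD (lD g) (lD m') = Comp ShD (lD g) (lD m)"
  proof (rule Sh_arrow_eqI_\<iota>[OF x D.Comp_Sh_hom[OF hm' hg] D.Comp_Sh_hom[OF hm hg]])
    fix y w assume y: "y \<in> Obj D" and w: "w \<in> hom D y x"
    have "Comp D g (Comp D m w) = Comp D g (Comp D m' w)"
      using gm g m m' w D.comp_assoc[of w m g] D.comp_assoc[of w m' g] by (auto simp: hom_def)
    then show "trafo (Comp ShD (lD g) (lD m')) y (\<iota> x y w) = trafo (Comp ShD (lD g) (lD m)) y (\<iota> x y w)"
      using trafo_Comp_Sh[OF hm y \<iota>_val[OF x y w]] trafo_Comp_Sh[OF hm' y \<iota>_val[OF x y w]]
        act[OF m] act[OF m'] y w l_map_\<iota>[OF g y comp_hom_D[OF w m]] l_map_\<iota>[OF g y comp_hom_D[OF w m']]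
      by simp
  qed
  have e2: "Comp ShD (\<eta> (Dom D g)) (lD m') = Comp ShD (\<eta> (Dom D g)) (lD m)"
  proof (rule Sh_arrow_eqI_\<iota>[OF x D.Comp_Sh_hom[OF hm' h\<eta>] D.Comp_Sh_hom[OF hm h\<eta>]])
    fix y w assume y: "y \<in> Obj D" and w: "w \<in> hom D y x"
    have "ArM p (Comp D m w) = ArM p (Comp D m' w)"
      using pm m m' w by (auto simp: hom_def)
    then show "trafo (Comp ShD (\<eta> (Dom D g)) (lD m')) y (\<iota> x y w) =
        trafo (Comp ShD (\<eta> (Dom D g)) (lD m)) y (\<iota> x y w)"
      using trafo_Comp_Sh[OF hm y \<iota>_val[OF x y w]] trafo_Comp_Sh[OF hm' y \<iota>_val[OF x y w]]
        act[OF m] act[OF m'] y w eta_\<iota>[OF d(1) y comp_hom_D[OF w m]] eta_\<iota>[OF d(1) y comp_hom_D[OF w m']]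
      by simp
  qed
  let ?q = "Comp ShD (\<eta> (Dom D g)) (lD m)" and ?r = "Comp ShD (lD g) (lD m)"
  have com: "Comp ShD (\<eta> (Cod D g)) ?r = Comp ShD (ArM Cp (lC (ArM p g))) ?q"
    using eta_natural[OF g] D.Comp_Sh_assoc[OF hm hg eta_hom[OF d(2)]]
      D.Comp_Sh_assoc[OF hm h\<eta> Cp_hom[OF lC_p_hom[OF g]]] by simp
  have "\<exists>!n. n \<in> hom ShD (LD x) (LD (Dom D g)) \<and> Comp ShD (\<eta> (Dom D g)) n = ?q \<and> Comp ShD (lD g) n = ?r"
    using pullback_squareD[OF g pb D.Comp_Sh_hom[OF hm hg] D.Comp_Sh_hom[OF hm h\<eta>] com] .
  then have "lD m = lD m'" using hm hm' e1 e2 by blast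
  moreover have idx: "Id D x \<in> hom D x x" using x by (simp add: hom_def)
  ultimately have "\<iota> (Dom D g) x (Comp D m (Id D x)) = \<iota> (Dom D g) x (Comp D m' (Id D x))"
    using act[OF m, THEN conjunct2, rule_format, OF x idx] act[OF m', THEN conjunct2, rule_format, OF x idx] by simp
  then have "\<iota> (Dom D g) x m = \<iota> (Dom D g) x m'" using m m' by (simp add: hom_def)
  then show "D.locally x (\<lambda>w. Comp D m w = Comp D m' w)" using \<iota>_inj[OF d(1) x m m'] by blast
qed

text \<open>A compatible pair \<open>(h, k)\<close> is a test object \<open>l(x)\<close>, with the map \<open>l(h)\<close> to \<open>l(d)\<close> and the map
  \<open>C_p\<^sup>* l(k) \<circ> \<eta>(x)\<close> to \<open>C_p\<^sup>* l(p d')\<close>. Its lift to \<open>l(d')\<close> is locally represented by arrows.\<close>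

lemma locally_surjective_lifts_of_pullback:
  assumes g: "g \<in> Arr D" and pb: "pullback_square g"
  shows "locally_surjective_lifts g"
  unfolding locally_surjective_lifts_def
proof (intro ballI impI)
  fix x h k
  assume x: "x \<in> Obj D" and h: "h \<in> hom D x (Cod D g)"
    and k: "k \<in> hom C (ObM p x) (ObM p (Dom D g))" and ph: "ArM p h = Comp C (ArM p g) k"
  let ?d' = "Dom D g" and ?d = "Cod D g" and ?px = "ObM p x"
  have d: "?d' \<in> Obj D" "?d \<in> Obj D" and pd: "ObM p ?d' \<in> Obj C" "ObM p ?d \<in> Obj C" and px: "?px \<in> Obj C"
    using g x by auto
  have ha: "h \<in> Arr D" "Dom D h = x" "Cod D h = ?d" using h by (auto simp: hom_def)
  have ka: "k \<in> Arr C" "Dom C k = ?px" "Cod C k = ObM p ?d'" using k by (auto simp: hom_def)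
  have hh: "lD h \<in> hom ShD (LD x) (LD ?d)" using l_map_D_hom[OF ha(1)] ha by simp
  have hk: "lC k \<in> hom ShC (LC ?px) (LC (ObM p ?d'))" using l_map_C_hom[OF ka(1)] ka by simp
  note hx = eta_hom[OF x] and hCk = Cp_hom[OF hk] and h\<eta> = eta_hom[OF d(2)] and h\<eta>' = eta_hom[OF d(1)]
    and hg = l_map_D_hom[OF g] and hCg = Cp_hom[OF lC_p_hom[OF g]]
  let ?q = "Comp ShD (ArM Cp (lC k)) (\<eta> x)"
  have hq: "?q \<in> hom ShD (LD x) (ObM Cp (LC (ObM p ?d')))" using D.Comp_Sh_hom[OF hx hCk] .
  have q\<iota>: "trafo ?q y (\<iota> x y w) = \<kappa> (ObM p ?d') y (Comp C k (ArM p w))"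
    if y: "y \<in> Obj D" and w: "w \<in> hom D y x" for y w
    using trafo_Comp_Sh[OF hx y \<iota>_val[OF x y w]] eta_\<iota>[OF x y w] Cp_l_map_\<kappa>[OF ka(1) y] ka ar_p_hom[OF w]
    by simp
  have com: "Comp ShD (\<eta> ?d) (lD h) = Comp ShD (ArM Cp (lC (ArM p g))) ?q"
  proof (rule Sh_arrow_eqI_\<iota>[OF x D.Comp_Sh_hom[OF hh h\<eta>] D.Comp_Sh_hom[OF hq hCg]])
    fix y w assume y: "y \<in> Obj D" and w: "w \<in> hom D y x"
    have kw: "Comp C k (ArM p w) \<in> hom C (ObM p y) (ObM p ?d')" using comp_hom_C[OF ar_p_hom[OF w] k] .
    have "ArM p (Comp D h w) = Comp C (ArM p g) (Comp C k (ArM p w))"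
      using ph w ha ka g by (auto simp: hom_def C.comp_assoc)
    then show "trafo (Comp ShD (\<eta> ?d) (lD h)) y (\<iota> x y w) =
        trafo (Comp ShD (ArM Cp (lC (ArM p g))) ?q) y (\<iota> x y w)"
      using trafo_Comp_Sh[OF hh y \<iota>_val[OF x y w]] trafo_Comp_Sh[OF hq y \<iota>_val[OF x y w]]
        l_map_\<iota>[OF ha(1) y] eta_\<iota>[OF d(2) y comp_hom_D[OF w h]] q\<iota>[OF y w]
        Cp_l_map_\<kappa>[of "ArM p g" y "Comp C k (ArM p w)"] ha w g y kw by simp
  qed
  obtain n where n: "n \<in> hom ShD (LD x) (LD ?d')" "Comp ShD (\<eta> ?d') n = ?q" "Comp ShD (lD g) n = lD h"
    using pullback_squareD[OF g pb hh hq com] by blast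
  have idx: "Id D x \<in> hom D x x" using x by (simp add: hom_def)
  \<comment> \<open>By the Yoneda lemma \<open>n\<close> is a section \<open>e\<close> of \<open>l(d')\<close>, and a section is locally an arrow.\<close>
  define e where "e = trafo n x (\<iota> x x (Id D x))"
  have e: "e \<in> Val (LD ?d') x" unfolding e_def using trafo_val[OF n(1) x \<iota>_val[OF x x idx]] .
  have ge: "trafo (lD g) x e = \<iota> ?d x h"
    using trafo_Comp_Sh[OF n(1) x \<iota>_val[OF x x idx], of "lD g"] l_map_\<iota>[OF ha(1) x] ha idx
    unfolding n(3) e_def by simp
  have \<eta>e: "trafo (\<eta> ?d') x e = \<kappa> (ObM p ?d') x k"
    using trafo_Comp_Sh[OF n(1) x \<iota>_val[OF x x idx], of "\<eta> ?d'"] q\<iota>[OF x idx] ka x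
    unfolding n(2) e_def by simp
  show "D.locally x (\<lambda>w. \<exists>n\<in>hom D (Dom D w) ?d'.
          Comp D g n = Comp D h w \<and> ArM p n = Comp C k (ArM p w))"
  proof (rule D.locally_bind[OF x \<iota>_surj[OF d(1) x e]])
    fix w assume w: "w \<in> Arr D" "Cod D w = x"
      and "\<exists>n\<in>hom D (Dom D w) ?d'. \<iota> ?d' (Dom D w) n = Res (LD ?d') w e"
    then obtain n where n: "n \<in> hom D (Dom D w) ?d'" "\<iota> ?d' (Dom D w) n = Res (LD ?d') w e" by blast
    have wd: "Dom D w \<in> Obj D" and wh: "w \<in> hom D (Dom D w) x" using w by (auto simp: hom_def)
    have "\<iota> ?d (Dom D w) (Comp D g n) = \<iota> ?d (Dom D w) (Comp D h w)"
      using l_map_\<iota>[OF g wd n(1)] trafo_res[OF hg w(1), of e] e w ge n(2) \<iota>_res[OF d(2) x h w] by simp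
    then have l1: "D.locally (Dom D w) (\<lambda>v. Comp D (Comp D g n) v = Comp D (Comp D h w) v)"
      using \<iota>_inj[OF d(2) wd comp_hom_D[OF n(1) hom_selfI[OF g]] comp_hom_D[OF wh h]] by blast
    have "\<kappa> (ObM p ?d') (Dom D w) (ArM p n) = \<kappa> (ObM p ?d') (Dom D w) (Comp C k (ArM p w))"
      using eta_\<iota>[OF d(1) wd n(1)] trafo_res[OF h\<eta>' w(1), of e] e w \<eta>e n(2) \<kappa>_res[OF pd(1) x k w] by simp
    then have l2: "D.locally (Dom D w) (\<lambda>v. Comp C (ArM p n) (ArM p v) = Comp C (Comp C k (ArM p w)) (ArM p v))"
      using \<kappa>_inj[OF pd(1) wd ar_p_hom[OF n(1)] comp_hom_C[OF ar_p_hom[OF wh] k]] by blast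
    show "D.locally (Dom D w) (\<lambda>v. \<exists>n\<in>hom D (Dom D (Comp D w v)) ?d'.
            Comp D g n = Comp D h (Comp D w v) \<and> ArM p n = Comp C k (ArM p (Comp D w v)))"
    proof (rule D.locally_mono[OF D.locally_conj[OF wd l1 l2] wd])
      fix v assume v: "v \<in> Arr D" "Cod D v = Dom D w"
        "Comp D (Comp D g n) v = Comp D (Comp D h w) v \<and>
         Comp C (ArM p n) (ArM p v) = Comp C (Comp C k (ArM p w)) (ArM p v)"
      show "\<exists>n\<in>hom D (Dom D (Comp D w v)) ?d'.
            Comp D g n = Comp D h (Comp D w v) \<and> ArM p n = Comp C k (ArM p (Comp D w v))"
        using v w n(1) g ha ka
        by (intro bexI[of _ "Comp D n v"]) (auto simp: hom_def D.comp_assoc C.comp_assoc)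
    qed
  qed
qed

text \<open>Local injectivity makes a section of \<open>l(d')\<close> determined by its two images.\<close>

lemma section_eq_of_locally_injective_lifts:
  assumes g: "g \<in> Arr D" and inj: "locally_injective_lifts g" and x: "x \<in> Obj D"
    and z: "z \<in> Val (LD (Dom D g)) x" and z': "z' \<in> Val (LD (Dom D g)) x"
    and eg: "trafo (lD g) x z = trafo (lD g) x z'"
    and e\<eta>: "trafo (\<eta> (Dom D g)) x z = trafo (\<eta> (Dom D g)) x z'"
  shows "z = z'"
proof -
  let ?d' = "Dom D g" and ?d = "Cod D g"
  have d: "?d' \<in> Obj D" "?d \<in> Obj D" and pd: "ObM p ?d' \<in> Obj C" using g by auto
  note hg = l_map_D_hom[OF g] and h\<eta> = eta_hom[OF d(1)]
  note P = D.sheaf_presheaf[OF sheaf_LD[OF d(1)]]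
  have "D.locally x (\<lambda>w. Res (LD ?d') w z = Res (LD ?d') w z')"
  proof (rule D.locally_bind[OF x D.locally_conj[OF x \<iota>_surj[OF d(1) x z] \<iota>_surj[OF d(1) x z']]])
    fix w assume w: "w \<in> Arr D" "Cod D w = x"
      and "(\<exists>n\<in>hom D (Dom D w) ?d'. \<iota> ?d' (Dom D w) n = Res (LD ?d') w z) \<and>
           (\<exists>n\<in>hom D (Dom D w) ?d'. \<iota> ?d' (Dom D w) n = Res (LD ?d') w z')"
    then obtain n n' where n: "n \<in> hom D (Dom D w) ?d'" "\<iota> ?d' (Dom D w) n = Res (LD ?d') w z"
      and n': "n' \<in> hom D (Dom D w) ?d'" "\<iota> ?d' (Dom D w) n' = Res (LD ?d') w z'" by blast
    have wd: "Dom D w \<in> Obj D" using w by simp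
    have "\<iota> ?d (Dom D w) (Comp D g n) = \<iota> ?d (Dom D w) (Comp D g n')"
      using l_map_\<iota>[OF g wd n(1)] l_map_\<iota>[OF g wd n'(1)] trafo_res[OF hg w(1), of z] trafo_res[OF hg w(1), of z']
        z z' w eg n(2) n'(2) by simp
    then have l1: "D.locally (Dom D w) (\<lambda>v. Comp D (Comp D g n) v = Comp D (Comp D g n') v)"
      using \<iota>_inj[OF d(2) wd] comp_hom_D[OF n(1) hom_selfI[OF g]] comp_hom_D[OF n'(1) hom_selfI[OF g]] by blast
    have "\<kappa> (ObM p ?d') (Dom D w) (ArM p n) = \<kappa> (ObM p ?d') (Dom D w) (ArM p n')"
      using eta_\<iota>[OF d(1) wd n(1)] eta_\<iota>[OF d(1) wd n'(1)] trafo_res[OF h\<eta> w(1), of z]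
        trafo_res[OF h\<eta> w(1), of z'] z z' w e\<eta> n(2) n'(2) by simp
    then have l2: "D.locally (Dom D w) (\<lambda>v. Comp C (ArM p n) (ArM p v) = Comp C (ArM p n') (ArM p v))"
      using \<kappa>_inj[OF pd wd ar_p_hom[OF n(1)] ar_p_hom[OF n'(1)]] by blast
    have "D.locally (Dom D w) (\<lambda>v. Comp D n v = Comp D n' v)"
    proof (rule D.locally_bind[OF wd D.locally_conj[OF wd l1 l2]])
      fix v assume v: "v \<in> Arr D" "Cod D v = Dom D w"
        "Comp D (Comp D g n) v = Comp D (Comp D g n') v \<and>
         Comp C (ArM p n) (ArM p v) = Comp C (ArM p n') (ArM p v)"
      have "D.locally (Dom D v) (\<lambda>u. Comp D (Comp D n v) u = Comp D (Comp D n' v) u)"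
        using inj[unfolded locally_injective_lifts_def, rule_format, of "Dom D v" "Comp D n v" "Comp D n' v"]
          v n(1) n'(1) g by (auto simp: hom_def D.comp_assoc)
      then show "D.locally (Dom D v) (\<lambda>u. Comp D n (Comp D v u) = Comp D n' (Comp D v u))"
        by (rule D.locally_mono) (use v n(1) n'(1) in \<open>auto simp: hom_def D.comp_assoc\<close>)
    qed
    then show "D.locally (Dom D w) (\<lambda>v. Res (LD ?d') (Comp D w v) z = Res (LD ?d') (Comp D w v) z')"
    proof (rule D.locally_mono[OF _ wd])
      fix v assume v: "v \<in> Arr D" "Cod D v = Dom D w" "Comp D n v = Comp D n' v"
      show "Res (LD ?d') (Comp D w v) z = Res (LD ?d') (Comp D w v) z'"
        using v w z z' D.res_comp[OF P v(1) w(1)] \<iota>_res[OF d(1) wd n(1) v(1,2)] \<iota>_res[OF d(1) wd n'(1) v(1,2)]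
          n(2) n'(2) by simp
    qed
  qed
  then show ?thesis by (rule D.sheaf_separated[OF sheaf_LD[OF d(1)] x z z'])
qed

text \<open>Sections of the test sheaf \<open>E\<close> locally yield compatible pairs \<open>(h, k)\<close>, hence local lifts to
  \<open>l(d')\<close>. The lifts are unique by the preceding lemma, so they assemble to a map from \<open>E\<close>.\<close>

lemma pullback_of_lifts:
  assumes g: "g \<in> Arr D" and inj: "locally_injective_lifts g" and surj: "locally_surjective_lifts g"
  shows "pullback_square g"
proof (rule pullback_squareI[OF g])
  let ?d' = "Dom D g" and ?d = "Cod D g"
  fix E a \<beta>
  assume a: "a \<in> hom ShD E (LD ?d)" and \<beta>: "\<beta> \<in> hom ShD E (ObM Cp (LC (ObM p ?d')))"
    and com: "Comp ShD (\<eta> ?d) a = Comp ShD (ArM Cp (lC (ArM p g))) \<beta>"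
  have d: "?d' \<in> Obj D" "?d \<in> Obj D" and pd: "ObM p ?d' \<in> Obj C" "ObM p ?d \<in> Obj C" using g by auto
  note hg = l_map_D_hom[OF g] and h\<eta>' = eta_hom[OF d(1)] and h\<eta> = eta_hom[OF d(2)]
    and hCg = Cp_hom[OF lC_p_hom[OF g]]
  have E: "sheaf D K E" using a unfolding hom_Sh by blast
  note PE = D.sheaf_presheaf[OF E]
  have com_e: "trafo (\<eta> ?d) x (trafo a x e) = trafo (ArM Cp (lC (ArM p g))) x (trafo \<beta> x e)"
    if "x \<in> Obj D" "e \<in> Val E x" for x e
    using trafo_Comp_Sh[OF a that, of "\<eta> ?d"] trafo_Comp_Sh[OF \<beta> that, of "ArM Cp (lC (ArM p g))"] com by simp
  let ?\<Psi> = "\<lambda>x e z. trafo (lD g) x z = trafo a x e \<and> trafo (\<eta> ?d') x z = trafo \<beta> x e"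
  have local_ex: "D.locally x (\<lambda>w. \<exists>z\<in>Val (LD ?d') (Dom D w). ?\<Psi> (Dom D w) (Res E w e) z)"
    if x: "x \<in> Obj D" and e: "e \<in> Val E x" for x e
  proof -
    note ae = trafo_val[OF a x e] and \<beta>e = trafo_val[OF \<beta> x e]
    show ?thesis
    proof (rule D.locally_bind[OF x D.locally_conj[OF x \<iota>_surj[OF d(2) x ae] \<kappa>_surj[OF pd(1) x \<beta>e]]])
      fix w assume w: "w \<in> Arr D" "Cod D w = x"
        and "(\<exists>h\<in>hom D (Dom D w) ?d. \<iota> ?d (Dom D w) h = Res (LD ?d) w (trafo a x e)) \<and>
          (\<exists>k\<in>hom C (ObM p (Dom D w)) (ObM p ?d'). \<kappa> (ObM p ?d') (Dom D w) k =
            Res (ObM Cp (LC (ObM p ?d'))) w (trafo \<beta> x e))"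
      then obtain h k where h: "h \<in> hom D (Dom D w) ?d" "\<iota> ?d (Dom D w) h = Res (LD ?d) w (trafo a x e)"
        and k: "k \<in> hom C (ObM p (Dom D w)) (ObM p ?d')"
          "\<kappa> (ObM p ?d') (Dom D w) k = Res (ObM Cp (LC (ObM p ?d'))) w (trafo \<beta> x e)" by blast
      have wd: "Dom D w \<in> Obj D" using w by simp
      have we: "Res E w e \<in> Val E (Dom D w)" using D.res_val[OF PE w(1)] w e by simp
      have hw: "\<iota> ?d (Dom D w) h = trafo a (Dom D w) (Res E w e)"
        and kw: "\<kappa> (ObM p ?d') (Dom D w) k = trafo \<beta> (Dom D w) (Res E w e)"
        using h(2) k(2) trafo_res[OF a w(1), of e] trafo_res[OF \<beta> w(1), of e] w e by auto
      have gk: "Comp C (ArM p g) k \<in> hom C (ObM p (Dom D w)) (ObM p ?d)"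
        using comp_hom_C[OF k(1) ar_p_hom[OF hom_selfI[OF g]]] .
      have "\<kappa> (ObM p ?d) (Dom D w) (ArM p h) = \<kappa> (ObM p ?d) (Dom D w) (Comp C (ArM p g) k)"
        using com_e[OF wd we] hw kw eta_\<iota>[OF d(2) wd h(1)] Cp_l_map_\<kappa>[of "ArM p g" "Dom D w" k] g wd k(1)
        by simp
      then have loc: "D.locally (Dom D w) (\<lambda>v. Comp C (ArM p h) (ArM p v) = Comp C (Comp C (ArM p g) k) (ArM p v))"
        using \<kappa>_inj[OF pd(2) wd ar_p_hom[OF h(1)] gk] by blast
      have "D.locally (Dom D w) (\<lambda>v. \<exists>n\<in>hom D (Dom D v) ?d'.
          Comp D g n = Comp D h v \<and> ArM p n = Comp C k (ArM p v))"
      proof (rule D.locally_bind[OF wd loc])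
        fix v assume v: "v \<in> Arr D" "Cod D v = Dom D w"
          "Comp C (ArM p h) (ArM p v) = Comp C (Comp C (ArM p g) k) (ArM p v)"
        have "D.locally (Dom D v) (\<lambda>u. \<exists>n\<in>hom D (Dom D u) ?d'.
            Comp D g n = Comp D (Comp D h v) u \<and> ArM p n = Comp C (Comp C k (ArM p v)) (ArM p u))"
          using surj[unfolded locally_surjective_lifts_def, rule_format,
              of "Dom D v" "Comp D h v" "Comp C k (ArM p v)"]
            v h(1) k(1) g by (auto simp: hom_def C.comp_assoc)
        then show "D.locally (Dom D v) (\<lambda>u. \<exists>n\<in>hom D (Dom D (Comp D v u)) ?d'.
            Comp D g n = Comp D h (Comp D v u) \<and> ArM p n = Comp C k (ArM p (Comp D v u)))"
          by (rule D.locally_mono) (use v h(1) k(1) in \<open>auto simp: hom_def D.comp_assoc C.comp_assoc\<close>)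
      qed
      then show "D.locally (Dom D w) (\<lambda>v. \<exists>z\<in>Val (LD ?d') (Dom D (Comp D w v)).
          ?\<Psi> (Dom D (Comp D w v)) (Res E (Comp D w v) e) z)"
      proof (rule D.locally_mono[OF _ wd])
        fix v assume v: "v \<in> Arr D" "Cod D v = Dom D w"
          and "\<exists>n\<in>hom D (Dom D v) ?d'. Comp D g n = Comp D h v \<and> ArM p n = Comp C k (ArM p v)"
        then obtain n where n: "n \<in> hom D (Dom D v) ?d'" "Comp D g n = Comp D h v" "ArM p n = Comp C k (ArM p v)"
          by blast
        have vd: "Dom D v \<in> Obj D" using v by simp
        have res: "Res E (Comp D w v) e = Res E v (Res E w e)"
          using D.res_comp[OF PE v(1) w(1) v(2)] w e by simp
        have "trafo (lD g) (Dom D v) (\<iota> ?d' (Dom D v) n) = trafo a (Dom D v) (Res E v (Res E w e))"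
          using l_map_\<iota>[OF g vd n(1)] n(2) \<iota>_res[OF d(2) wd h(1) v] hw trafo_res[OF a v(1), of "Res E w e"] v we
          by simp
        moreover have "trafo (\<eta> ?d') (Dom D v) (\<iota> ?d' (Dom D v) n) = trafo \<beta> (Dom D v) (Res E v (Res E w e))"
          using eta_\<iota>[OF d(1) vd n(1)] n(3) \<kappa>_res[OF pd(1) wd k(1) v] kw trafo_res[OF \<beta> v(1), of "Res E w e"] v we
          by simp
        ultimately show "\<exists>z\<in>Val (LD ?d') (Dom D (Comp D w v)).
            ?\<Psi> (Dom D (Comp D w v)) (Res E (Comp D w v) e) z"
          using res \<iota>_val[OF d(1) vd n(1)] v w by auto
      qed
    qed
  qed
  have "\<exists>\<gamma>. nat_trans D E (LD ?d') \<gamma> \<and> (\<forall>x\<in>Obj D. \<forall>e\<in>Val E x. ?\<Psi> x e (\<gamma> x e))"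
  proof (rule D.nat_trans_of_local_solutions[OF PE sheaf_LD[OF d(1)]])
    show "?\<Psi> (Dom D w) (Res E w e) (Res (LD ?d') w z)"
      if "w \<in> Arr D" "e \<in> Val E (Cod D w)" "z \<in> Val (LD ?d') (Cod D w)" "?\<Psi> (Cod D w) e z" for w e z
      using that trafo_res[OF hg that(1,3)] trafo_res[OF h\<eta>' that(1,3)] trafo_res[OF a that(1,2)]
        trafo_res[OF \<beta> that(1,2)] by simp
    show "?\<Psi> x e z"
      if x: "x \<in> Obj D" and e: "e \<in> Val E x" and z: "z \<in> Val (LD ?d') x"
        and loc: "D.locally x (\<lambda>w. ?\<Psi> (Dom D w) (Res E w e) (Res (LD ?d') w z))" for x e z
    proof
      show "trafo (lD g) x z = trafo a x e"
      proof (rule D.sheaf_separated[OF sheaf_LD[OF d(2)] x trafo_val[OF hg x z] trafo_val[OF a x e]])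
        show "D.locally x (\<lambda>w. Res (LD ?d) w (trafo (lD g) x z) = Res (LD ?d) w (trafo a x e))"
          by (rule D.locally_mono[OF loc x]) (use trafo_res[OF hg] trafo_res[OF a] z e in force)
      qed
      show "trafo (\<eta> ?d') x z = trafo \<beta> x e"
      proof (rule D.sheaf_separated[OF sheaf_Cp_LC[OF pd(1)] x trafo_val[OF h\<eta>' x z] trafo_val[OF \<beta> x e]])
        show "D.locally x (\<lambda>w. Res (ObM Cp (LC (ObM p ?d'))) w (trafo (\<eta> ?d') x z) =
            Res (ObM Cp (LC (ObM p ?d'))) w (trafo \<beta> x e))"
          by (rule D.locally_mono[OF loc x]) (use trafo_res[OF h\<eta>'] trafo_res[OF \<beta>] z e in force)
      qed
    qed
    show "z = z'"
      if "x \<in> Obj D" "e \<in> Val E x" "z \<in> Val (LD ?d') x" "z' \<in> Val (LD ?d') x" "?\<Psi> x e z" "?\<Psi> x e z'" for x e z z'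
      using section_eq_of_locally_injective_lifts[OF g inj that(1,3,4)] that(5,6) by simp
  qed (rule local_ex)
  then obtain \<gamma> where \<gamma>: "nat_trans D E (LD ?d') \<gamma>"
    and \<Psi>: "\<And>x e. x \<in> Obj D \<Longrightarrow> e \<in> Val E x \<Longrightarrow> ?\<Psi> x e (\<gamma> x e)" by blast
  let ?m = "(E, \<gamma>, LD ?d')"
  have hm: "?m \<in> hom ShD E (LD ?d')" using E sheaf_LD[OF d(1)] \<gamma> unfolding hom_Sh by simp
  show "\<exists>!m. m \<in> hom ShD E (LD ?d') \<and> Comp ShD (\<eta> ?d') m = \<beta> \<and> Comp ShD (lD g) m = a"
  proof (rule ex1I[of _ ?m])
    have "Comp ShD (\<eta> ?d') ?m = \<beta>"
      by (rule Sh_arrow_eqI[OF D.Comp_Sh_hom[OF hm h\<eta>'] \<beta>]) (use trafo_Comp_Sh[OF hm] \<Psi> in simp)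
    moreover have "Comp ShD (lD g) ?m = a"
      by (rule Sh_arrow_eqI[OF D.Comp_Sh_hom[OF hm hg] a]) (use trafo_Comp_Sh[OF hm] \<Psi> in simp)
    ultimately show "?m \<in> hom ShD E (LD ?d') \<and> Comp ShD (\<eta> ?d') ?m = \<beta> \<and> Comp ShD (lD g) ?m = a"
      using hm by blast
    fix m assume m: "m \<in> hom ShD E (LD ?d') \<and> Comp ShD (\<eta> ?d') m = \<beta> \<and> Comp ShD (lD g) m = a"
    then have hm': "m \<in> hom ShD E (LD ?d')" by blast
    show "m = ?m"
    proof (rule Sh_arrow_eqI[OF hm' hm])
      fix x e assume x: "x \<in> Obj D" and e: "e \<in> Val E x"
      have "?\<Psi> x e (trafo m x e)" using m trafo_Comp_Sh[OF hm' x e] by metis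
      then show "trafo m x e = trafo ?m x e"
        using section_eq_of_locally_injective_lifts[OF g inj x trafo_val[OF hm' x e] trafo_val[OF hm x e]] \<Psi>[OF x e]
        by simp
    qed
  qed
qed

lemma locally_cartesian_iff_lifts:
  assumes "g \<in> Arr D"
  shows "locally_cartesian TYPE('u) D K C J p g \<longleftrightarrow> locally_injective_lifts g \<and> locally_surjective_lifts g"
  using assms locally_cartesian_iff_pullback locally_injective_lifts_of_pullback
    locally_surjective_lifts_of_pullback pullback_of_lifts by blast

end

section \<open>Preservation of pullbacks\<close>

text \<open>The numbers 0, 1, 2 name the objects as well as their identities; the two other arrows are
  3, from 0 to 2, and 4, from 1 to 2. Of two composable arrows at least one is an identity.\<close>

definition cospan_shape :: "(nat, nat) category" where
  "cospan_shape = \<lparr>Obj = {0, 1, 2}, Arr = {0, 1, 2, 3, 4},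
     Dom = (\<lambda>s. if s = 3 then 0 else if s = 4 then 1 else s),
     Cod = (\<lambda>s. if s = 3 \<or> s = 4 then 2 else s),
     Id = (\<lambda>i. i), Comp = (\<lambda>t s. if s = 3 \<or> s = 4 then s else t)\<rparr>"

definition cospan :: "('o, 'a) category \<Rightarrow> 'a \<Rightarrow> 'a \<Rightarrow> (nat, nat, 'o, 'a) func" where
  "cospan C f u =
     (let ob = (\<lambda>i. if i = 0 then Dom C f else if i = 1 then Dom C u else Cod C f)
      in \<lparr>ObM = ob, ArM = (\<lambda>s. if s = 3 then f else if s = 4 then u else Id C (ob s))\<rparr>)"

definition cospan_legs :: "('o, 'a) category \<Rightarrow> 'a \<Rightarrow> 'a \<Rightarrow> 'a \<Rightarrow> nat \<Rightarrow> 'a" where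
  "cospan_legs C f q r = (\<lambda>i. if i = 0 then r else if i = 1 then q else Comp C f r)"

lemma finite_category_cospan_shape: "finite_category cospan_shape"
  by (auto simp: finite_category_def category_def cospan_shape_def hom_def)

context fixed_category
begin

lemma is_functor_cospan:
  assumes "f \<in> Arr C" "u \<in> Arr C" "Cod C f = Cod C u"
  shows "is_functor cospan_shape C (cospan C f u)"
  using assms by (auto simp: is_functor_def cospan_shape_def cospan_def Let_def hom_def)

lemma cone_cospan_iff:
  assumes f: "f \<in> Arr C" and u: "u \<in> Arr C" and fu: "Cod C f = Cod C u"
  shows "cone cospan_shape C (cospan C f u) a l \<longleftrightarrow> a \<in> Obj C \<and>
    l 0 \<in> hom C a (Dom C f) \<and> l 1 \<in> hom C a (Dom C u) \<and>
    l 2 = Comp C f (l 0) \<and> Comp C f (l 0) = Comp C u (l 1)"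
  using assms by (auto simp: cone_def cospan_shape_def cospan_def Let_def hom_def)

text \<open>The leg to the common codomain is forced by the other two.\<close>

lemma limit_cone_cospan_iff:
  assumes f: "f \<in> Arr C" and u: "u \<in> Arr C" and fu: "Cod C f = Cod C u"
  shows "limit_cone cospan_shape C (cospan C f u) a (cospan_legs C f q r) \<longleftrightarrow>
    is_pullback C f u q r \<and> a = Dom C q"
proof -
  have legs: "cospan_legs C f q r 0 = r" "cospan_legs C f q r 1 = q" "cospan_legs C f q r (Suc 0) = q"
    "cospan_legs C f q r 2 = Comp C f r" by (auto simp: cospan_legs_def)
  have commutes: "(\<forall>i\<in>Obj cospan_shape. Comp C (cospan_legs C f q r i) h = m i) \<longleftrightarrow>
      Comp C q h = m 1 \<and> Comp C r h = m 0"
    if "h \<in> hom C b a" "q \<in> hom C a (Dom C u)" "r \<in> hom C a (Dom C f)" "m 2 = Comp C f (m 0)" for h m b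
    using that f by (auto simp: legs cospan_shape_def hom_def comp_assoc)
  show ?thesis
  proof
    assume lim: "limit_cone cospan_shape C (cospan C f u) a (cospan_legs C f q r)"
    then have cn: "r \<in> hom C a (Dom C f)" "q \<in> hom C a (Dom C u)" "Comp C f r = Comp C u q"
      unfolding limit_cone_def cone_cospan_iff[OF f u fu] legs by auto
    have "\<exists>!h. h \<in> hom C (Dom C q') (Dom C q) \<and> Comp C q h = q' \<and> Comp C r h = r'"
      if A: "q' \<in> Arr C" "r' \<in> Arr C" "Dom C q' = Dom C r'" "Cod C q' = Dom C u" "Cod C r' = Dom C f"
        "Comp C f r' = Comp C u q'" for q' r'
    proof -
      let ?m = "cospan_legs C f q' r'"
      have m: "?m 0 = r'" "?m 1 = q'" "?m 2 = Comp C f r'" by (auto simp: cospan_legs_def)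
      have "cone cospan_shape C (cospan C f u) (Dom C q') ?m"
        unfolding cone_cospan_iff[OF f u fu] m using A by (auto simp: hom_def)
      then have "\<exists>!h. h \<in> hom C (Dom C q') a \<and> (\<forall>i\<in>Obj cospan_shape. Comp C (cospan_legs C f q r i) h = ?m i)"
        using lim unfolding limit_cone_def by blast
      moreover have "h \<in> hom C (Dom C q') a \<and> (\<forall>i\<in>Obj cospan_shape. Comp C (cospan_legs C f q r i) h = ?m i) \<longleftrightarrow>
          h \<in> hom C (Dom C q') (Dom C q) \<and> Comp C q h = q' \<and> Comp C r h = r'" for h
        using commutes[of h "Dom C q'" ?m] cn m by (auto simp: hom_def)
      ultimately show ?thesis by simp
    qed
    then show "is_pullback C f u q r \<and> a = Dom C q"
      using cn f u fu unfolding is_pullback_def by (auto simp: hom_def)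
  next
    assume "is_pullback C f u q r \<and> a = Dom C q"
    then have pb: "is_pullback C f u q r" and a: "a = Dom C q" by auto
    then have cn: "r \<in> hom C a (Dom C f)" "q \<in> hom C a (Dom C u)" "Comp C f r = Comp C u q" "a \<in> Obj C"
      unfolding is_pullback_def by (auto simp: hom_def)
    have "\<exists>!h. h \<in> hom C b a \<and> (\<forall>i\<in>Obj cospan_shape. Comp C (cospan_legs C f q r i) h = m i)"
      if "cone cospan_shape C (cospan C f u) b m" for b m
    proof -
      have m: "m 0 \<in> hom C b (Dom C f)" "m 1 \<in> hom C b (Dom C u)" "m 2 = Comp C f (m 0)"
        "Comp C f (m 0) = Comp C u (m 1)" using that unfolding cone_cospan_iff[OF f u fu] by auto
      have "\<exists>!h. h \<in> hom C b a \<and> Comp C q h = m 1 \<and> Comp C r h = m 0"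
        using is_pullback_lift[OF pb m(1,2,4)] unfolding a .
      moreover have "h \<in> hom C b a \<and> (\<forall>i\<in>Obj cospan_shape. Comp C (cospan_legs C f q r i) h = m i) \<longleftrightarrow>
          h \<in> hom C b a \<and> Comp C q h = m 1 \<and> Comp C r h = m 0" for h
        using commutes[OF _ cn(2,1) m(3)] by blast
      ultimately show ?thesis by simp
    qed
    then show "limit_cone cospan_shape C (cospan C f u) a (cospan_legs C f q r)"
      unfolding limit_cone_def cone_cospan_iff[OF f u fu] legs using cn by auto
  qed
qed

end

lemma (in functor_between) preserves_pullbacks:
  assumes pres: "preserves_finite_limits D C p" and pb: "is_pullback D f u q r"
  shows "is_pullback C (ArM p f) (ArM p u) (ArM p q) (ArM p r)"
proof -
  have ar: "f \<in> Arr D" "u \<in> Arr D" "Cod D f = Cod D u" "q \<in> Arr D" "r \<in> Arr D" "Cod D r = Dom D f"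
    using pb unfolding is_pullback_def by auto
  have "limit_cone cospan_shape D (cospan D f u) (Dom D q) (cospan_legs D f q r)"
    using D.limit_cone_cospan_iff[OF ar(1,2,3)] pb by blast
  then have "limit_cone cospan_shape C (fcomp p (cospan D f u)) (ObM p (Dom D q))
      (\<lambda>i. ArM p (cospan_legs D f q r i))"
    using pres finite_category_cospan_shape D.is_functor_cospan[OF ar(1,2,3)]
    unfolding preserves_finite_limits_def by blast
  moreover have "fcomp p (cospan D f u) = cospan C (ArM p f) (ArM p u)"
    using ar by (auto simp: fcomp_def cospan_def Let_def)
  moreover have "(\<lambda>i. ArM p (cospan_legs D f q r i)) = cospan_legs C (ArM p f) (ArM p q) (ArM p r)"
    using ar by (auto simp: cospan_legs_def)
  ultimately show ?thesis
    using C.limit_cone_cospan_iff[of "ArM p f" "ArM p u"] ar by simp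
qed

section \<open>Locally cartesian arrows are local on the codomain\<close>

context universe_comorphism
begin

lemma locally_factors_through_cover:
  assumes W: "covering_family D K d W" and d: "d \<in> Obj D" and h: "h \<in> hom D x d"
  shows "D.locally x (\<lambda>w. \<exists>u\<in>W. \<exists>t\<in>Arr D. Cod D t = Dom D u \<and> Comp D h w = Comp D u t)"
  using D.locally_pullback[of h] D.locally_covering_family[OF W d] h by (auto simp: hom_def)

text \<open>Locally, two arrows into \<open>d'\<close> with a common composite into \<open>d\<close> lift to the pullback of \<open>f\<close> along
  a member of the cover. The lifts have the same image under \<open>p\<close>, because \<open>p\<close> preserves the pullback.\<close>

lemma locally_injective_lifts_if_on_cover:
  assumes pres: "preserves_finite_limits D C p" and f: "f \<in> Arr D" and W: "covering_family D K (Cod D f) W"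
    and pb: "\<And>u. u \<in> W \<Longrightarrow> \<exists>q r. is_pullback D f u q r \<and> locally_injective_lifts q"
  shows "locally_injective_lifts f"
  unfolding locally_injective_lifts_def
proof (intro ballI impI)
  fix x m m'
  assume x: "x \<in> Obj D" and m: "m \<in> hom D x (Dom D f)" and m': "m' \<in> hom D x (Dom D f)"
    and fm: "Comp D f m = Comp D f m'" and pm: "ArM p m = ArM p m'"
  have h: "Comp D f m \<in> hom D x (Cod D f)" using comp_hom_D[OF m hom_selfI[OF f]] .
  show "D.locally x (\<lambda>w. Comp D m w = Comp D m' w)"
  proof (rule D.locally_bind[OF x locally_factors_through_cover[OF W D.cod_obj[OF f] h]])
    fix w
    assume w: "w \<in> Arr D" "Cod D w = x"
      and "\<exists>u\<in>W. \<exists>t\<in>Arr D. Cod D t = Dom D u \<and> Comp D (Comp D f m) w = Comp D u t"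
    then obtain u t where u: "u \<in> W" and t: "t \<in> Arr D" "Cod D t = Dom D u"
      and ut: "Comp D (Comp D f m) w = Comp D u t" by blast
    obtain q r where sq: "is_pullback D f u q r" and q: "locally_injective_lifts q" using pb[OF u] by blast
    note sqh = is_pullback_hom[OF sq] and sqC = preserves_pullbacks[OF pres sq]
    have wh: "w \<in> hom D (Dom D w) x" and y: "Dom D w \<in> Obj D" using w by (auto simp: hom_def)
    have mw: "Comp D m w \<in> hom D (Dom D w) (Dom D f)" "Comp D m' w \<in> hom D (Dom D w) (Dom D f)"
      using comp_hom_D[OF wh] m m' by auto
    have feq: "Comp D f (Comp D m w) = Comp D u t" "Comp D f (Comp D m' w) = Comp D u t"
      using ut fm m m' w f D.comp_assoc[of w m f] D.comp_assoc[of w m' f] by (auto simp: hom_def)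
    have "Dom D (Comp D u t) = Dom D t" using sqh(2) t by (simp add: hom_def)
    moreover have "Dom D (Comp D f (Comp D m w)) = Dom D w" using mw f by (simp add: hom_def)
    ultimately have th: "t \<in> hom D (Dom D w) (Dom D u)" using feq t by (simp add: hom_def)
    obtain n where n: "n \<in> hom D (Dom D w) (Dom D q)" "Comp D q n = t" "Comp D r n = Comp D m w"
      using is_pullback_lift[OF sq mw(1) th feq(1)] by blast
    obtain n' where n': "n' \<in> hom D (Dom D w) (Dom D q)" "Comp D q n' = t" "Comp D r n' = Comp D m' w"
      using is_pullback_lift[OF sq mw(2) th feq(2)] by blast
    have pn: "ArM p n \<in> hom C (ObM p (Dom D w)) (Dom C (ArM p q)) \<and>
        Comp C (ArM p q) (ArM p n) = ArM p t \<and> Comp C (ArM p r) (ArM p n) = Comp C (ArM p m) (ArM p w)"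
      using n sqh m w comp_p[of n q] comp_p[of n r] comp_p[of w m] by (auto simp: hom_def)
    have pn': "ArM p n' \<in> hom C (ObM p (Dom D w)) (Dom C (ArM p q)) \<and>
        Comp C (ArM p q) (ArM p n') = ArM p t \<and> Comp C (ArM p r) (ArM p n') = Comp C (ArM p m) (ArM p w)"
      using n' sqh m' w pm comp_p[of n' q] comp_p[of n' r] comp_p[of w m'] by (auto simp: hom_def)
    have "\<exists>!k. k \<in> hom C (ObM p (Dom D w)) (Dom C (ArM p q)) \<and>
        Comp C (ArM p q) k = ArM p t \<and> Comp C (ArM p r) k = Comp C (ArM p m) (ArM p w)"
    proof (rule is_pullback_lift[OF sqC])
      show "Comp C (ArM p m) (ArM p w) \<in> hom C (ObM p (Dom D w)) (Dom C (ArM p f))"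
        using m w f by (auto simp: hom_def)
      show "ArM p t \<in> hom C (ObM p (Dom D w)) (Dom C (ArM p u))" using th sqh(2) by (auto simp: hom_def)
      have "ArM p (Comp D f (Comp D m w)) = ArM p (Comp D u t)" using feq by simp
      then show "Comp C (ArM p f) (Comp C (ArM p m) (ArM p w)) = Comp C (ArM p u) (ArM p t)"
        using m w f t sqh(2) by (auto simp: hom_def)
    qed
    then have "ArM p n = ArM p n'" using pn pn' by blast
    then have "D.locally (Dom D w) (\<lambda>v. Comp D n v = Comp D n' v)"
      using q[unfolded locally_injective_lifts_def, rule_format, OF y n(1) n'(1)] n(2) n'(2) by simp
    then show "D.locally (Dom D w) (\<lambda>v. Comp D m (Comp D w v) = Comp D m' (Comp D w v))"
    proof (rule D.locally_mono[OF _ y])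
      fix v assume v: "v \<in> Arr D" "Cod D v = Dom D w" "Comp D n v = Comp D n' v"
      have "Comp D m (Comp D w v) = Comp D (Comp D r n) v" "Comp D m' (Comp D w v) = Comp D (Comp D r n') v"
        unfolding n(3) n'(3) using v w m m' by (auto simp: hom_def D.comp_assoc)
      then show "Comp D m (Comp D w v) = Comp D m' (Comp D w v)"
        using v n(1) n'(1) sqh(4) by (simp add: hom_def D.comp_assoc)
    qed
  qed
qed

text \<open>Locally, \<open>h\<close> factors as \<open>u \<circ> t\<close> with \<open>u\<close> in the cover, and as \<open>p\<close> preserves the pullback, \<open>p t\<close>
  and \<open>k\<close> determine an arrow \<open>k'\<close> into its image. The pair \<open>(t, k')\<close> is compatible for the pullback
  \<open>q\<close> of \<open>f\<close> along \<open>u\<close>, and composing its local lifts with the projection \<open>r\<close> lifts \<open>(h, k)\<close>.\<close>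

lemma locally_surjective_lifts_if_on_cover:
  assumes pres: "preserves_finite_limits D C p" and f: "f \<in> Arr D" and W: "covering_family D K (Cod D f) W"
    and pb: "\<And>u. u \<in> W \<Longrightarrow> \<exists>q r. is_pullback D f u q r \<and> locally_surjective_lifts q"
  shows "locally_surjective_lifts f"
  unfolding locally_surjective_lifts_def
proof (intro ballI impI)
  fix x h k
  assume x: "x \<in> Obj D" and h: "h \<in> hom D x (Cod D f)"
    and k: "k \<in> hom C (ObM p x) (ObM p (Dom D f))" and ph: "ArM p h = Comp C (ArM p f) k"
  show "D.locally x (\<lambda>w. \<exists>n\<in>hom D (Dom D w) (Dom D f).
      Comp D f n = Comp D h w \<and> ArM p n = Comp C k (ArM p w))"
  proof (rule D.locally_bind[OF x locally_factors_through_cover[OF W D.cod_obj[OF f] h]])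
    fix w
    assume w: "w \<in> Arr D" "Cod D w = x"
      and "\<exists>u\<in>W. \<exists>t\<in>Arr D. Cod D t = Dom D u \<and> Comp D h w = Comp D u t"
    then obtain u t where u: "u \<in> W" and t: "t \<in> Arr D" "Cod D t = Dom D u"
      and ut: "Comp D h w = Comp D u t" by blast
    obtain q r where sq: "is_pullback D f u q r" and q: "locally_surjective_lifts q" using pb[OF u] by blast
    note sqh = is_pullback_hom[OF sq] and sqC = preserves_pullbacks[OF pres sq]
    have y: "Dom D w \<in> Obj D" using w by simp
    have "Dom D (Comp D u t) = Dom D t" using sqh(2) t by (simp add: hom_def)
    moreover have "Dom D (Comp D h w) = Dom D w" using h w by (simp add: hom_def)
    ultimately have th: "t \<in> hom D (Dom D w) (Dom D u)" using ut t by (simp add: hom_def)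
    have "\<exists>!k'. k' \<in> hom C (ObM p (Dom D w)) (Dom C (ArM p q)) \<and>
        Comp C (ArM p q) k' = ArM p t \<and> Comp C (ArM p r) k' = Comp C k (ArM p w)"
    proof (rule is_pullback_lift[OF sqC])
      show "Comp C k (ArM p w) \<in> hom C (ObM p (Dom D w)) (Dom C (ArM p f))"
        using k w f by (auto simp: hom_def)
      show "ArM p t \<in> hom C (ObM p (Dom D w)) (Dom C (ArM p u))" using th sqh(2) by (auto simp: hom_def)
      have "Comp C (ArM p f) (Comp C k (ArM p w)) = Comp C (ArM p h) (ArM p w)"
        unfolding ph using k w f by (auto simp: hom_def C.comp_assoc)
      also have "\<dots> = ArM p (Comp D u t)" using h w by (simp add: hom_def flip: ut)
      also have "\<dots> = Comp C (ArM p u) (ArM p t)" using t sqh(2) by (simp add: hom_def)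
      finally show "Comp C (ArM p f) (Comp C k (ArM p w)) = Comp C (ArM p u) (ArM p t)" .
    qed
    then obtain k' where k': "k' \<in> hom C (ObM p (Dom D w)) (Dom C (ArM p q))"
      "Comp C (ArM p q) k' = ArM p t" "Comp C (ArM p r) k' = Comp C k (ArM p w)" by blast
    have qa: "q \<in> Arr D" "Cod D q = Dom D u" using sqh(3) by (auto simp: hom_def)
    have "D.locally (Dom D w) (\<lambda>v. \<exists>n\<in>hom D (Dom D v) (Dom D q).
        Comp D q n = Comp D t v \<and> ArM p n = Comp C k' (ArM p v))"
      using q[unfolded locally_surjective_lifts_def, rule_format, OF y, of t k'] th k'(1,2) qa by simp
    then show "D.locally (Dom D w) (\<lambda>v. \<exists>n\<in>hom D (Dom D (Comp D w v)) (Dom D f).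
        Comp D f n = Comp D h (Comp D w v) \<and> ArM p n = Comp C k (ArM p (Comp D w v)))"
    proof (rule D.locally_mono[OF _ y])
      fix v assume v: "v \<in> Arr D" "Cod D v = Dom D w"
        and "\<exists>n\<in>hom D (Dom D v) (Dom D q). Comp D q n = Comp D t v \<and> ArM p n = Comp C k' (ArM p v)"
      then obtain n where n: "n \<in> hom D (Dom D v) (Dom D q)" "Comp D q n = Comp D t v"
        "ArM p n = Comp C k' (ArM p v)" by blast
      have "Comp D f (Comp D r n) = Comp D u (Comp D q n)"
        using n(1) sqh D.comp_assoc[of n r f] D.comp_assoc[of n q u] by (simp add: hom_def)
      also have "\<dots> = Comp D (Comp D u t) v" unfolding n(2) using v th sqh(2) by (simp add: hom_def D.comp_assoc)
      also have "\<dots> = Comp D h (Comp D w v)" unfolding ut[symmetric] using v w h by (simp add: hom_def D.comp_assoc)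
      finally have 1: "Comp D f (Comp D r n) = Comp D h (Comp D w v)" .
      have "ArM p (Comp D r n) = Comp C (ArM p r) (Comp C k' (ArM p v))"
        using n(1,3) sqh(4) by (simp add: hom_def)
      also have "\<dots> = Comp C (Comp C (ArM p r) k') (ArM p v)"
        using k'(1) v sqh(3,4) by (simp add: hom_def C.comp_assoc)
      also have "\<dots> = Comp C k (ArM p (Comp D w v))"
        unfolding k'(3) using k v w by (simp add: hom_def C.comp_assoc)
      finally have 2: "ArM p (Comp D r n) = Comp C k (ArM p (Comp D w v))" .
      have "Comp D r n \<in> hom D (Dom D (Comp D w v)) (Dom D f)"
        using comp_hom_D[OF n(1) sqh(4)] v w by simp
      then show "\<exists>n\<in>hom D (Dom D (Comp D w v)) (Dom D f).
          Comp D f n = Comp D h (Comp D w v) \<and> ArM p n = Comp C k (ArM p (Comp D w v))"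
        using 1 2 by blast
    qed
  qed
qed

lemma K_cartesian_of_locally_cartesian:
  assumes f: "f \<in> Arr D" and lc: "locally_cartesian TYPE('u) D K C J p f"
  shows "K_cartesian TYPE('u) D K C J p f"
proof -
  have d: "Dom D f \<in> Obj D" "Cod D f \<in> Obj D" using f by auto
  have "generated_sieve D {Id D (Cod D f)} = {g \<in> Arr D. Cod D g = Cod D f}"
  proof (intro equalityI subsetI)
    fix g assume "g \<in> {g \<in> Arr D. Cod D g = Cod D f}"
    then have "g = Comp D (Id D (Cod D f)) g \<and> g \<in> Arr D \<and> Cod D g = Dom D (Id D (Cod D f))"
      using d by auto
    then show "g \<in> generated_sieve D {Id D (Cod D f)}" unfolding generated_sieve_def by blast
  qed (use d in \<open>auto simp: generated_sieve_def\<close>)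
  then have "covering_family D K (Cod D f) {Id D (Cod D f)}"
    using D.covering_max[OF d(2)] d by (auto simp: covering_family_def)
  moreover have "is_pullback D f (Id D (Cod D f)) f (Id D (Dom D f))"
    by (subst is_pullback_iff[of f D "Dom D f" "Cod D f" _ "Cod D f" _ "Dom D f"])
       (use f d in \<open>auto simp: hom_def\<close>)
  ultimately show ?thesis
    unfolding K_cartesian_def using f lc by blast
qed

lemma locally_cartesian_of_K_cartesian:
  assumes pres: "preserves_finite_limits D C p" and f: "f \<in> Arr D" and "K_cartesian TYPE('u) D K C J p f"
  shows "locally_cartesian TYPE('u) D K C J p f"
proof -
  obtain W where W: "covering_family D K (Cod D f) W"
    and pb: "\<And>u. u \<in> W \<Longrightarrow> \<exists>q r. is_pullback D f u q r \<and> locally_cartesian TYPE('u) D K C J p q"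
    using assms(3) unfolding K_cartesian_def by blast
  have "\<exists>q r. is_pullback D f u q r \<and> locally_injective_lifts q \<and> locally_surjective_lifts q" if "u \<in> W" for u
    using pb[OF that] locally_cartesian_iff_lifts unfolding is_pullback_def by metis
  then show ?thesis
    using locally_cartesian_iff_lifts[OF f] locally_injective_lifts_if_on_cover[OF pres f W]
      locally_surjective_lifts_if_on_cover[OF pres f W] by metis
qed

end

theorem proposition4p1p3:
  fixes D :: "('od, 'ad) category" and K :: "'od \<Rightarrow> 'ad set set"
    and C :: "('oc, 'ac) category" and J :: "'oc \<Rightarrow> 'ac set set"
    and p :: "('od, 'ad, 'oc, 'ac) func"
  assumes "infinite (UNIV :: 'u set)"
    and "cartesian_local_fibration TYPE('u) D K C J p"
    and "f \<in> Arr D"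
  shows "locally_cartesian TYPE('u) D K C J p f \<longleftrightarrow> K_cartesian TYPE('u) D K C J p f"
proof -
  have com: "comorphism_of_sites TYPE('u) D K C J p" and pres: "preserves_finite_limits D C p"
    using assms(2) unfolding cartesian_local_fibration_def local_fibration_def by blast+
  have sites: "site TYPE('u) D K" "site TYPE('u) C J"
    and functor_p: "is_functor D C p"
    and cov: "\<forall>d\<in>Obj D. \<forall>S\<in>J (ObM p d). \<exists>R\<in>K d. ArM p ` R \<subseteq> S"
    using com unfolding comorphism_of_sites_def by blast+
  interpret D: universe_site D K "TYPE('u)"
    by unfold_locales (use sites(1) assms(1) in \<open>auto simp: site_def\<close>)
  interpret C: universe_site C J "TYPE('u)"
    by unfold_locales (use sites(2) assms(1) in \<open>auto simp: site_def\<close>)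
  interpret universe_comorphism D K C J "TYPE('u)" p
    by unfold_locales (use functor_p cov in blast)+
  show ?thesis
    using K_cartesian_of_locally_cartesian[OF assms(3)] locally_cartesian_of_K_cartesian[OF pres assms(3)]
    by blast
qed

end
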